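(* An imprimitive quaternionic reflection group of rank two can have more than one system of imprimitivity only if $H=1$ or $H=C_2$, i.e., every reflection in it has order two. This is not a sufficient condition; for example, $G_{\mathcal I}(L_{20}^{\mathcal I},1)$ and $G_{\mathcal I}(L_{20}^{\mathcal I},C_2)$ have just one system of imprimitivity. The number of systems of imprimitivity of an imprimitive quaternionic reflection group of rank two is one of the following, with the groups counted up to conjugacy in $\mathrm{GL}(\mathbb{H}^2)$: one (infinitely many cases); two (three cases); three (three infinite families, namely $G(n,1,n,2)$ with $n$ odd; $G(n,1,\frac n2,2)$ with $n$ even, $n\neq2$; and $G(n,2,\frac n2,1)$ with $n$ even and $\frac n2$ odd); five (one case); infinite (three cases).
   Context: $\mathbb{H}$ denotes the quaternions with standard units $i,j,k$; $\mathbb{H}^2$ is a right vector space (matrices act on the left). A system of imprimitivity of a group $G\subset\mathrm{GL}(\mathbb{H}^2)$ is an unordered pair $\{V_1,V_2\}$ of one-dimensional subspaces with $\mathbb{H}^2=V_1\oplus V_2$ which is permuted by every element of $G$. A reflection is a linear map of finite order, not the identity, which fixes a one-dimensional subspace pointwise. For sets $\mathcal{L},\mathcal{H}$ of unit quaternions, $$\mathcal{G}(\mathcal{L},\mathcal{H}):=\Bigl\langle \bigl\{\begin{pmatrix}0&\beta\\ \overline{\beta}&0\end{pmatrix}\bigr\}_{\beta\in\mathcal{L}}\cup\bigl\{\begin{pmatrix}h&0\\0&1\end{pmatrix}\bigr\}_{h\in\mathcal{H}}\Bigr\rangle .$$ For such a group, $H$ denotes the set of all $h$ for which $\begin{pmatrix}h&0\\0&1\end{pmatrix}$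 belongs to the group, and $C_2=\{\pm1\}$. The imprimitive quaternionic reflection groups of rank two are (up to conjugacy in $\mathrm{GL}(\mathbb{H}^2)$) the following groups, where $\omega=e^{\pi i/n}$, $\mathcal{D}_n=\langle\omega,j\rangle$, $\tau=\frac{1+\sqrt5}{2}$, $\sigma=1-\tau$, $w=\frac{1+i+j+k}{2}$, $v=\frac{\tau+\sigma i-j}{2}$. Dicyclic case ($n\ge2$): $\mathcal{G}(\{1,\omega,j,\omega j\},\{\omega,j\})$ (with $H=\mathcal{D}_n$); $\mathcal{G}(\{1,\omega,j,\omega j\},\{j\})$ for $n$ even, $n\ge4$ (with $H=\mathcal{D}_{n/2}$); and $G(n,a,b,r)=\mathcal{G}(\{1,\omega^a,j,\omega^bj\},\{\omega^{2n/r}\})$ (with $H=C_r$ cyclic of order $r$) for $[n,a,b,r]\in\Lambda_n^*=\Lambda_n\setminus\{[n,1,n,1]\}$, where $\Omega_n=\{(a,b):1\le a\le b\le n,\ a\mid n,\ b\mid n,\ \gcd(a,b)=1\}$ and $\Lambda_n=\bigcup_{(a,b)\in\Omega_n}\{[n,a,b,\frac{n}{ab}]\}\cup\bigcup_{(a,b)\in\Omega_n,\ ab\text{ odd}}\{[n,a,b,\frac{2n}{ab}]\}$. In the three infinite families of the claim only indices belonging to $\Lambda_n^*$ are meant. Case $\mathcal{T}$: $G_{\mathcal T}(\mathcal T,\mathcal T)=\mathcal{G}(\{1,i\},\{w\})$; $G_{\mathcal T}(\mathcal T,Q_8)=\mathcal{G}(\{1,i,j,w\},\{\})$; $G_{\mathcal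 T}(L_{12}^{\mathcal T},C_2)=\mathcal{G}(\{1,i,w\},\{-1\})$; $G_{\mathcal T}(L_{12}^{\mathcal T},1)=\mathcal{G}(\{1,i,w\},\{\})$. Case $\mathcal{O}$: $G_{\mathcal O}(\mathcal O,\mathcal O)=\mathcal{G}(\{1,w\},\{\frac{1+i}{\sqrt2}\})$; $G_{\mathcal O}(\mathcal O,\mathcal T)=\mathcal{G}(\{1,\frac{1+i}{\sqrt2},\frac{1+j}{\sqrt2},w\},\{\})$; $G_{\mathcal O}(L_{32}^{\mathcal O},Q_8)=\mathcal{G}(\{1,\frac{1+i}{\sqrt2},j,w\},\{\})$; $G_{\mathcal O}(L_{20}^{\mathcal O},C_2)=\mathcal{G}(\{1,\frac{1+i}{\sqrt2},w,\frac{j-k}{\sqrt2}\},\{\})$; $G_{\mathcal O}(L_{18}^{\mathcal O},1)=\mathcal{G}(\{1,\frac{1+i}{\sqrt2},w\},\{\})$; $G_{\mathcal O}(L_{14}^{\mathcal O},1)=\mathcal{G}(\{1,i,w,\frac{j-k}{\sqrt2}\},\{\})$. Case $\mathcal{I}$: $G_{\mathcal I}(\mathcal I,\mathcal I)=\mathcal{G}(\{1,i,w,v\},\{\})$; $G_{\mathcal I}(L_{32}^{\mathcal I},C_2)=\mathcal{G}(\{1,w,v,\frac{j-\tau i-\sigma k}{2}\},\{\})$; $G_{\mathcal I}(L_{30}^{\mathcal I},1)=\mathcal{G}(\{1,w,v\},\{\})$; $G_{\mathcal I}(L_{20}^{\mathcal I},C_2)=\mathcal{G}(\{1,i,w,\frac{i+\sigma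 j+\tau k}{2}\},\{-1\})$; $G_{\mathcal I}(L_{20}^{\mathcal I},1)=\mathcal{G}(\{1,i,w,\frac{i+\sigma j+\tau k}{2}\},\{\})$. In each $G_K(L,H)$ the second argument is the group $H$ ($Q_8$ the quaternion group). The only conjugate pair among the listed groups is $G_{\mathcal T}(L_{12}^{\mathcal T},C_2)\cong G_{\mathcal O}(L_{14}^{\mathcal O},1)$. *)

theory Defs
  imports "HOL-Analysis.Analysis" "HOL-Algebra.Generated_Groups" "HOL-Algebra.Multiplicative_Group"
begin

section \<open>Quaternions\<close>

datatype quat = Quat (qre: real) (qi: real) (qj: real) (qk: real)

instantiation quat :: division_ring
begin

definition "0 = Quat 0 0 0 0"
definition "1 = Quat 1 0 0 0"
definition "p + q = Quat (qre p + qre q) (qi p + qi q) (qj p + qj q) (qk p + qk q)"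
definition "p - q = Quat (qre p - qre q) (qi p - qi q) (qj p - qj q) (qk p - qk q)"
definition "- q = Quat (- qre q) (- qi q) (- qj q) (- qk q)"
definition "p * q = Quat
  (qre p * qre q - qi p * qi q - qj p * qj q - qk p * qk q)
  (qre p * qi q + qi p * qre q + qj p * qk q - qk p * qj q)
  (qre p * qj q - qi p * qk q + qj p * qre q + qk p * qi q)
  (qre p * qk q + qi p * qj q - qj p * qi q + qk p * qre q)"
definition "inverse q =
  (let N = (qre q)\<^sup>2 + (qi q)\<^sup>2 + (qj q)\<^sup>2 + (qk q)\<^sup>2
   in Quat (qre q / N) (- qi q / N) (- qj q / N) (- qk q / N))"
definition "p div q = p * inverse (q :: quat)"

lemmas quat_arith_defs = zero_quat_def one_quat_def plus_quat_def minus_quat_def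
  uminus_quat_def times_quat_def

lemma quat_norm_sq_pos:
  assumes "q \<noteq> (0 :: quat)"
  shows "(qre q)\<^sup>2 + (qi q)\<^sup>2 + (qj q)\<^sup>2 + (qk q)\<^sup>2 > 0"
proof -
  have "qre q \<noteq> 0 \<or> qi q \<noteq> 0 \<or> qj q \<noteq> 0 \<or> qk q \<noteq> 0"
    using assms by (cases q) (auto simp: zero_quat_def)
  then have "(qre q)\<^sup>2 > 0 \<or> (qi q)\<^sup>2 > 0 \<or> (qj q)\<^sup>2 > 0 \<or> (qk q)\<^sup>2 > 0"
    by simp
  moreover have "(qre q)\<^sup>2 \<ge> 0" "(qi q)\<^sup>2 \<ge> 0" "(qj q)\<^sup>2 \<ge> 0" "(qk q)\<^sup>2 \<ge> 0"
    by simp_all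
  ultimately show ?thesis by linarith
qed

instance
proof
  fix a b c :: quat
  show "a * b * c = a * (b * c)"
    by (simp add: quat_arith_defs algebra_simps)
  show "(a + b) * c = a * c + b * c" "a * (b + c) = a * b + a * c"
    by (simp_all add: quat_arith_defs algebra_simps)
  show "a + b + c = a + (b + c)" "a + b = b + a" "0 + a = a" "- a + a = 0" "a - b = a + - b"
    "1 * a = a" "a * 1 = a" "(0::quat) \<noteq> 1"
    by (simp_all add: quat_arith_defs)
  show "a div b = a * inverse b" by (fact divide_quat_def)
  show "inverse (0::quat) = 0" by (simp add: inverse_quat_def zero_quat_def)
  assume "a \<noteq> 0"
  define N where "N = (qre a)\<^sup>2 + (qi a)\<^sup>2 + (qj a)\<^sup>2 + (qk a)\<^sup>2"
  have N: "N > 0" unfolding N_def by (rule quat_norm_sq_pos [OF \<open>a \<noteq> 0\<close>])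
  have inv: "inverse a = Quat (qre a / N) (- qi a / N) (- qj a / N) (- qk a / N)"
    by (simp add: inverse_quat_def N_def Let_def)
  have one: "(qre a * qre a + qi a * qi a + qj a * qj a + qk a * qk a) / N = 1"
    using N by (simp add: N_def power2_eq_square)
  show "inverse a * a = 1" "a * inverse a = 1"
    using one by (simp_all add: inv quat_arith_defs add_divide_distrib mult.commute)
qed

end

definition qcnj :: "quat \<Rightarrow> quat" where
  "qcnj q = Quat (qre q) (- qi q) (- qj q) (- qk q)"

definition ii :: quat where "ii = Quat 0 1 0 0"
definition jj :: quat where "jj = Quat 0 0 1 0"
definition kk :: quat where "kk = Quat 0 0 0 1"


section \<open>The general linear group of the right vector space of quaternionic columns\<close>

definition GLH2 :: "(quat^2^2) monoid" where
  "GLH2 = \<lparr>carrier = {A. invertible A}, mult = (**), one = mat 1\<rparr>"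

lemma group_GLH2: "group GLH2"
proof (rule groupI)
  fix A B assume "A \<in> carrier GLH2" "B \<in> carrier GLH2"
  then obtain A' B' where "A ** A' = mat 1" "A' ** A = mat 1" "B ** B' = mat 1" "B' ** B = mat 1"
    unfolding GLH2_def invertible_def by auto
  then have "(A ** B) ** (B' ** A') = mat 1" "(B' ** A') ** (A ** B) = mat 1"
    by (metis matrix_mul_assoc matrix_mul_rid)+
  then show "A \<otimes>\<^bsub>GLH2\<^esub> B \<in> carrier GLH2"
    unfolding GLH2_def invertible_def by auto
next
  show "\<one>\<^bsub>GLH2\<^esub> \<in> carrier GLH2"
    unfolding GLH2_def invertible_def by (auto intro!: exI [of _ "mat 1"])
qed (auto simp: GLH2_def matrix_mul_assoc invertible_def)

definition rscale :: "quat^2 \<Rightarrow> quat \<Rightarrow> quat^2" where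
  "rscale v q = (\<chi> m. v $ m * q)"

definition one_dim_subspace :: "(quat^2) set \<Rightarrow> bool" where
  "one_dim_subspace V \<longleftrightarrow> (\<exists>v. v \<noteq> 0 \<and> V = range (rscale v))"

definition direct_decomposition :: "(quat^2) set \<Rightarrow> (quat^2) set \<Rightarrow> bool" where
  "direct_decomposition V W \<longleftrightarrow> V \<inter> W = {0} \<and> {x + y | x y. x \<in> V \<and> y \<in> W} = UNIV"

definition systems_of_imprimitivity :: "(quat^2^2) set \<Rightarrow> (quat^2) set set set" where
  "systems_of_imprimitivity G =
     {S. \<exists>V W. S = {V, W} \<and> one_dim_subspace V \<and> one_dim_subspace W \<and> direct_decomposition V W \<and>
         (\<forall>g\<in>G. (\<lambda>U. (*v) g ` U) ` S = S)}"

text \<open>The order function \<^const>\<open>group.ord\<close> takes the value zero on elements of infinite order.\<close>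

definition is_reflection :: "quat^2^2 \<Rightarrow> bool" where
  "is_reflection r \<longleftrightarrow> r \<in> carrier GLH2 \<and> group.ord GLH2 r \<noteq> 0 \<and> r \<noteq> mat 1 \<and>
     (\<exists>V. one_dim_subspace V \<and> (\<forall>v\<in>V. r *v v = v))"

definition conjugate_GLH2 :: "(quat^2^2) set \<Rightarrow> (quat^2^2) set \<Rightarrow> bool" where
  "conjugate_GLH2 G K \<longleftrightarrow>
     (\<exists>P \<in> carrier GLH2. G = (\<lambda>A. P ** A ** inv\<^bsub>GLH2\<^esub> P) ` K)"


section \<open>The imprimitive quaternionic reflection groups of rank two\<close>

definition antidiag :: "quat \<Rightarrow> quat^2^2" where
  "antidiag b = vector [vector [0, b], vector [qcnj b, 0]]"

definition diag1 :: "quat \<Rightarrow> quat^2^2" where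
  "diag1 h = vector [vector [h, 0], vector [0, 1]]"

definition refl_group :: "quat set \<Rightarrow> quat set \<Rightarrow> (quat^2^2) set" where
  "refl_group L H = generate GLH2 (antidiag ` L \<union> diag1 ` H)"

definition H_of :: "(quat^2^2) set \<Rightarrow> quat set" where
  "H_of G = {h. diag1 h \<in> G}"

definition omega :: "nat \<Rightarrow> quat" where
  "omega n = Quat (cos (pi / real n)) (sin (pi / real n)) 0 0"

definition tau :: real where "tau = (1 + sqrt 5) / 2"
definition sigma :: real where "sigma = 1 - tau"

definition ww :: quat where "ww = Quat (1/2) (1/2) (1/2) (1/2)"
definition vv :: quat where "vv = Quat (tau/2) (sigma/2) (-1/2) 0"

definition G_dic_full :: "nat \<Rightarrow> (quat^2^2) set" where
  "G_dic_full n = refl_group {1, omega n, jj, omega n * jj} {omega n, jj}"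

definition G_dic_half :: "nat \<Rightarrow> (quat^2^2) set" where
  "G_dic_half n = refl_group {1, omega n, jj, omega n * jj} {jj}"

definition G_dic :: "nat \<Rightarrow> nat \<Rightarrow> nat \<Rightarrow> nat \<Rightarrow> (quat^2^2) set" where
  "G_dic n a b r = refl_group {1, omega n ^ a, jj, omega n ^ b * jj} {omega n ^ (2 * n div r)}"

definition Omega_index :: "nat \<Rightarrow> (nat \<times> nat) set" where
  "Omega_index n = {(a, b). 1 \<le> a \<and> a \<le> b \<and> b \<le> n \<and> a dvd n \<and> b dvd n \<and> gcd a b = 1}"

text \<open>The divisions below are exact: \<open>a\<close> and \<open>b\<close> are coprime divisors of \<open>n\<close>, so \<open>a * b\<close> divides
  \<open>n\<close>, and each resulting \<open>r\<close> divides \<open>2 * n\<close>.\<close>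

definition Lambda_index :: "nat \<Rightarrow> (nat \<times> nat \<times> nat \<times> nat) set" where
  "Lambda_index n =
     {(n, a, b, n div (a * b)) | a b. (a, b) \<in> Omega_index n} \<union>
     {(n, a, b, 2 * n div (a * b)) | a b. (a, b) \<in> Omega_index n \<and> odd (a * b)}"

definition Lambda_star :: "nat \<Rightarrow> (nat \<times> nat \<times> nat \<times> nat) set" where
  "Lambda_star n = Lambda_index n - {(n, 1, n, 1)}"

definition "G_T_T_T = refl_group {1, ii} {ww}"
definition "G_T_T_Q8 = refl_group {1, ii, jj, ww} {}"
definition "G_T_L12_C2 = refl_group {1, ii, ww} {-1}"
definition "G_T_L12_1 = refl_group {1, ii, ww} {}"

definition "G_O_O_O = refl_group {1, ww} {Quat (1/sqrt 2) (1/sqrt 2) 0 0}"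
definition "G_O_O_T =
  refl_group {1, Quat (1/sqrt 2) (1/sqrt 2) 0 0, Quat (1/sqrt 2) 0 (1/sqrt 2) 0, ww} {}"
definition "G_O_L32_Q8 = refl_group {1, Quat (1/sqrt 2) (1/sqrt 2) 0 0, jj, ww} {}"
definition "G_O_L20_C2 =
  refl_group {1, Quat (1/sqrt 2) (1/sqrt 2) 0 0, ww, Quat 0 0 (1/sqrt 2) (-1/sqrt 2)} {}"
definition "G_O_L18_1 = refl_group {1, Quat (1/sqrt 2) (1/sqrt 2) 0 0, ww} {}"
definition "G_O_L14_1 = refl_group {1, ii, ww, Quat 0 0 (1/sqrt 2) (-1/sqrt 2)} {}"

definition "G_I_I_I = refl_group {1, ii, ww, vv} {}"
definition "G_I_L32_C2 = refl_group {1, ww, vv, Quat 0 (-tau/2) (1/2) (-sigma/2)} {}"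
definition "G_I_L30_1 = refl_group {1, ww, vv} {}"
definition "G_I_L20_C2 = refl_group {1, ii, ww, Quat 0 (1/2) (sigma/2) (tau/2)} {-1}"
definition "G_I_L20_1 = refl_group {1, ii, ww, Quat 0 (1/2) (sigma/2) (tau/2)} {}"

definition listed_groups :: "(quat^2^2) set set" where
  "listed_groups =
     {G_dic_full n | n. n \<ge> 2} \<union>
     {G_dic_half n | n. even n \<and> n \<ge> 4} \<union>
     {G_dic n a b r | n a b r. n \<ge> 2 \<and> (n, a, b, r) \<in> Lambda_star n} \<union>
     {G_T_T_T, G_T_T_Q8, G_T_L12_C2, G_T_L12_1} \<union>
     {G_O_O_O, G_O_O_T, G_O_L32_Q8, G_O_L20_C2, G_O_L18_1, G_O_L14_1} \<union>
     {G_I_I_I, G_I_L32_C2, G_I_L30_1, G_I_L20_C2, G_I_L20_1}"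

text \<open>By the classification, every imprimitive quaternionic reflection group of rank two is
  conjugate to a listed group; the classification serves as the definition here. The set
  \<^const>\<open>H_of\<close> refers to the monomial form, so it is only used for the listed groups.\<close>

definition imprimitive_quat_refl_groups :: "(quat^2^2) set set" where
  "imprimitive_quat_refl_groups = {G. \<exists>K\<in>listed_groups. conjugate_GLH2 G K}"

definition conj_rel :: "((quat^2^2) set \<times> (quat^2^2) set) set" where
  "conj_rel = {(G, K). G \<in> imprimitive_quat_refl_groups \<and> K \<in> imprimitive_quat_refl_groups \<and>
                       conjugate_GLH2 G K}"

text \<open>Each set of groups \<open>X\<close> below is counted up to conjugacy by the quotient \<open>X // conj_rel\<close>.\<close>

definition groups_with_systems :: "nat \<Rightarrow> (quat^2^2) set set" where
  "groups_with_systems m =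
     {G \<in> imprimitive_quat_refl_groups.
        finite (systems_of_imprimitivity G) \<and> card (systems_of_imprimitivity G) = m}"

definition groups_with_infinitely_many_systems :: "(quat^2^2) set set" where
  "groups_with_infinitely_many_systems =
     {G \<in> imprimitive_quat_refl_groups. infinite (systems_of_imprimitivity G)}"

definition family_odd :: "(quat^2^2) set set" where
  "family_odd = {G_dic n 1 n 2 | n. n \<ge> 2 \<and> odd n \<and> (n, 1, n, 2) \<in> Lambda_star n}"

definition family_even :: "(quat^2^2) set set" where
  "family_even =
     {G_dic n 1 (n div 2) 2 | n. n \<ge> 2 \<and> even n \<and> n \<noteq> 2 \<and> (n, 1, n div 2, 2) \<in> Lambda_star n}"

definition family_half_odd :: "(quat^2^2) set set" where
  "family_half_odd =
     {G_dic n 2 (n div 2) 1 | n. n \<ge> 2 \<and> even n \<and> odd (n div 2) \<and>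
                                 (n, 2, n div 2, 1) \<in> Lambda_star n}"

end

theory Submission
  imports Defs
begin

text \<open>Every line of the right vector space except the second coordinate axis is the graph
  of a left multiplication, so it has a quaternion, its slope, as coordinate; the
  second axis has slope infinity. In this coordinate the reflection \<open>antidiag b\<close>
  acts by \<open>x \<mapsto> qcnj b * inverse x * qcnj b\<close>, and \<open>diag1 h\<close> acts by
  \<open>x \<mapsto> x * qcnj h\<close>. A system of imprimitivity is a pair of distinct slopes
  that each generator fixes or exchanges. All the listed groups contain
  \<open>antidiag 1\<close>, which inverts slopes; hence a system other than the pair of
  coordinate axes is either \<open>{1, -1}\<close> or \<open>{x, inverse x}\<close>. Writing out when another
  generator preserves such a pair gives \<open>systems_refl_group\<close>: for \<open>x\<close> other than
  \<open>\<plusminus>1\<close> the pair \<open>{x, inverse x}\<close> is a system if and only if \<open>x\<close> is pure, each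
  generator \<open>b\<close> is equal to \<open>\<plusminus>x\<close> or has imaginary part orthogonal to \<open>x\<close>, and each
  diagonal generator \<open>h\<close> is 1, or is -1 with \<open>x\<close> of norm one.

  Counting systems is thus linear algebra in three-dimensional space. A diagonal
  generator other than \<open>\<plusminus>1\<close> excludes a second system. In the remaining exceptional
  groups two of the generators confine \<open>x\<close> to the normal of the plane that their
  imaginary parts span. If nothing else is imposed, all nonzero multiples of the
  normal give systems. If there is one further condition, namely the diagonal
  generator -1 or a generator that is a unit vector on the normal, then exactly one
  second system survives. In the other cases a generator in a different direction
  leaves none. For the dicyclic groups \<open>x\<close> lies in the plane of \<open>jj\<close> and \<open>kk\<close>, and
  it exists only if \<open>omega n ^ b * jj\<close> is orthogonal or parallel to \<open>jj\<close>, that is,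
  if \<open>n = 2 * b\<close> or \<open>n = b\<close>. This gives the three families. For \<open>n = 2\<close> all three
  units \<open>ii\<close>, \<open>jj\<close>, \<open>kk\<close> are admissible and \<open>{1, -1}\<close> is a system as well, whence
  five.

  A second system bounds \<open>H\<close>, because \<open>diag1 h\<close> has to fix or exchange its two
  slopes (\<open>two_systems_H_of\<close>). Up to the swap of coordinates every reflection in a
  monomial group is an involution or has the form \<open>diag1 h\<close>, so having only
  reflections of order two amounts to \<open>H\<close> lying in \<open>{1, -1}\<close>, provided that an \<open>H\<close>
  larger than that contains a torsion element other than \<open>\<plusminus>1\<close>. Explicit words
  provide one in the exceptional groups, and in the dicyclic groups all entries are
  torsion. In \<open>G_I_L20_1\<close> and \<open>G_I_L20_C2\<close> the two entries of a diagonal matrix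
  determine each other, up to sign in the second of them, by a ring automorphism
  that involves \<open>\<surd>5 \<mapsto> -\<surd>5\<close>. Therefore \<open>H\<close> is as small as for a group with
  many systems although there is only one system.

  Conjugacy classes are separated by the real part of the trace. Among the
  exceptional groups to be told apart, its values lie in \<open>\<rat>\<close> for the tetrahedral
  ones, include \<open>\<surd>2\<close> but stay in \<open>\<rat>(\<surd>2)\<close> for the octahedral ones, and include the
  golden ratio for the icosahedral ones. In \<open>G_dic n a b r\<close> they form a finite set
  that contains \<open>2 * cos (a * \<pi> / n)\<close>; for fixed \<open>a\<close> infinitely many \<open>n\<close> therefore
  give infinitely many classes. The one coincidence in the list is an explicit
  change of basis to the second system of the octahedral group
  (\<open>conjugate_O_L14_T_L12\<close>).\<close>

section \<open>Quaternions, unit quaternions and two-by-two matrices\<close>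

definition unitq :: "quat \<Rightarrow> bool" where
  "unitq q \<longleftrightarrow> q * qcnj q = 1"

definition imdot :: "quat \<Rightarrow> quat \<Rightarrow> real" where
  "imdot p q = qi p * qi q + qj p * qj q + qk p * qk q"

lemmas quat_simps = quat_arith_defs qcnj_def

lemma unitq_iff: "unitq q \<longleftrightarrow> (qre q)\<^sup>2 + (qi q)\<^sup>2 + (qj q)\<^sup>2 + (qk q)\<^sup>2 = 1"
  by (auto simp: unitq_def quat_simps power2_eq_square algebra_simps)

lemma unitq_left: "unitq q \<Longrightarrow> qcnj q * q = 1"
  by (auto simp: unitq_iff quat_simps power2_eq_square algebra_simps)

lemma unitq_right: "unitq q \<Longrightarrow> q * qcnj q = 1"
  by (simp add: unitq_def)

lemma qcnj_mult: "qcnj (p * q) = qcnj q * qcnj p"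
  by (simp add: quat_simps algebra_simps)

lemma qcnj_qcnj [simp]: "qcnj (qcnj q) = q"
  by (simp add: quat_simps)

lemma qcnj_1 [simp]: "qcnj 1 = 1" and qcnj_0 [simp]: "qcnj 0 = 0"
  by (simp_all add: quat_simps)

lemma qcnj_minus [simp]: "qcnj (- q) = - qcnj q"
  by (simp add: quat_simps)

lemma unitq_1 [simp]: "unitq 1"
  by (simp add: unitq_def)

lemma unitq_minus [simp]: "unitq (- q) = unitq q"
  by (simp add: unitq_def)

lemma unitq_qcnj [simp]: "unitq (qcnj q) = unitq q"
  by (auto simp: unitq_iff quat_simps)

lemma unitq_nonzero: "unitq q \<Longrightarrow> q \<noteq> 0"
  by (auto simp: unitq_def)

lemma unitq_mult: "unitq p \<Longrightarrow> unitq q \<Longrightarrow> unitq (p * q)"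
  unfolding unitq_def qcnj_mult by (metis mult.assoc mult.right_neutral)

lemma inverse_unitq: "unitq q \<Longrightarrow> inverse q = qcnj q"
  by (metis unitq_def unitq_nonzero inverse_unique)

lemma square_eq_1_iff: "q * q = 1 \<longleftrightarrow> q = 1 \<or> q = - 1" for q :: quat
  by (simp add: square_eq_1_iff)

lemma Re_mult_commute: "qre (p * q) = qre (q * p)"
  by (simp add: quat_simps algebra_simps)

definition Mat :: "quat \<Rightarrow> quat \<Rightarrow> quat \<Rightarrow> quat \<Rightarrow> quat^2^2" where
  "Mat a b c d = vector [vector [a, b], vector [c, d]]"

definition Vec :: "quat \<Rightarrow> quat \<Rightarrow> quat^2" where
  "Vec p q = vector [p, q]"

lemma Vec_nth [simp]: "Vec p q $ 1 = p" "Vec p q $ 2 = q"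
  by (simp_all add: Vec_def)

lemma Vec_eta: "Vec (v $ 1) (v $ 2) = v"
  by (simp add: vec_eq_iff forall_2)

lemma Vec_cases: obtains p q where "v = Vec p q"
  by (metis Vec_eta)

lemma Vec_eq_iff [simp]: "Vec p q = Vec p' q' \<longleftrightarrow> p = p' \<and> q = q'"
  by (metis Vec_nth)

lemma Vec_zero: "0 = Vec 0 0"
  by (simp add: vec_eq_iff forall_2)

lemma Vec_add: "Vec p q + Vec p' q' = Vec (p + p') (q + q')"
  by (simp add: vec_eq_iff forall_2)

lemma Mat_nth [simp]:
  "Mat a b c d $ 1 $ 1 = a" "Mat a b c d $ 1 $ 2 = b"
  "Mat a b c d $ 2 $ 1 = c" "Mat a b c d $ 2 $ 2 = d"
  by (simp_all add: Mat_def)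

lemma Mat_eta: "Mat (A $ 1 $ 1) (A $ 1 $ 2) (A $ 2 $ 1) (A $ 2 $ 2) = A"
  by (simp add: vec_eq_iff forall_2)

lemma Mat_cases: obtains a b c d where "A = Mat a b c d"
  by (metis Mat_eta)

lemma Mat_eq_iff [simp]: "Mat a b c d = Mat a' b' c' d' \<longleftrightarrow> a = a' \<and> b = b' \<and> c = c' \<and> d = d'"
  by (metis Mat_nth)

lemma Mat_mult [simp]:
  "Mat a b c d ** Mat a' b' c' d' =
     Mat (a * a' + b * c') (a * b' + b * d') (c * a' + d * c') (c * b' + d * d')"
  by (simp add: matrix_matrix_mult_def vec_eq_iff forall_2 sum_2)

lemma Mat_vec [simp]: "Mat a b c d *v Vec p q = Vec (a * p + b * q) (c * p + d * q)"
  by (simp add: matrix_vector_mult_def vec_eq_iff forall_2 sum_2)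

lemma Mat_one: "mat 1 = Mat 1 0 0 1"
  by (simp add: mat_def vec_eq_iff forall_2)

lemma antidiag_Mat: "antidiag b = Mat 0 b (qcnj b) 0"
  by (simp add: antidiag_def Mat_def)

lemma diag1_Mat: "diag1 h = Mat h 0 0 1"
  by (simp add: diag1_def Mat_def)

lemma rscale_Vec: "rscale (Vec p q) c = Vec (p * c) (q * c)"
  by (simp add: rscale_def vec_eq_iff forall_2)

lemma antidiag_invol: "unitq b \<Longrightarrow> antidiag b ** antidiag b = mat 1"
  by (simp add: antidiag_Mat Mat_one unitq_left unitq_right)

lemma diag1_mult: "diag1 h ** diag1 k = diag1 (h * k)"
  by (simp add: diag1_Mat)

lemma diag1_1: "diag1 1 = mat 1"
  by (simp add: diag1_Mat Mat_one)

lemma mult_GLH2 [simp]: "A \<otimes>\<^bsub>GLH2\<^esub> B = A ** B"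
  and one_GLH2 [simp]: "\<one>\<^bsub>GLH2\<^esub> = mat 1"
  by (simp_all add: GLH2_def)

lemma carrier_GLH2: "A \<in> carrier GLH2 \<longleftrightarrow> invertible A"
  by (simp add: GLH2_def)

lemma carrier_GLH2I: "A ** B = mat 1 \<Longrightarrow> B ** A = mat 1 \<Longrightarrow> A \<in> carrier GLH2"
  unfolding carrier_GLH2 invertible_def by blast

lemma inv_GLH2: "A ** B = mat 1 \<Longrightarrow> B ** A = mat 1 \<Longrightarrow> inv\<^bsub>GLH2\<^esub> A = B"
  using group.inv_equality[OF group_GLH2, of B A] by (simp add: carrier_GLH2I)

lemma inv_GLH2_left: "A \<in> carrier GLH2 \<Longrightarrow> inv\<^bsub>GLH2\<^esub> A ** A = mat 1"
  using group.l_inv[OF group_GLH2, of A] by simp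

lemma inv_GLH2_right: "A \<in> carrier GLH2 \<Longrightarrow> A ** inv\<^bsub>GLH2\<^esub> A = mat 1"
  using group.r_inv[OF group_GLH2, of A] by simp

lemma inv_GLH2_carrier: "A \<in> carrier GLH2 \<Longrightarrow> inv\<^bsub>GLH2\<^esub> A \<in> carrier GLH2"
  using group.inv_closed[OF group_GLH2] by simp

lemma antidiag_carrier: "unitq b \<Longrightarrow> antidiag b \<in> carrier GLH2"
  by (rule carrier_GLH2I) (rule antidiag_invol; assumption)+

lemma antidiag_inv: "unitq b \<Longrightarrow> inv\<^bsub>GLH2\<^esub> (antidiag b) = antidiag b"
  by (rule inv_GLH2) (rule antidiag_invol; assumption)+

lemma diag1_carrier: "unitq h \<Longrightarrow> diag1 h \<in> carrier GLH2"
  by (rule carrier_GLH2I[of _ "diag1 (qcnj h)"])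
     (simp_all add: diag1_mult diag1_1 unitq_left unitq_right)

lemma diag1_inv: "unitq h \<Longrightarrow> inv\<^bsub>GLH2\<^esub> (diag1 h) = diag1 (qcnj h)"
  by (rule inv_GLH2) (simp_all add: diag1_mult diag1_1 unitq_left unitq_right)

section \<open>Words in the generators\<close>

definition unit_gens :: "quat set \<Rightarrow> quat set \<Rightarrow> bool" where
  "unit_gens L Hs \<longleftrightarrow> (\<forall>q \<in> L \<union> Hs. unitq q)"

lemma gens_subset_carrier: "unit_gens L Hs \<Longrightarrow> antidiag ` L \<union> diag1 ` Hs \<subseteq> carrier GLH2"
  by (auto simp: unit_gens_def antidiag_carrier diag1_carrier)

lemma refl_group_subset_carrier: "unit_gens L Hs \<Longrightarrow> refl_group L Hs \<subseteq> carrier GLH2"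
  unfolding refl_group_def
  by (rule group.generate_incl[OF group_GLH2 gens_subset_carrier])

lemma refl_group_antidiag: "b \<in> L \<Longrightarrow> antidiag b \<in> refl_group L Hs"
  unfolding refl_group_def by (rule generate.incl) auto

lemma refl_group_diag1: "h \<in> Hs \<Longrightarrow> diag1 h \<in> refl_group L Hs"
  unfolding refl_group_def by (rule generate.incl) auto

lemma refl_group_mult: "A \<in> refl_group L Hs \<Longrightarrow> B \<in> refl_group L Hs \<Longrightarrow> A ** B \<in> refl_group L Hs"
  unfolding refl_group_def using generate.eng[of A GLH2 _ B] by simp

lemma refl_group_one: "mat 1 \<in> refl_group L Hs"
  unfolding refl_group_def using generate.one[of GLH2] by simp

text \<open>An antidiagonal generator is an involution, so among the inverses of generators only
  those of the diagonal ones need a case.\<close>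

lemma refl_group_induct [consumes 2, case_names one antidiag diag1 diag1_inv mult]:
  assumes "unit_gens L Hs" "A \<in> refl_group L Hs"
    and one: "P (mat 1)"
    and anti: "\<And>b. b \<in> L \<Longrightarrow> P (antidiag b)"
    and diag: "\<And>h. h \<in> Hs \<Longrightarrow> P (diag1 h)" "\<And>h. h \<in> Hs \<Longrightarrow> P (diag1 (qcnj h))"
    and mult: "\<And>A B. P A \<Longrightarrow> P B \<Longrightarrow> P (A ** B)"
  shows "P A"
  using assms(2) unfolding refl_group_def
proof (induction rule: generate.induct)
  case (inv h)
  then show ?case
    using assms(1) anti diag by (auto simp: unit_gens_def antidiag_inv diag1_inv)
qed (use assms in auto)

definition monomial_over :: "(quat \<Rightarrow> quat \<Rightarrow> bool) \<Rightarrow> (quat^2^2) set" where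
  "monomial_over R = {Mat p 0 0 q | p q. R p q} \<union> {Mat 0 p q 0 | p q. R p q}"

text \<open>Symmetry of the relation is what makes it compatible with products: in the product
  of an antidiagonal matrix with another monomial matrix the entries of one factor
  trade places.\<close>

lemma refl_group_monomial_over:
  assumes "unit_gens L Hs"
    and sym: "\<And>p q. R p q \<Longrightarrow> R q p"
    and mult: "\<And>p q p' q'. R p q \<Longrightarrow> R p' q' \<Longrightarrow> R (p * p') (q * q')"
    and one: "R 1 1"
    and L: "\<And>b. b \<in> L \<Longrightarrow> R b (qcnj b)"
    and H: "\<And>h. h \<in> Hs \<Longrightarrow> R h 1" "\<And>h. h \<in> Hs \<Longrightarrow> R (qcnj h) 1"
  shows "refl_group L Hs \<subseteq> monomial_over R"
proof
  fix A assume "A \<in> refl_group L Hs"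
  with assms(1) show "A \<in> monomial_over R"
  proof (induction rule: refl_group_induct)
    case (mult A B)
    have "\<And>p q p' q'. R p q \<Longrightarrow> R p' q' \<Longrightarrow> R (p * q') (q * p')"
      using assms(2,3) by blast
    with mult show ?case
      using assms(3) by (auto simp: monomial_over_def)
  qed (use one L H in \<open>auto simp: monomial_over_def Mat_one antidiag_Mat diag1_Mat\<close>)
qed

lemma refl_group_monomial:
  assumes "unit_gens L Hs"
  shows "refl_group L Hs \<subseteq> monomial_over (\<lambda>p q. unitq p \<and> unitq q)"
  by (rule refl_group_monomial_over) (use assms in \<open>auto simp: unit_gens_def unitq_mult\<close>)

section \<open>Lines and their slopes\<close>

text \<open>Left multiplication by \<open>x\<close> commutes with the right scalar action, so its graph is a
  subspace. The quaternion \<open>x\<close> is called the slope of the line.\<close>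

definition Line :: "quat \<Rightarrow> (quat^2) set" where
  "Line x = {v. v $ 2 = x * v $ 1}"

definition Line_inf :: "(quat^2) set" where
  "Line_inf = {v. v $ 1 = 0}"

lemma Vec_in_Line [simp]: "Vec p q \<in> Line x \<longleftrightarrow> q = x * p"
  by (simp add: Line_def)

lemma Vec_in_Line_inf [simp]: "Vec p q \<in> Line_inf \<longleftrightarrow> p = 0"
  by (simp add: Line_inf_def)

lemma set_eq_VecI: "(\<And>p q. Vec p q \<in> A \<longleftrightarrow> Vec p q \<in> B) \<Longrightarrow> A = B"
  by (metis Vec_eta subsetI subset_antisym)

lemma Line_eq_iff [simp]: "Line x = Line y \<longleftrightarrow> x = y"
  by (metis Vec_in_Line mult_1_right)

lemma Line_neq_inf [simp]: "Line x \<noteq> Line_inf" "Line_inf \<noteq> Line x"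
  by (metis Vec_in_Line Vec_in_Line_inf mult_1_right zero_neq_one)+

lemma range_rscale:
  assumes "Vec p q \<noteq> 0"
  shows "range (rscale (Vec p q)) = (if p = 0 then Line_inf else Line (q * inverse p))"
proof (cases "p = 0")
  case True
  then have "q \<noteq> 0" using assms by (simp add: Vec_zero)
  then have "Vec 0 s = rscale (Vec p q) (inverse q * s)" for s
    using True by (simp add: rscale_Vec mult.assoc[symmetric])
  then show ?thesis
    using True by (intro set_eq_VecI) (metis (no_types, lifting) Vec_cases Vec_in_Line_inf mult_zero_left
      rangeE rangeI rscale_Vec)
next
  case False
  show ?thesis
  proof (rule set_eq_VecI)
    fix s t
    have "t = q * inverse p * s" if "Vec s t = Vec (p * c) (q * c)" for c
      using that False by (simp add: mult.assoc[of q] mult.assoc[of _ p, symmetric])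
    moreover have "Vec s (q * inverse p * s) = Vec (p * (inverse p * s)) (q * (inverse p * s))"
      using False by (simp add: mult.assoc[symmetric])
    ultimately show "Vec s t \<in> range (rscale (Vec p q)) \<longleftrightarrow>
      Vec s t \<in> (if p = 0 then Line_inf else Line (q * inverse p))"
      using False unfolding image_iff rscale_Vec by (simp only: if_False Vec_in_Line) blast
  qed
qed

lemma one_dim_subspace_iff: "one_dim_subspace U \<longleftrightarrow> U = Line_inf \<or> (\<exists>x. U = Line x)"
proof
  assume "one_dim_subspace U"
  then obtain v where v: "v \<noteq> 0" "U = range (rscale v)"
    unfolding one_dim_subspace_def by auto
  obtain p q where "v = Vec p q" by (rule Vec_cases)
  with v show "U = Line_inf \<or> (\<exists>x. U = Line x)"
    using range_rscale[of p q] by auto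
next
  have "Line_inf = range (rscale (Vec 0 1))" "Line x = range (rscale (Vec 1 x))" for x
    using range_rscale[of 0 1] range_rscale[of 1 x] by (auto simp: Vec_zero)
  moreover assume "U = Line_inf \<or> (\<exists>x. U = Line x)"
  ultimately show "one_dim_subspace U"
    unfolding one_dim_subspace_def Vec_zero by (metis Vec_eq_iff zero_neq_one)
qed

lemma direct_decomposition_commute: "direct_decomposition U W \<longleftrightarrow> direct_decomposition W U"
proof -
  have "{x + y |x y. x \<in> U \<and> y \<in> W} = {x + y |x y. x \<in> W \<and> y \<in> U}"
    by (auto) (metis add.commute)+
  then show ?thesis
    unfolding direct_decomposition_def by (simp add: Int_commute)
qed

lemma direct_decompositionI:
  assumes "U \<inter> W = {0}" "\<And>p q. \<exists>u w. Vec p q = u + w \<and> u \<in> U \<and> w \<in> W"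
  shows "direct_decomposition U W"
  unfolding direct_decomposition_def
proof
  show "{x + y |x y. x \<in> U \<and> y \<in> W} = UNIV"
    by (rule set_eq_VecI) (use assms(2) in simp)
qed (fact assms(1))

lemma direct_decomposition_Line_inf: "direct_decomposition (Line x) Line_inf"
proof -
  have "Line x \<inter> Line_inf = {0}"
    by (rule set_eq_VecI) (auto simp: Vec_zero)
  moreover have "\<exists>u w. Vec p q = u + w \<and> u \<in> Line x \<and> w \<in> Line_inf" for p q
    by (rule exI[of _ "Vec p (x * p)"], rule exI[of _ "Vec 0 (q - x * p)"]) (simp add: Vec_add)
  ultimately show ?thesis
    by (rule direct_decompositionI)
qed

lemma direct_decomposition_Line:
  assumes "x \<noteq> y"
  shows "direct_decomposition (Line x) (Line y)"
proof -
  have "x * p = y * p \<longleftrightarrow> p = 0" for p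
    using assms by simp
  then have "Vec p q \<in> Line x \<inter> Line y \<longleftrightarrow> Vec p q \<in> {0}" for p q
    unfolding Int_iff Vec_in_Line singleton_iff Vec_zero Vec_eq_iff by (metis mult_zero_right)
  then have "Line x \<inter> Line y = {0}"
    by (rule set_eq_VecI)
  moreover have "\<exists>u w. Vec p q = u + w \<and> u \<in> Line x \<and> w \<in> Line y" for p q
  proof -
    define s where "s = inverse (x - y) * (q - y * p)"
    have "(x - y) * s = q - y * p"
      using assms by (simp add: s_def mult.assoc[symmetric])
    then have "q = x * s + y * (p - s)"
      by (simp add: algebra_simps)
    then show ?thesis
      by (intro exI[of _ "Vec s (x * s)"] exI[of _ "Vec (p - s) (y * (p - s))"]) (simp add: Vec_add)
  qed
  ultimately show ?thesis
    by (rule direct_decompositionI)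
qed

text \<open>The space has dimension two, so two different lines already span it.\<close>

lemma direct_decomposition_iff:
  assumes U: "one_dim_subspace U" and W: "one_dim_subspace W"
  shows "direct_decomposition U W \<longleftrightarrow> U \<noteq> W"
proof -
  have "\<not> direct_decomposition U U"
  proof
    assume "direct_decomposition U U"
    then have *: "U = {0}" by (simp add: direct_decomposition_def)
    have "Vec 0 1 \<in> Line_inf" "Vec 1 x \<in> Line x" for x by simp_all
    then show False
      using U unfolding one_dim_subspace_iff unfolding * Vec_zero
      by (metis Vec_eq_iff singletonD zero_neq_one)
  qed
  moreover have "direct_decomposition U W" if "U \<noteq> W"
  proof (cases "U = Line_inf")
    case True
    then obtain y where "W = Line y" using W \<open>U \<noteq> W\<close> by (auto simp: one_dim_subspace_iff)
    then show ?thesis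
      using True direct_decomposition_Line_inf direct_decomposition_commute by blast
  next
    case False
    then obtain x where "U = Line x" using U by (auto simp: one_dim_subspace_iff)
    moreover have "W = Line_inf \<or> (\<exists>y. W = Line y)" using W by (simp add: one_dim_subspace_iff)
    ultimately show ?thesis
      using \<open>U \<noteq> W\<close> by (auto intro: direct_decomposition_Line_inf direct_decomposition_Line
        simp del: not_ex)
  qed
  ultimately show ?thesis by blast
qed

section \<open>The action on pairs of lines\<close>

definition act :: "quat^2^2 \<Rightarrow> (quat^2) set set \<Rightarrow> (quat^2) set set" where
  "act g S = (\<lambda>U. (*v) g ` U) ` S"

lemma act_mult: "act (A ** B) S = act A (act B S)"
  by (simp add: act_def image_image matrix_vector_mul_assoc)

lemma act_one [simp]: "act (mat 1) S = S"
  by (simp add: act_def)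

lemma systems_of_imprimitivity_iff:
  "S \<in> systems_of_imprimitivity G \<longleftrightarrow>
     (\<exists>U W. S = {U, W} \<and> one_dim_subspace U \<and> one_dim_subspace W \<and> U \<noteq> W \<and> (\<forall>g\<in>G. act g S = S))"
  unfolding systems_of_imprimitivity_def act_def mem_Collect_eq
  by (intro iff_exI) (auto simp: direct_decomposition_iff)

text \<open>The stabiliser of a set of lines is a group.\<close>

lemma act_refl_group:
  assumes "unit_gens L Hs"
  shows "(\<forall>g\<in>refl_group L Hs. act g S = S) \<longleftrightarrow>
    (\<forall>b\<in>L. act (antidiag b) S = S) \<and> (\<forall>h\<in>Hs. act (diag1 h) S = S)"
proof (intro iffI conjI ballI)
  fix g assume *: "(\<forall>b\<in>L. act (antidiag b) S = S) \<and> (\<forall>h\<in>Hs. act (diag1 h) S = S)"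
    and g: "g \<in> refl_group L Hs"
  from assms g show "act g S = S"
  proof (induction rule: refl_group_induct)
    case (diag1_inv h)
    then have "unitq h" using assms by (simp add: unit_gens_def)
    then have "act (diag1 (qcnj h)) (act (diag1 h) S) = S"
      by (simp add: act_mult[symmetric] diag1_mult diag1_1 unitq_left)
    with diag1_inv * show ?case by simp
  qed (use * in \<open>simp_all add: act_mult\<close>)
qed (auto intro: refl_group_antidiag refl_group_diag1)

lemma image_involution:
  assumes "\<And>v. f (g v) = v" "\<And>v. g (f v) = v"
  shows "f ` U = {v. g v \<in> U}"
proof (rule subset_antisym)
  show "{v. g v \<in> U} \<subseteq> f ` U" using assms(1) by (metis (mono_tags) image_eqI mem_Collect_eq subsetI)
qed (use assms(2) in auto)

lemma Vec_in_antidiag_image: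
  assumes "unitq b"
  shows "Vec p q \<in> (*v) (antidiag b) ` U \<longleftrightarrow> Vec (b * q) (qcnj b * p) \<in> U"
proof -
  have "(*v) (antidiag b) ` U = {v. antidiag b *v v \<in> U}"
    by (rule image_involution)
       (use antidiag_invol[OF assms] in \<open>simp_all add: matrix_vector_mul_assoc\<close>)
  then show ?thesis by (simp add: antidiag_Mat)
qed

lemma Vec_in_diag1_image:
  assumes "unitq h"
  shows "Vec p q \<in> (*v) (diag1 h) ` U \<longleftrightarrow> Vec (qcnj h * p) q \<in> U"
proof -
  have "(*v) (diag1 h) ` U = {v. diag1 (qcnj h) *v v \<in> U}"
    by (rule image_involution)
       (use assms in \<open>simp_all add: matrix_vector_mul_assoc diag1_mult diag1_1 unitq_left unitq_right\<close>)
  then show ?thesis by (simp add: diag1_Mat)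
qed

lemma antidiag_Line:
  assumes b: "unitq b" and x: "x \<noteq> 0"
  shows "(*v) (antidiag b) ` Line x = Line (qcnj b * inverse x * qcnj b)"
proof (rule set_eq_VecI)
  fix p q
  have "qcnj b * p = x * (b * q) \<longleftrightarrow> q = qcnj b * inverse x * qcnj b * p" (is "?l \<longleftrightarrow> ?r")
  proof
    assume ?l
    then have "qcnj b * inverse x * (qcnj b * p) = qcnj b * (inverse x * x) * b * q"
      by (simp only: mult.assoc)
    also have "\<dots> = q"
      using b x by (simp add: unitq_left)
    finally show ?r by (simp add: mult.assoc)
  next
    assume ?r
    then have "x * (b * q) = x * (b * qcnj b) * inverse x * qcnj b * p"
      by (simp add: mult.assoc)
    also have "\<dots> = qcnj b * p"
      using b x by (simp add: unitq_right)
    finally show ?l ..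
  qed
  then show "Vec p q \<in> (*v) (antidiag b) ` Line x \<longleftrightarrow> Vec p q \<in> Line (qcnj b * inverse x * qcnj b)"
    by (simp add: Vec_in_antidiag_image[OF b])
qed

lemma antidiag_Line_0: "unitq b \<Longrightarrow> (*v) (antidiag b) ` Line 0 = Line_inf"
  by (rule set_eq_VecI) (use unitq_nonzero[of "qcnj b"] in \<open>auto simp: Vec_in_antidiag_image\<close>)

lemma antidiag_Line_inf: "unitq b \<Longrightarrow> (*v) (antidiag b) ` Line_inf = Line 0"
  by (rule set_eq_VecI) (use unitq_nonzero[of "b"] in \<open>auto simp: Vec_in_antidiag_image\<close>)

lemma diag1_Line: "unitq h \<Longrightarrow> (*v) (diag1 h) ` Line x = Line (x * qcnj h)"
  by (rule set_eq_VecI) (auto simp: Vec_in_diag1_image mult.assoc)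

lemma diag1_Line_inf: "unitq h \<Longrightarrow> (*v) (diag1 h) ` Line_inf = Line_inf"
  by (rule set_eq_VecI) (use unitq_nonzero[of "qcnj h"] in \<open>auto simp: Vec_in_diag1_image\<close>)

lemma standard_system:
  assumes "unit_gens L Hs"
  shows "{Line 0, Line_inf} \<in> systems_of_imprimitivity (refl_group L Hs)"
  unfolding systems_of_imprimitivity_iff act_refl_group[OF assms]
  using assms
  by (intro exI[of _ "Line 0"] exI[of _ Line_inf])
     (auto simp: one_dim_subspace_iff act_def unit_gens_def antidiag_Line_0 antidiag_Line_inf
        diag1_Line diag1_Line_inf)

section \<open>Systems of imprimitivity in terms of slopes\<close>

lemma unitq_square_eq_minus_1: "unitq q \<Longrightarrow> q * q = - 1 \<longleftrightarrow> qre q = 0"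
proof -
  assume q: "unitq q"
  show ?thesis
  proof
    assume "q * q = - 1"
    then have "qre q * qre q - qi q * qi q - qj q * qj q - qk q * qk q = - 1"
      by (simp add: quat_simps)
    moreover have "qre q * qre q + qi q * qi q + qj q * qj q + qk q * qk q = 1"
      using q by (simp add: unitq_iff power2_eq_square)
    ultimately have "2 * (qre q * qre q) = 0" by linarith
    then show "qre q = 0" by simp
  next
    assume "qre q = 0"
    then show "q * q = - 1"
      using q by (simp add: quat_simps unitq_iff power2_eq_square)
  qed
qed

lemma pure_square_neq_1:
  assumes "qre x = 0"
  shows "x * x \<noteq> 1"
proof
  assume "x * x = 1"
  then have "x = 1 \<or> x = - 1" by (simp add: square_eq_1_iff)
  with assms show False by (auto simp: quat_simps)
qed

lemma unitq_pure_inverse: "unitq x \<Longrightarrow> qre x = 0 \<Longrightarrow> inverse x = - x"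
  by (simp add: inverse_unitq) (simp add: quat_simps)

text \<open>Conjugation by a quaternion inverts a nonreal unit \<open>b\<close> exactly when it is a half
  turn about an axis orthogonal to that of \<open>b\<close>.\<close>

lemma twisted_commute_iff:
  "x * qcnj b = b * x \<longleftrightarrow> imdot x b = 0 \<and> qre x * qi b = 0 \<and> qre x * qj b = 0 \<and> qre x * qk b = 0"
  by (auto simp: quat_simps imdot_def algebra_simps)

text \<open>For nonzero \<open>x\<close>: inversion of slopes is the action of \<open>antidiag 1\<close>, so these are the
  pairs of lines that it exchanges.\<close>

definition pair_of :: "quat \<Rightarrow> (quat^2) set set" where
  "pair_of x = {Line x, Line (inverse x)}"

text \<open>The pure slopes \<open>x\<close> for which \<open>pair_of x\<close> is a system of imprimitivity;
  \<open>systems_refl_group\<close> derives the conditions.\<close>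

definition admissible :: "quat set \<Rightarrow> quat set \<Rightarrow> quat set" where
  "admissible L Hs = {x. x \<noteq> 0 \<and> qre x = 0 \<and> (\<forall>b\<in>L. imdot x b = 0 \<or> b = x \<or> b = - x) \<and>
     (\<forall>h\<in>Hs. h = 1 \<or> h = - 1 \<and> x * x = - 1)}"

lemma act_antidiag_pair:
  "unitq b \<Longrightarrow> x \<noteq> 0 \<Longrightarrow> y \<noteq> 0 \<Longrightarrow> act (antidiag b) {Line x, Line y} = {Line x, Line y} \<longleftrightarrow>
     (qcnj b * inverse x * qcnj b = x \<and> qcnj b * inverse y * qcnj b = y) \<or>
     (qcnj b * inverse x * qcnj b = y \<and> qcnj b * inverse y * qcnj b = x)"
  by (simp add: act_def antidiag_Line doubleton_eq_iff)

lemma act_diag1_pair: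
  "unitq h \<Longrightarrow> act (diag1 h) {Line x, Line y} = {Line x, Line y} \<longleftrightarrow>
     (x * qcnj h = x \<and> y * qcnj h = y) \<or> (x * qcnj h = y \<and> y * qcnj h = x)"
  by (simp add: act_def diag1_Line doubleton_eq_iff)

lemma act_antidiag_pm1:
  assumes b: "unitq b"
  shows "act (antidiag b) {Line 1, Line (- 1)} = {Line 1, Line (- 1)} \<longleftrightarrow> b = 1 \<or> b = - 1 \<or> qre b = 0"
proof -
  have "act (antidiag b) {Line 1, Line (- 1)} = {Line 1, Line (- 1)} \<longleftrightarrow>
      qcnj b * qcnj b = 1 \<or> qcnj b * qcnj b = - 1"
    using b by (subst act_antidiag_pair) (auto simp: minus_equation_iff)
  also have "qcnj b * qcnj b = 1 \<longleftrightarrow> b = 1 \<or> b = - 1"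
    unfolding square_eq_1_iff by (metis qcnj_1 qcnj_minus qcnj_qcnj)
  also have "qcnj b * qcnj b = - 1 \<longleftrightarrow> qre b = 0"
    using b by (simp add: unitq_square_eq_minus_1) (simp add: quat_simps)
  finally show ?thesis by blast
qed

lemma qcnj_eq_pm1: "qcnj h = 1 \<longleftrightarrow> h = 1" "qcnj h = - 1 \<longleftrightarrow> h = - 1"
  by (metis qcnj_1 qcnj_minus qcnj_qcnj)+

lemma act_diag1_pm1:
  assumes h: "unitq h"
  shows "act (diag1 h) {Line 1, Line (- 1)} = {Line 1, Line (- 1)} \<longleftrightarrow> h \<in> {1, - 1}"
  using h by (subst act_diag1_pair) (auto simp: qcnj_eq_pm1 minus_equation_iff)

text \<open>The two slopes are exchanged exactly in the first alternative. If they are fixed,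
  then \<open>qcnj b * x\<close> squares to one, so \<open>b = \<plusminus>x\<close>; as \<open>b\<close> has norm one, the
  fixed-point equation becomes \<open>x ^ 4 = 1\<close>.\<close>

lemma act_antidiag_pair_of:
  assumes b: "unitq b" and x: "x \<noteq> 0" "x * x \<noteq> 1"
  shows "act (antidiag b) (pair_of x) = pair_of x \<longleftrightarrow>
    x * qcnj b = b * x \<or> qre x = 0 \<and> (b = x \<or> b = - x)"
proof -
  have bb: "b * qcnj b = 1" "qcnj b * b = 1" using b by (simp_all add: unitq_left unitq_right)
  have "act (antidiag b) (pair_of x) = pair_of x \<longleftrightarrow>
     (qcnj b * inverse x * qcnj b = x \<and> qcnj b * x * qcnj b = inverse x) \<or>
     (qcnj b * inverse x * qcnj b = inverse x \<and> qcnj b * x * qcnj b = x)"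
    using b x by (simp add: pair_of_def act_antidiag_pair)
  also have "qcnj b * inverse x * qcnj b = inverse x \<and> qcnj b * x * qcnj b = x \<longleftrightarrow> x * qcnj b = b * x"
  proof
    assume "qcnj b * inverse x * qcnj b = inverse x \<and> qcnj b * x * qcnj b = x"
    then show "x * qcnj b = b * x" using bb by (metis mult.assoc mult_1_left)
  next
    assume *: "x * qcnj b = b * x"
    have **: "qcnj b * x * qcnj b = x"
      using * bb by (simp add: mult.assoc) (simp add: mult.assoc[symmetric])
    have "qcnj b * inverse x * qcnj b * (b * (x * b)) = 1"
      using x bb by (metis mult.assoc mult_1_right left_inverse)
    moreover have "b * (x * b) = x"
      using ** bb by (metis mult.assoc mult_1_left mult_1_right)
    ultimately have "qcnj b * inverse x * qcnj b = inverse x"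
      by (metis inverse_unique inverse_inverse_eq x(1) mult.assoc mult_1_right right_inverse)
    with ** show "qcnj b * inverse x * qcnj b = inverse x \<and> qcnj b * x * qcnj b = x" by simp
  qed
  also have "qcnj b * inverse x * qcnj b = x \<and> qcnj b * x * qcnj b = inverse x \<longleftrightarrow>
      qre x = 0 \<and> (b = x \<or> b = - x)"
  proof
    assume *: "qcnj b * inverse x * qcnj b = x \<and> qcnj b * x * qcnj b = inverse x"
    then have "(qcnj b * x) * (qcnj b * x) = 1"
      using x by (metis left_inverse mult.assoc)
    then have "qcnj b * x = 1 \<or> qcnj b * x = - 1" by (simp add: square_eq_1_iff)
    then have bx: "b = x \<or> b = - x"
      using bb by (metis mult.assoc mult_1_left mult_1_right mult_minus_right minus_minus)
    then have "unitq x" using b by auto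
    moreover from this have "x * x = - 1"
    proof -
      \<comment> \<open>As \<open>b = \<plusminus>x\<close>, the first slope equation only involves \<open>x\<close>.\<close>
      have "qcnj x * qcnj x * qcnj x = x"
        using * bx \<open>unitq x\<close> by (auto simp: inverse_unitq)
      then have "(x * x) * (x * x) = 1"
        using \<open>unitq x\<close> by (metis mult.assoc mult_1_left mult_1_right unitq_def)
      then show ?thesis using x by (simp add: square_eq_1_iff)
    qed
    ultimately show "qre x = 0 \<and> (b = x \<or> b = - x)"
      using bx by (simp add: unitq_square_eq_minus_1)
  next
    assume *: "qre x = 0 \<and> (b = x \<or> b = - x)"
    then have u: "unitq x" using b by auto
    with * have "qcnj x = - x" "inverse x = - x" "x * x = - 1"
      by (simp_all add: unitq_pure_inverse unitq_square_eq_minus_1) (simp add: quat_simps)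
    with * show "qcnj b * inverse x * qcnj b = x \<and> qcnj b * x * qcnj b = inverse x"
      by (auto simp: mult.assoc)
  qed
  finally show ?thesis by blast
qed

text \<open>If \<open>diag1 h\<close> exchanges the slopes, then \<open>qcnj h\<close> is \<open>x * x\<close>, whose square is one; a
  pure quaternion never squares to one, which leaves -1.\<close>

lemma act_diag1_pair_of:
  assumes h: "unitq h" and x: "x \<noteq> 0" "qre x = 0"
  shows "act (diag1 h) (pair_of x) = pair_of x \<longleftrightarrow> h = 1 \<or> h = - 1 \<and> x * x = - 1"
proof -
  have 1: "x * qcnj h = x \<longleftrightarrow> h = 1" if "x \<noteq> 0" for x :: quat
    using that by (metis mult_cancel_left mult_1_right qcnj_eq_pm1(1))
  have 2: "x * qcnj h = inverse x \<and> inverse x * qcnj h = x \<longleftrightarrow> h = - 1 \<and> x * x = - 1"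
  proof
    assume *: "x * qcnj h = inverse x \<and> inverse x * qcnj h = x"
    then have hx: "qcnj h = x * x"
      using x by (metis mult.assoc mult_1_left right_inverse)
    then have "(x * x) * (x * x) = 1"
      using * x by (metis mult.assoc left_inverse right_inverse)
    then have "x * x = - 1" using x pure_square_neq_1 by (simp add: square_eq_1_iff)
    with hx show "h = - 1 \<and> x * x = - 1" by (simp add: qcnj_eq_pm1)
  next
    assume *: "h = - 1 \<and> x * x = - 1"
    then have "inverse x = - x"
      by (metis inverse_unique minus_minus mult_minus_right)
    with * show "x * qcnj h = inverse x \<and> inverse x * qcnj h = x" by simp
  qed
  show ?thesis
    unfolding pair_of_def using x by (simp add: act_diag1_pair[OF h] 1[OF x(1)] 2 qcnj_eq_pm1)
qed

text \<open>Inversion exchanges the slopes zero and infinity, so a system that contains one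
  coordinate axis contains the other. Both remaining slopes are fixed by inversion,
  or they are exchanged by it.\<close>

lemma swap_systems:
  assumes S: "S = {U, W}" "U \<noteq> W" "one_dim_subspace U" "one_dim_subspace W"
    and swap: "act (antidiag 1) S = S"
  shows "S = {Line 0, Line_inf} \<or> S = {Line 1, Line (- 1)} \<or> (\<exists>x. x \<noteq> 0 \<and> x * x \<noteq> 1 \<and> S = pair_of x)"
proof (cases "Line 0 \<in> S \<or> Line_inf \<in> S")
  case True
  have "(*v) (antidiag 1) ` Line 0 \<in> S" if "Line 0 \<in> S"
    using that swap unfolding act_def by (metis imageI)
  moreover have "(*v) (antidiag 1) ` Line_inf \<in> S" if "Line_inf \<in> S"
    using that swap unfolding act_def by (metis imageI)
  ultimately have "Line 0 \<in> S" "Line_inf \<in> S"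
    using True by (auto simp: antidiag_Line_0 antidiag_Line_inf)
  then have "U = Line 0 \<or> W = Line 0" "U = Line_inf \<or> W = Line_inf"
    unfolding S(1) by blast+
  then have "S = {Line 0, Line_inf}" unfolding S(1) by (metis Line_neq_inf(1) insert_commute)
  then show ?thesis by simp
next
  case False
  then obtain x y where xy: "U = Line x" "W = Line y" "x \<noteq> 0" "y \<noteq> 0"
    using S by (auto simp: one_dim_subspace_iff)
  then have "x \<noteq> y" using S by simp
  from swap xy have "(inverse x = x \<and> inverse y = y) \<or> (inverse x = y \<and> inverse y = x)"
    using act_antidiag_pair[of 1 x y] S by simp
  then show ?thesis
  proof
    assume "inverse x = x \<and> inverse y = y"
    then have "x * x = 1" "y * y = 1" using xy by (metis left_inverse)+
    then have "{x, y} = {1, - 1}" using \<open>x \<noteq> y\<close> by (auto simp: square_eq_1_iff)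
    then have "S = {Line 1, Line (- 1)}" unfolding S(1) xy by (metis image_insert image_empty)
    then show ?thesis by simp
  next
    assume *: "inverse x = y \<and> inverse y = x"
    then have "S = pair_of x" by (simp add: pair_of_def S(1) xy)
    moreover have "x * x \<noteq> 1" using * \<open>x \<noteq> y\<close> inverse_unique by metis
    ultimately show ?thesis using xy by blast
  qed
qed

text \<open>A generator other than \<open>\<plusminus>1\<close> has nonzero imaginary part and so forces \<open>x\<close> to be pure;
  for pure \<open>x\<close> the twisted commutation is orthogonality.\<close>

lemma pair_of_admissible_iff:
  assumes "unit_gens L Hs" and nonreal: "b0 \<in> L" "b0 \<noteq> 1" "b0 \<noteq> - 1"
    and x: "x \<noteq> 0" "x * x \<noteq> 1"
  shows "(\<forall>b\<in>L. act (antidiag b) (pair_of x) = pair_of x) \<and> (\<forall>h\<in>Hs. act (diag1 h) (pair_of x) = pair_of x)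
     \<longleftrightarrow> x \<in> admissible L Hs"
proof -
  have u: "\<And>b. b \<in> L \<Longrightarrow> unitq b" "\<And>h. h \<in> Hs \<Longrightarrow> unitq h"
    using assms(1) by (auto simp: unit_gens_def)
  have "qre x = 0" if "act (antidiag b0) (pair_of x) = pair_of x"
  proof (rule ccontr)
    assume "qre x \<noteq> 0"
    then have im: "qi b0 = 0" "qj b0 = 0" "qk b0 = 0"
      using that act_antidiag_pair_of[OF u(1)[OF nonreal(1)] x] by (simp_all add: twisted_commute_iff)
    then have "(qre b0)\<^sup>2 = 1" using u(1)[OF nonreal(1)] by (simp add: unitq_iff)
    then have "qre b0 = 1 \<or> qre b0 = - 1" by (simp add: power2_eq_1_iff)
    with im nonreal show False by (cases b0) (auto simp: quat_simps)
  qed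
  note pure = this
  show ?thesis
  proof (cases "qre x = 0")
    case True
    have "act (antidiag b) (pair_of x) = pair_of x \<longleftrightarrow> imdot x b = 0 \<or> b = x \<or> b = - x" if "b \<in> L" for b
      using True act_antidiag_pair_of[OF u(1)[OF that] x] by (simp add: twisted_commute_iff)
    moreover have "act (diag1 h) (pair_of x) = pair_of x \<longleftrightarrow> h = 1 \<or> h = - 1 \<and> x * x = - 1"
      if "h \<in> Hs" for h
      using act_diag1_pair_of[OF u(2)[OF that] x(1) True] .
    ultimately show ?thesis
      unfolding admissible_def using True x(1) by simp
  next
    case False
    then show ?thesis
      using pure nonreal(1) unfolding admissible_def by blast
  qed
qed

text \<open>The swap leaves three kinds of candidates, and each of the remaining generators is
  tested on them. The pair \<open>{1, -1}\<close> differs from the others in that its slopes are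
  not pure.\<close>

theorem systems_refl_group:
  assumes unit: "unit_gens L Hs" and one: "1 \<in> L" and nonreal: "b0 \<in> L" "b0 \<noteq> 1" "b0 \<noteq> - 1"
  shows "S \<in> systems_of_imprimitivity (refl_group L Hs) \<longleftrightarrow>
    S = {Line 0, Line_inf} \<or>
    S = {Line 1, Line (- 1)} \<and> (\<forall>b\<in>L. b = 1 \<or> b = - 1 \<or> qre b = 0) \<and> Hs \<subseteq> {1, - 1} \<or>
    (\<exists>x\<in>admissible L Hs. S = pair_of x)" (is "?L \<longleftrightarrow> ?R")
proof -
  have u: "\<And>b. b \<in> L \<Longrightarrow> unitq b" "\<And>h. h \<in> Hs \<Longrightarrow> unitq h"
    using unit by (auto simp: unit_gens_def)
  let ?stable = "\<lambda>S. (\<forall>b\<in>L. act (antidiag b) S = S) \<and> (\<forall>h\<in>Hs. act (diag1 h) S = S)"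
  let ?pm1 = "(\<forall>b\<in>L. b = 1 \<or> b = - 1 \<or> qre b = 0) \<and> Hs \<subseteq> {1, - 1}"
  have pm1: "?stable {Line 1, Line (- 1)} \<longleftrightarrow> ?pm1"
    using u by (auto simp: act_antidiag_pm1 act_diag1_pm1)
  have pair: "?stable (pair_of x) \<longleftrightarrow> x \<in> admissible L Hs" if "x \<noteq> 0" "x * x \<noteq> 1" for x
    using pair_of_admissible_iff[OF unit nonreal that] .
  have sys: "S \<in> systems_of_imprimitivity (refl_group L Hs) \<longleftrightarrow>
     (\<exists>U W. S = {U, W} \<and> one_dim_subspace U \<and> one_dim_subspace W \<and> U \<noteq> W \<and> ?stable S)"
    unfolding systems_of_imprimitivity_iff act_refl_group[OF unit] ..
  show ?thesis
  proof
    assume "S \<in> systems_of_imprimitivity (refl_group L Hs)"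
    then obtain U W where S: "S = {U, W}" "U \<noteq> W" "one_dim_subspace U" "one_dim_subspace W"
      and st: "?stable S"
      unfolding sys by metis
    with one have "act (antidiag 1) S = S" by blast
    from swap_systems[OF S this]
    consider "S = {Line 0, Line_inf}" | "S = {Line 1, Line (- 1)}"
      | x where "x \<noteq> 0" "x * x \<noteq> 1" "S = pair_of x" by blast
    then show ?R
    proof cases
      case 2
      with st pm1 have ?pm1 by simp
      with 2 show ?thesis by simp
    next
      case 3
      with st pair have "x \<in> admissible L Hs" by simp
      with 3 show ?thesis by blast
    qed simp
  next
    assume ?R
    then consider "S = {Line 0, Line_inf}" | "S = {Line 1, Line (- 1)}" ?pm1
      | x where "x \<in> admissible L Hs" "S = pair_of x" by blast
    then show "S \<in> systems_of_imprimitivity (refl_group L Hs)"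
    proof cases
      case 1
      then show ?thesis using standard_system[OF unit] by simp
    next
      case 2
      moreover have "(1::quat) \<noteq> - 1" by (simp add: quat_simps)
      ultimately show ?thesis unfolding sys one_dim_subspace_iff
        using pm1 by (intro exI[of _ "Line 1"] exI[of _ "Line (- 1)"]) simp
    next
      case 3
      then have x: "x \<noteq> 0" "x * x \<noteq> 1"
        by (auto simp: admissible_def pure_square_neq_1)
      then have "x \<noteq> inverse x" by (metis right_inverse)
      moreover have "?stable S" using pair[OF x] 3 by simp
      ultimately show ?thesis unfolding sys
        using 3 by (intro exI[of _ "Line x"] exI[of _ "Line (inverse x)"])
          (simp add: one_dim_subspace_iff pair_of_def)
    qed
  qed
qed

section \<open>Counting systems of imprimitivity\<close>

definition good_gens :: "quat set \<Rightarrow> quat set \<Rightarrow> bool" where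
  "good_gens L Hs \<longleftrightarrow> unit_gens L Hs \<and> 1 \<in> L \<and> (\<exists>b\<in>L. b \<noteq> 1 \<and> b \<noteq> - 1)"

lemma minus_one_neq_one [simp]: "(1::quat) \<noteq> - 1" "- 1 \<noteq> (1::quat)"
  by (simp_all add: quat_simps)

lemma pair_of_eq_iff: "pair_of x = pair_of y \<longleftrightarrow> y = x \<or> y = inverse x"
  by (auto simp: pair_of_def doubleton_eq_iff)

lemma pair_of_neq_standard [simp]: "pair_of x \<noteq> {Line 0, Line_inf}" "{Line 0, Line_inf} \<noteq> pair_of x"
  by (auto simp: pair_of_def doubleton_eq_iff)

lemma pm1_neq_standard [simp]: "{Line 1, Line (- 1)} \<noteq> {Line 0, Line_inf}"
  by (simp add: doubleton_eq_iff)

lemma pair_of_neq_pm1: "qre x = 0 \<Longrightarrow> pair_of x \<noteq> {Line 1, Line (- 1)}"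
  by (auto simp: pair_of_def doubleton_eq_iff quat_simps)

lemma inverse_of_square_minus_one: "x * x = - 1 \<Longrightarrow> inverse x = - x" for x :: quat
  by (metis inverse_unique minus_minus mult_minus_right)

lemma systems_iff_good:
  assumes "good_gens L Hs"
  shows "S \<in> systems_of_imprimitivity (refl_group L Hs) \<longleftrightarrow>
    S = {Line 0, Line_inf} \<or>
    S = {Line 1, Line (- 1)} \<and> (\<forall>b\<in>L. b = 1 \<or> b = - 1 \<or> qre b = 0) \<and> Hs \<subseteq> {1, - 1} \<or>
    (\<exists>x\<in>admissible L Hs. S = pair_of x)"
proof -
  obtain b where "unit_gens L Hs" "1 \<in> L" "b \<in> L" "b \<noteq> 1" "b \<noteq> - 1"
    using assms unfolding good_gens_def by metis
  then show ?thesis by (rule systems_refl_group)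
qed

text \<open>A generator that is neither \<open>\<plusminus>1\<close> nor pure destroys the pair of slopes \<open>{1, -1}\<close>.\<close>

lemma systems_mixed:
  assumes "good_gens L Hs" "b \<in> L" "b \<noteq> 1" "b \<noteq> - 1" "qre b \<noteq> 0"
  shows "systems_of_imprimitivity (refl_group L Hs) =
    insert {Line 0, Line_inf} (pair_of ` admissible L Hs)"
proof (rule Set.set_eqI)
  fix S
  have "\<not> (\<forall>b\<in>L. b = 1 \<or> b = - 1 \<or> qre b = 0)" using assms by metis
  then show "S \<in> systems_of_imprimitivity (refl_group L Hs) \<longleftrightarrow>
      S \<in> insert {Line 0, Line_inf} (pair_of ` admissible L Hs)"
    unfolding systems_iff_good[OF assms(1)] insert_iff image_iff by argo
qed

lemma systems_H_nontrivial:
  assumes "good_gens L Hs" "h \<in> Hs" "h \<noteq> 1" "h \<noteq> - 1"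
  shows "systems_of_imprimitivity (refl_group L Hs) = {{Line 0, Line_inf}}"
proof -
  have "admissible L Hs = {}" "\<not> Hs \<subseteq> {1, - 1}" using assms unfolding admissible_def by auto
  then show ?thesis
    by (intro Set.set_eqI) (simp add: systems_iff_good[OF assms(1)])
qed

definition count_systems :: "(quat^2^2) set \<Rightarrow> nat \<Rightarrow> bool" where
  "count_systems G m \<longleftrightarrow> finite (systems_of_imprimitivity G) \<and> card (systems_of_imprimitivity G) = m"

lemma count_H_nontrivial:
  assumes "good_gens L Hs" "h \<in> Hs" "h \<noteq> 1" "h \<noteq> - 1"
  shows "count_systems (refl_group L Hs) 1"
  using systems_H_nontrivial[OF assms] by (simp add: count_systems_def)

lemma count_one:
  assumes "good_gens L Hs" "b \<in> L" "b \<noteq> 1" "b \<noteq> - 1" "qre b \<noteq> 0" "admissible L Hs = {}"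
  shows "count_systems (refl_group L Hs) 1"
  using systems_mixed[OF assms(1-5)] assms(6) by (simp add: count_systems_def)

lemma count_two:
  assumes "good_gens L Hs" "b \<in> L" "b \<noteq> 1" "b \<noteq> - 1" "qre b \<noteq> 0"
    and "\<And>y. y \<in> admissible L Hs \<longleftrightarrow> y = x \<or> y = - x" "x * x = - 1"
  shows "count_systems (refl_group L Hs) 2"
proof -
  have "admissible L Hs = {x, - x}" using assms(6) by auto
  moreover have "pair_of (- x) = pair_of x"
    using inverse_of_square_minus_one[OF assms(7)] by (simp add: pair_of_eq_iff)
  ultimately show ?thesis
    using systems_mixed[OF assms(1-5)] by (simp add: count_systems_def)
qed

lemma count_three:
  assumes "good_gens L Hs" "b \<in> L" "b \<noteq> 1" "b \<noteq> - 1" "qre b \<noteq> 0"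
    and "\<And>z. z \<in> admissible L Hs \<longleftrightarrow> z = x \<or> z = - x \<or> z = y \<or> z = - y"
    and "x * x = - 1" "y * y = - 1" "x \<noteq> y" "x \<noteq> - y"
  shows "count_systems (refl_group L Hs) 3"
proof -
  have "admissible L Hs = {x, - x, y, - y}" using assms(6) by auto
  moreover have "pair_of (- x) = pair_of x" "pair_of (- y) = pair_of y"
    using inverse_of_square_minus_one[OF assms(7)] inverse_of_square_minus_one[OF assms(8)]
    by (simp_all add: pair_of_eq_iff)
  moreover have "pair_of x \<noteq> pair_of y"
    using inverse_of_square_minus_one[OF assms(7)] assms(9,10) by (auto simp: pair_of_eq_iff)
  ultimately show ?thesis
    using systems_mixed[OF assms(1-5)] by (simp add: count_systems_def)
qed

text \<open>Two positive multiples of a pure quaternion are never inverse to each other, since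
  their product is negative; so different multiples give different pairs.\<close>

lemma infinite_systems:
  assumes "good_gens L Hs"
    and line: "\<And>t. t \<noteq> 0 \<Longrightarrow> Quat 0 (t * a) (t * b) (t * c) \<in> admissible L Hs"
    and nz: "a \<noteq> 0 \<or> b \<noteq> 0 \<or> c \<noteq> 0"
  shows "infinite (systems_of_imprimitivity (refl_group L Hs))"
proof -
  define u where "u t = Quat 0 (t * a) (t * b) (t * c)" for t
  have sub: "(\<lambda>t. pair_of (u t)) ` {0<..} \<subseteq> systems_of_imprimitivity (refl_group L Hs)"
  proof (rule image_subsetI)
    fix t :: real assume "t \<in> {0<..}"
    then have "u t \<in> admissible L Hs" using line unfolding u_def by simp
    then show "pair_of (u t) \<in> systems_of_imprimitivity (refl_group L Hs)"
      unfolding systems_iff_good[OF assms(1)] by blast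
  qed
  have inj: "inj_on (\<lambda>t. pair_of (u t)) {0<..}"
  proof (rule inj_onI)
    fix s t :: real assume st: "s \<in> {0<..}" "t \<in> {0<..}" and "pair_of (u s) = pair_of (u t)"
    then have "u t = u s \<or> u t = inverse (u s)" by (simp add: pair_of_eq_iff)
    moreover have "u t \<noteq> inverse (u s)"
    proof
      assume *: "u t = inverse (u s)"
      have "u s \<noteq> 0" using st nz by (auto simp: u_def quat_simps)
      with * have "u t * u s = 1" by simp
      then have 1: "- (t * a * (s * a)) - t * b * (s * b) - t * c * (s * c) = 1"
        by (simp add: u_def quat_simps)
      have "- (t * a * (s * a)) - t * b * (s * b) - t * c * (s * c) = - (t * s) * (a * a + b * b + c * c)"
        by (simp add: algebra_simps)
      moreover have "(t * s) * (a * a + b * b + c * c) \<ge> 0" using st by simp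
      ultimately show False using 1 by simp
    qed
    ultimately show "s = t" using nz by (auto simp: u_def)
  qed
  have "infinite ({0<..} :: real set)" by (simp add: infinite_Ioi)
  then show ?thesis
    using finite_imageD[OF finite_subset[OF sub] inj] by blast
qed

lemma refl_group_unitq: "unit_gens L Hs \<Longrightarrow> h \<in> H_of (refl_group L Hs) \<Longrightarrow> unitq h"
  using refl_group_monomial[of L Hs] by (force simp: H_of_def diag1_Mat monomial_over_def)

text \<open>Membership of \<open>diag1 h\<close> in the group means that it preserves the second system too,
  so it passes the same test as a diagonal generator.\<close>

lemma two_systems_H_of:
  assumes good: "good_gens L Hs"
    and S: "S \<in> systems_of_imprimitivity (refl_group L Hs)"
      "S' \<in> systems_of_imprimitivity (refl_group L Hs)" "S \<noteq> S'"
  shows "H_of (refl_group L Hs) \<subseteq> {1, - 1}"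
proof
  fix h assume h: "h \<in> H_of (refl_group L Hs)"
  have unit: "unit_gens L Hs" using good by (simp add: good_gens_def)
  have u: "unitq h" using refl_group_unitq[OF unit h] .
  obtain T where T: "T \<in> systems_of_imprimitivity (refl_group L Hs)" "T \<noteq> {Line 0, Line_inf}"
    using S by metis
  have "T = {Line 1, Line (- 1)} \<or> (\<exists>x\<in>admissible L Hs. T = pair_of x)"
    using T unfolding systems_iff_good[OF good] by argo
  moreover have "act (diag1 h) T = T"
    using T(1) h by (auto simp: systems_of_imprimitivity_iff H_of_def)
  ultimately show "h \<in> {1, - 1}"
    using act_diag1_pm1[OF u] act_diag1_pair_of[OF u] by (auto simp: admissible_def)
qed

section \<open>Reflections and conjugation\<close>

lemma pow_GLH2_Suc: "A [^]\<^bsub>GLH2\<^esub> Suc n = A [^]\<^bsub>GLH2\<^esub> n ** A"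
  by (simp add: nat_pow_def)

lemma pow_GLH2_0: "A [^]\<^bsub>GLH2\<^esub> (0::nat) = mat 1"
  by (simp add: nat_pow_def)

lemma ord_dvd_iff: "A \<in> carrier GLH2 \<Longrightarrow> group.ord GLH2 A dvd n \<longleftrightarrow> A [^]\<^bsub>GLH2\<^esub> n = mat 1"
  using group.pow_eq_id[OF group_GLH2, of A n] by simp

lemma square_GLH2: "A [^]\<^bsub>GLH2\<^esub> (2::nat) = A ** A"
  by (simp add: numeral_2_eq_2 pow_GLH2_Suc pow_GLH2_0)

lemma ord_eq_2I:
  assumes "A \<in> carrier GLH2" "A ** A = mat 1" "A \<noteq> mat 1"
  shows "group.ord GLH2 A = 2"
proof -
  have "group.ord GLH2 A dvd 2" using assms by (simp add: ord_dvd_iff square_GLH2)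
  then have "group.ord GLH2 A = 1 \<or> group.ord GLH2 A = 2"
    using prime_nat_iff two_is_prime_nat by blast
  moreover have "group.ord GLH2 A \<noteq> 1"
    using group.ord_eq_1[OF group_GLH2 assms(1)] assms(3) by simp
  ultimately show ?thesis by simp
qed

lemma diag1_pow: "diag1 h [^]\<^bsub>GLH2\<^esub> (n::nat) = diag1 (h ^ n)"
proof (induction n)
  case (Suc n)
  then show ?case
    by (simp only: pow_GLH2_Suc diag1_mult power_Suc2)
qed (simp add: pow_GLH2_0 diag1_1)

lemma diag1_reflection:
  assumes "unitq h" "h \<noteq> 1" "h ^ m = 1" "m > 0"
  shows "is_reflection (diag1 h)"
proof -
  have c: "diag1 h \<in> carrier GLH2" using assms by (simp add: diag1_carrier)
  have "group.ord GLH2 (diag1 h) dvd m"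
    using assms by (simp add: ord_dvd_iff[OF c] diag1_pow diag1_1)
  then have "group.ord GLH2 (diag1 h) \<noteq> 0" using assms(4) by (metis dvd_0_left_iff less_not_refl)
  moreover have "diag1 h \<noteq> mat 1" using assms(2) by (simp add: diag1_Mat Mat_one)
  moreover have "diag1 h *v v = v" if "v \<in> Line_inf" for v
    using that by (cases v rule: Vec_cases) (simp add: diag1_Mat)
  ultimately show ?thesis
    unfolding is_reflection_def using c one_dim_subspace_iff by blast
qed

text \<open>A monomial matrix with a nonzero fixed vector is either antidiagonal with mutually
  inverse entries, hence an involution, or diagonal with an entry 1. In the second
  case the swap moves that entry into the lower corner.\<close>

lemma reflection_order_two:
  assumes unit: "unit_gens L Hs" and one: "1 \<in> L"
    and H: "H_of (refl_group L Hs) \<subseteq> {1, - 1}"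
    and r: "r \<in> refl_group L Hs" "is_reflection r"
  shows "group.ord GLH2 r = 2"
proof (rule ord_eq_2I)
  show "r \<in> carrier GLH2" "r \<noteq> mat 1" using r by (simp_all add: is_reflection_def)
  obtain V where V: "one_dim_subspace V" "\<forall>v\<in>V. r *v v = v"
    using r by (auto simp: is_reflection_def)
  then have "\<exists>v\<in>V. v \<noteq> 0"
    unfolding one_dim_subspace_iff Vec_zero
    by (metis Vec_eq_iff Vec_in_Line Vec_in_Line_inf mult_1_right zero_neq_one)
  then obtain v where "v \<noteq> 0" "r *v v = v" using V by blast
  then obtain a b where ab: "a \<noteq> 0 \<or> b \<noteq> 0" "r *v Vec a b = Vec a b"
    by (metis Vec_eta Vec_zero)
  have "(\<exists>p q. r = Mat p 0 0 q) \<or> (\<exists>p q. r = Mat 0 p q 0)"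
    using refl_group_monomial[OF unit] r(1) unfolding monomial_over_def by blast
  then show "r ** r = mat 1"
  proof (elim disjE exE)
    fix p q assume rpq: "r = Mat p 0 0 q"
    have "Mat 0 1 1 0 \<in> refl_group L Hs"
      using refl_group_antidiag[OF one] by (simp add: antidiag_Mat)
    then have "Mat 0 1 1 0 ** r ** Mat 0 1 1 0 \<in> refl_group L Hs"
      using r by (intro refl_group_mult)
    then have "Mat q 0 0 p \<in> refl_group L Hs" by (simp add: rpq)
    with r(1) rpq have "p = 1 \<Longrightarrow> q \<in> H_of (refl_group L Hs)" "q = 1 \<Longrightarrow> p \<in> H_of (refl_group L Hs)"
      by (auto simp: H_of_def diag1_Mat)
    moreover have "p = 1 \<or> q = 1"
      using ab by (auto simp: rpq mult_cancel_right1)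
    ultimately have "(p = 1 \<or> p = - 1) \<and> (q = 1 \<or> q = - 1)" using H by blast
    then show ?thesis by (auto simp: rpq Mat_one)
  next
    fix p q assume rpq: "r = Mat 0 p q 0"
    then have *: "p * b = a" "q * a = b" using ab(2) by simp_all
    then have "a \<noteq> 0" "b \<noteq> 0" using ab(1) by auto
    have "p * q * a = a" "q * p * b = b" using * by (simp_all add: mult.assoc)
    then have "p * q = 1" "q * p = 1" using \<open>a \<noteq> 0\<close> \<open>b \<noteq> 0\<close> by (auto simp: mult_cancel_right1)
    then show ?thesis by (simp add: rpq Mat_one)
  qed
qed

lemma one_in_H_of: "1 \<in> H_of (refl_group L Hs)"
  by (simp add: H_of_def diag1_1 refl_group_one)

lemma subset_doubleton_with_first:
  assumes "a \<in> X"
  shows "X = {a} \<or> X = {a, b} \<longleftrightarrow> X \<subseteq> {a, b}"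
proof
  assume X: "X \<subseteq> {a, b}"
  show "X = {a} \<or> X = {a, b}"
  proof (cases "b \<in> X")
    case True
    then have "{a, b} \<subseteq> X" using assms by simp
    with X have "X = {a, b}" by (rule subset_antisym)
    then show ?thesis ..
  next
    case False
    then have "X \<subseteq> {a}" using X by fast
    then show ?thesis using assms by (metis empty_iff subset_singletonD)
  qed
qed fast

lemmas H_of_cases = subset_doubleton_with_first[OF one_in_H_of, where b = "- 1"]

text \<open>A reflection has finite order by definition, so an element of \<open>H\<close> shows up among the
  reflections only if it is torsion. Hence the assumption that \<open>H\<close> contains a
  torsion element other than \<open>\<plusminus>1\<close> once it is larger than \<open>{1, -1}\<close>.\<close>

lemma reflections_order_two_iff:
  assumes unit: "unit_gens L Hs" and one: "1 \<in> L"
    and H: "H_of (refl_group L Hs) \<subseteq> {1, - 1} \<or>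
      (\<exists>h\<in>H_of (refl_group L Hs). unitq h \<and> h \<noteq> 1 \<and> h \<noteq> - 1 \<and> (\<exists>m>0. h ^ m = 1))"
  shows "H_of (refl_group L Hs) = {1} \<or> H_of (refl_group L Hs) = {1, - 1} \<longleftrightarrow>
    (\<forall>r\<in>refl_group L Hs. is_reflection r \<longrightarrow> group.ord GLH2 r = 2)"
proof (cases "H_of (refl_group L Hs) \<subseteq> {1, - 1}")
  case True
  then show ?thesis unfolding H_of_cases using reflection_order_two[OF unit one True] by simp
next
  case False
  then obtain h m where h: "h \<in> H_of (refl_group L Hs)" "unitq h" "h \<noteq> 1" "h \<noteq> - 1" "m > 0" "h ^ m = 1"
    using H by blast
  then have "is_reflection (diag1 h)" "diag1 h \<in> refl_group L Hs" "diag1 h \<in> carrier GLH2"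
    by (simp_all add: diag1_reflection[of h m] H_of_def diag1_carrier)
  moreover have "group.ord GLH2 (diag1 h) \<noteq> 2"
  proof
    assume "group.ord GLH2 (diag1 h) = 2"
    then have "diag1 h ** diag1 h = mat 1"
      using ord_dvd_iff[of "diag1 h" 2] \<open>diag1 h \<in> carrier GLH2\<close> by (simp add: square_GLH2)
    then have "h * h = 1" by (simp add: diag1_Mat Mat_one)
    with h show False by (simp add: square_eq_1_iff)
  qed
  ultimately show ?thesis unfolding H_of_cases using False by fast
qed

subsection \<open>Conjugation\<close>

definition conjm :: "quat^2^2 \<Rightarrow> quat^2^2 \<Rightarrow> quat^2^2" where
  "conjm P A = P ** A ** inv\<^bsub>GLH2\<^esub> P"

lemma conjugate_iff: "conjugate_GLH2 G K \<longleftrightarrow> (\<exists>P\<in>carrier GLH2. G = conjm P ` K)"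
  by (simp add: conjugate_GLH2_def conjm_def)

lemma conjm_mult:
  assumes "P \<in> carrier GLH2"
  shows "conjm P (A ** B) = conjm P A ** conjm P B"
proof -
  have "conjm P A ** conjm P B = P ** A ** (inv\<^bsub>GLH2\<^esub> P ** P) ** B ** inv\<^bsub>GLH2\<^esub> P"
    by (simp add: conjm_def matrix_mul_assoc)
  then show ?thesis by (simp add: inv_GLH2_left[OF assms] conjm_def matrix_mul_assoc)
qed

lemma conjm_one: "P \<in> carrier GLH2 \<Longrightarrow> conjm P (mat 1) = mat 1"
  unfolding conjm_def by (simp add: inv_GLH2_right)

lemma mult_carrier: "A \<in> carrier GLH2 \<Longrightarrow> B \<in> carrier GLH2 \<Longrightarrow> A ** B \<in> carrier GLH2"
  using monoid.m_closed[OF group.is_monoid[OF group_GLH2], of A B] by simp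

lemma conjm_carrier: "P \<in> carrier GLH2 \<Longrightarrow> A \<in> carrier GLH2 \<Longrightarrow> conjm P A \<in> carrier GLH2"
  unfolding conjm_def by (intro mult_carrier inv_GLH2_carrier)

lemma conjm_conjm:
  assumes "P \<in> carrier GLH2" "Q \<in> carrier GLH2"
  shows "conjm P (conjm Q A) = conjm (P ** Q) A"
proof -
  have "inv\<^bsub>GLH2\<^esub> (P ** Q) = inv\<^bsub>GLH2\<^esub> Q ** inv\<^bsub>GLH2\<^esub> P"
    using group.inv_mult_group[OF group_GLH2 assms] by simp
  then show ?thesis unfolding conjm_def by (simp add: matrix_mul_assoc)
qed

lemma conjm_by_one: "conjm (mat 1) A = A"
  unfolding conjm_def by (simp add: inv_GLH2[of "mat 1" "mat 1"])

lemma one_carrier: "mat 1 \<in> carrier GLH2"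
  by (rule carrier_GLH2I[of _ "mat 1"]) simp_all

lemma conjm_inv:
  assumes "P \<in> carrier GLH2"
  shows "conjm (inv\<^bsub>GLH2\<^esub> P) (conjm P A) = A" "conjm P (conjm (inv\<^bsub>GLH2\<^esub> P) A) = A"
  using assms by (simp_all add: conjm_conjm inv_GLH2_carrier inv_GLH2_left inv_GLH2_right conjm_by_one)

lemma conjugate_refl: "conjugate_GLH2 G G"
proof -
  have "G = conjm (mat 1) ` G" by (simp add: conjm_by_one[abs_def])
  then show ?thesis unfolding conjugate_iff using one_carrier by (rule bexI)
qed

lemma conjugate_sym:
  assumes "conjugate_GLH2 G K"
  shows "conjugate_GLH2 K G"
proof -
  obtain P where P: "P \<in> carrier GLH2" "G = conjm P ` K"
    using assms unfolding conjugate_iff by blast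
  then have "K = conjm (inv\<^bsub>GLH2\<^esub> P) ` G" by (simp add: image_image conjm_inv)
  then show ?thesis unfolding conjugate_iff using inv_GLH2_carrier[OF P(1)] by blast
qed

lemma conjugate_trans:
  assumes "conjugate_GLH2 G K" "conjugate_GLH2 K M"
  shows "conjugate_GLH2 G M"
proof -
  obtain P Q where PQ: "P \<in> carrier GLH2" "G = conjm P ` K" "Q \<in> carrier GLH2" "K = conjm Q ` M"
    using assms unfolding conjugate_iff by blast
  then have "G = conjm (P ** Q) ` M" by (simp add: image_image conjm_conjm)
  then show ?thesis unfolding conjugate_iff using mult_carrier[OF PQ(1,3)] by blast
qed

lemma conjm_pow:
  "P \<in> carrier GLH2 \<Longrightarrow> conjm P A [^]\<^bsub>GLH2\<^esub> (n::nat) = conjm P (A [^]\<^bsub>GLH2\<^esub> n)"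
  by (induction n) (simp_all only: pow_GLH2_Suc pow_GLH2_0 conjm_one conjm_mult)

lemma conjm_eq_one_iff:
  assumes "P \<in> carrier GLH2"
  shows "conjm P A = mat 1 \<longleftrightarrow> A = mat 1"
proof
  assume "conjm P A = mat 1"
  then have "conjm (inv\<^bsub>GLH2\<^esub> P) (conjm P A) = mat 1"
    using conjm_one[OF inv_GLH2_carrier[OF assms]] by simp
  then show "A = mat 1" by (simp add: conjm_inv[OF assms])
qed (simp add: conjm_one assms)

lemma ord_conjm:
  assumes "P \<in> carrier GLH2" "A \<in> carrier GLH2"
  shows "group.ord GLH2 (conjm P A) = group.ord GLH2 A"
proof (rule dvd_antisym)
  have "group.ord GLH2 (conjm P A) dvd n \<longleftrightarrow> group.ord GLH2 A dvd n" for n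
    using assms conjm_carrier[OF assms]
    by (simp add: ord_dvd_iff conjm_pow conjm_eq_one_iff)
  then show "group.ord GLH2 (conjm P A) dvd group.ord GLH2 A"
    "group.ord GLH2 A dvd group.ord GLH2 (conjm P A)" by (metis dvd_refl)+
qed

lemma image_one_dim:
  assumes "P \<in> carrier GLH2" "one_dim_subspace V"
  shows "one_dim_subspace ((*v) P ` V)"
proof -
  obtain v where v: "v \<noteq> 0" "V = range (rscale v)" using assms(2) by (auto simp: one_dim_subspace_def)
  have "P *v rscale v c = rscale (P *v v) c" for c
    by (simp add: vec_eq_iff rscale_def matrix_vector_mult_def sum_distrib_right mult.assoc)
  then have "(*v) P ` V = range (rscale (P *v v))" by (simp add: v image_image)
  moreover have "P *v v \<noteq> 0"
  proof
    assume "P *v v = 0"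
    then have "inv\<^bsub>GLH2\<^esub> P *v (P *v v) = 0" by simp
    then show False using v assms(1) by (simp add: matrix_vector_mul_assoc inv_GLH2_left)
  qed
  ultimately show ?thesis unfolding one_dim_subspace_def by blast
qed

lemma act_inv:
  assumes "P \<in> carrier GLH2"
  shows "act (inv\<^bsub>GLH2\<^esub> P) (act P S) = S" "act P (act (inv\<^bsub>GLH2\<^esub> P) S) = S"
  unfolding act_mult[symmetric] inv_GLH2_left[OF assms] inv_GLH2_right[OF assms] by (rule act_one)+

lemma image_inv:
  assumes "P \<in> carrier GLH2"
  shows "(*v) (inv\<^bsub>GLH2\<^esub> P) ` (*v) P ` U = U"
  by (simp add: image_image matrix_vector_mul_assoc inv_GLH2_left[OF assms])

text \<open>Conjugating the group by \<open>P\<close> and moving the lines by \<open>P\<close> are the same change of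
  coordinates.\<close>

lemma act_system:
  assumes P: "P \<in> carrier GLH2" and S: "S \<in> systems_of_imprimitivity K"
  shows "act P S \<in> systems_of_imprimitivity (conjm P ` K)"
proof -
  obtain U W where UW: "S = {U, W}" "one_dim_subspace U" "one_dim_subspace W" "U \<noteq> W"
    and st: "\<forall>g\<in>K. act g S = S"
    using S by (auto simp: systems_of_imprimitivity_iff)
  have "act P S = {(*v) P ` U, (*v) P ` W}" by (simp add: act_def UW(1))
  moreover have "(*v) P ` U \<noteq> (*v) P ` W" using image_inv[OF P] UW(4) by metis
  moreover have "act (conjm P g) (act P S) = act P S" if "g \<in> K" for g
    using st that by (simp add: conjm_def act_mult act_inv[OF P])
  ultimately show ?thesis
    unfolding systems_of_imprimitivity_iff
    using image_one_dim[OF P UW(2)] image_one_dim[OF P UW(3)]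
    by (intro exI[of _ "(*v) P ` U"] exI[of _ "(*v) P ` W"]) simp
qed

lemma bij_systems:
  assumes P: "P \<in> carrier GLH2"
  shows "bij_betw (act P) (systems_of_imprimitivity K) (systems_of_imprimitivity (conjm P ` K))"
proof (rule bij_betw_byWitness[of _ "act (inv\<^bsub>GLH2\<^esub> P)"])
  have "conjm (inv\<^bsub>GLH2\<^esub> P) ` conjm P ` K = K" using P by (simp add: image_image conjm_inv)
  then show "act (inv\<^bsub>GLH2\<^esub> P) ` systems_of_imprimitivity (conjm P ` K) \<subseteq> systems_of_imprimitivity K"
    using act_system[OF inv_GLH2_carrier[OF P], of _ "conjm P ` K"] by (intro image_subsetI) simp
  show "act P ` systems_of_imprimitivity K \<subseteq> systems_of_imprimitivity (conjm P ` K)"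
    using act_system[OF P] by (intro image_subsetI)
qed (simp_all add: act_inv[OF P])

lemma bij_betw_two_elements:
  assumes "bij_betw f A B"
  shows "(\<exists>x\<in>A. \<exists>y\<in>A. x \<noteq> y) \<longleftrightarrow> (\<exists>x\<in>B. \<exists>y\<in>B. x \<noteq> y)"
proof -
  have "B = f ` A" "inj_on f A" using assms by (simp_all add: bij_betw_def)
  then show ?thesis by (auto simp: inj_on_eq_iff)
qed

lemma conjugate_systems:
  assumes "conjugate_GLH2 G K"
  shows "finite (systems_of_imprimitivity G) \<longleftrightarrow> finite (systems_of_imprimitivity K)"
    "card (systems_of_imprimitivity G) = card (systems_of_imprimitivity K)"
    "(\<exists>S\<in>systems_of_imprimitivity G. \<exists>S'\<in>systems_of_imprimitivity G. S \<noteq> S') \<longleftrightarrow>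
     (\<exists>S\<in>systems_of_imprimitivity K. \<exists>S'\<in>systems_of_imprimitivity K. S \<noteq> S')"
proof -
  obtain P where P: "P \<in> carrier GLH2" "G = conjm P ` K"
    using assms unfolding conjugate_iff by (elim bexE)
  note bij = bij_systems[OF P(1), of K, folded P(2)]
  show "finite (systems_of_imprimitivity G) \<longleftrightarrow> finite (systems_of_imprimitivity K)"
    using bij_betw_finite[OF bij] by simp
  show "card (systems_of_imprimitivity G) = card (systems_of_imprimitivity K)"
    using bij_betw_same_card[OF bij] by simp
  show "(\<exists>S\<in>systems_of_imprimitivity G. \<exists>S'\<in>systems_of_imprimitivity G. S \<noteq> S') \<longleftrightarrow>
     (\<exists>S\<in>systems_of_imprimitivity K. \<exists>S'\<in>systems_of_imprimitivity K. S \<noteq> S')"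
    using bij by (rule bij_betw_two_elements[symmetric])
qed

lemma conjm_reflection:
  assumes P: "P \<in> carrier GLH2" and r: "is_reflection r"
  shows "is_reflection (conjm P r)"
proof -
  obtain V where V: "one_dim_subspace V" "\<forall>v\<in>V. r *v v = v"
    using r by (auto simp: is_reflection_def)
  have "conjm P r *v (P *v v) = P *v v" if "v \<in> V" for v
  proof -
    have "conjm P r *v (P *v v) = (P ** r ** (inv\<^bsub>GLH2\<^esub> P ** P)) *v v"
      by (simp add: conjm_def matrix_vector_mul_assoc matrix_mul_assoc)
    also have "\<dots> = P *v (r *v v)"
      by (simp add: inv_GLH2_left[OF P] matrix_vector_mul_assoc)
    finally show ?thesis using V that by simp
  qed
  then have "one_dim_subspace ((*v) P ` V) \<and> (\<forall>v\<in>(*v) P ` V. conjm P r *v v = v)"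
    using image_one_dim[OF P V(1)] by auto
  then show ?thesis
    using r P ord_conjm[OF P, of r] conjm_carrier[OF P, of r] conjm_eq_one_iff[OF P, of r]
    unfolding is_reflection_def by fastforce
qed

lemma conjugate_reflection_orders:
  assumes "conjugate_GLH2 G K" "K \<subseteq> carrier GLH2"
    and "\<forall>r\<in>K. is_reflection r \<longrightarrow> group.ord GLH2 r = 2"
  shows "\<forall>r\<in>G. is_reflection r \<longrightarrow> group.ord GLH2 r = 2"
proof (intro ballI impI)
  fix r assume r: "r \<in> G" "is_reflection r"
  obtain P where P: "P \<in> carrier GLH2" "G = conjm P ` K"
    using assms unfolding conjugate_iff by blast
  then obtain s where s: "s \<in> K" "r = conjm P s" using r by auto
  have "is_reflection s"
    using conjm_reflection[OF inv_GLH2_carrier[OF P(1)] r(2)] P(1) by (simp add: s conjm_inv)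
  then show "group.ord GLH2 r = 2"
    using assms(2,3) s P(1) ord_conjm by auto
qed

subsection \<open>Real traces\<close>

text \<open>A quarter of the trace of the matrix as a real endomorphism. The sum of the diagonal
  entries is itself not invariant under conjugation, because the quaternions do not
  commute.\<close>

definition re_trace :: "quat^2^2 \<Rightarrow> real" where
  "re_trace A = qre (A $ 1 $ 1) + qre (A $ 2 $ 2)"

lemma re_trace_Mat [simp]: "re_trace (Mat a b c d) = qre a + qre d"
  by (simp add: re_trace_def)

lemma qre_add: "qre (p + q) = qre p + qre q"
  by (simp add: quat_simps)

lemma re_trace_commute: "re_trace (A ** B) = re_trace (B ** A)"
proof -
  obtain a b c d where A: "A = Mat a b c d" by (rule Mat_cases)
  obtain a' b' c' d' where B: "B = Mat a' b' c' d'" by (rule Mat_cases)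
  show ?thesis
    using Re_mult_commute[of a a'] Re_mult_commute[of b c'] Re_mult_commute[of c b'] Re_mult_commute[of d d']
    by (simp add: A B qre_add)
qed

lemma re_trace_conjm:
  assumes "P \<in> carrier GLH2"
  shows "re_trace (conjm P A) = re_trace A"
proof -
  have "re_trace (conjm P A) = re_trace (inv\<^bsub>GLH2\<^esub> P ** (P ** A))"
    unfolding conjm_def by (rule re_trace_commute)
  then show ?thesis by (simp add: matrix_mul_assoc inv_GLH2_left[OF assms])
qed

lemma conjugate_re_trace:
  assumes "conjugate_GLH2 G K"
  shows "re_trace ` G = re_trace ` K"
proof -
  obtain P where "P \<in> carrier GLH2" "G = conjm P ` K"
    using assms unfolding conjugate_iff by (elim bexE)
  then show ?thesis by (simp add: image_image re_trace_conjm)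
qed

section \<open>Systems of the exceptional groups\<close>

lemmas quat_consts = ii_def jj_def kk_def ww_def vv_def

lemma tau_square: "tau * tau = tau + 1"
  by (simp add: tau_def field_simps)

lemma tau_pos: "tau > 1"
proof -
  have "sqrt 5 > 1" by simp
  then show ?thesis by (simp add: tau_def)
qed

lemma admissible_nonpure: "x \<in> admissible L Hs \<Longrightarrow> b \<in> L \<Longrightarrow> qre b \<noteq> 0 \<Longrightarrow> imdot x b = 0"
  by (auto simp: admissible_def quat_simps)

lemma admissible_pure:
  "x \<in> admissible L Hs \<Longrightarrow> b \<in> L \<Longrightarrow> imdot x b = 0 \<or> x = b \<or> x = - b"
  by (auto simp: admissible_def)

lemma admissible_cases:
  assumes "x \<in> admissible L Hs"
  obtains a b c where "x = Quat 0 a b c" "a \<noteq> 0 \<or> b \<noteq> 0 \<or> c \<noteq> 0"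
  using assms by (cases x) (auto simp: admissible_def quat_simps)

lemma ww_noncentral: "ww \<noteq> 1" "ww \<noteq> - 1" "qre ww \<noteq> 0"
  by (simp_all add: ww_def quat_simps)

lemma good_gensI:
  assumes "\<And>q. q \<in> L \<Longrightarrow> unitq q" "\<And>q. q \<in> Hs \<Longrightarrow> unitq q" "1 \<in> L" "b \<in> L" "b \<noteq> 1" "b \<noteq> - 1"
  shows "good_gens L Hs"
  using assms unfolding good_gens_def unit_gens_def by blast

lemma unitq_basic: "unitq ii" "unitq jj" "unitq kk" "unitq ww"
  by (simp_all add: unitq_iff quat_consts power2_eq_square)

lemma unitq_sqrt2:
  "unitq (Quat (1/sqrt 2) (1/sqrt 2) 0 0)" "unitq (Quat (1/sqrt 2) 0 (1/sqrt 2) 0)"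
  by (simp_all add: unitq_iff power_divide)

lemma tau_sigma_squares: "tau\<^sup>2 = tau + 1" "sigma\<^sup>2 = 2 - tau" "tau * sigma = - 1" "sigma * tau = - 1"
  using tau_square by (simp_all add: sigma_def power2_eq_square algebra_simps)

lemma unitq_icosian:
  "unitq vv" "unitq (Quat 0 (-tau/2) (1/2) (-sigma/2))" "unitq (Quat 0 (1/2) (sigma/2) (tau/2))"
  by (simp_all add: unitq_iff vv_def power_divide tau_sigma_squares add_divide_distrib[symmetric])

lemma good_T_T_T: "good_gens {1, ii} {ww}"
  by (rule good_gensI[of _ _ ii]) (auto simp: unitq_basic, simp_all add: quat_consts quat_simps)

lemma good_with_ww:
  assumes "\<forall>q\<in>L. unitq q" "Hs \<subseteq> {1, - 1}" "1 \<in> L" "ww \<in> L"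
  shows "good_gens L Hs"
  by (rule good_gensI[of _ _ ww]) (use assms ww_noncentral in auto)

lemma count_one_ww:
  assumes "good_gens L Hs" "ww \<in> L"
    "\<And>a b c. Quat 0 a b c \<in> admissible L Hs \<Longrightarrow> a = 0 \<and> b = 0 \<and> c = 0"
  shows "count_systems (refl_group L Hs) 1"
proof -
  have "x \<notin> admissible L Hs" for x
    using assms(3) by (metis admissible_cases)
  then show ?thesis using count_one[OF assms(1,2) ww_noncentral] by auto
qed

lemma admissible_ww: "Quat 0 a b c \<in> admissible L Hs \<Longrightarrow> ww \<in> L \<Longrightarrow> a + b + c = 0"
  using admissible_nonpure[of "Quat 0 a b c" L Hs ww] by (simp add: ww_def imdot_def)

text \<open>The imaginary parts of \<open>ii\<close> and \<open>ww\<close> span the plane orthogonal to \<open>jj - kk\<close>. The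
  alternative that \<open>x\<close> is \<open>\<plusminus>ii\<close> fails since \<open>ii\<close> is not orthogonal to the imaginary
  part of \<open>ww\<close>.\<close>

lemma admissible_ii_ww:
  assumes "Quat 0 a b c \<in> admissible L Hs" "ii \<in> L" "ww \<in> L"
  shows "a = 0 \<and> c = - b"
proof -
  have "a = 0 \<or> b = 0 \<and> c = 0"
    using admissible_pure[OF assms(1,2)] by (auto simp: ii_def imdot_def quat_simps)
  then show ?thesis using admissible_ww[OF assms(1,3)] by auto
qed

lemma admissible_jj_ww:
  assumes "Quat 0 a b c \<in> admissible L Hs" "jj \<in> L" "ww \<in> L"
  shows "b = 0 \<and> c = - a"
proof -
  have "b = 0 \<or> a = 0 \<and> c = 0"
    using admissible_pure[OF assms(1,2)] by (auto simp: jj_def imdot_def quat_simps)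
  then show ?thesis using admissible_ww[OF assms(1,3)] by auto
qed

definition eighth_root :: quat where "eighth_root = Quat (1/sqrt 2) (1/sqrt 2) 0 0"
definition eighth_root_jj :: quat where "eighth_root_jj = Quat (1/sqrt 2) 0 (1/sqrt 2) 0"
definition jk_unit :: quat where "jk_unit = Quat 0 0 (1/sqrt 2) (-1/sqrt 2)"

lemma admissible_eighth_root_ww:
  assumes "Quat 0 a b c \<in> admissible L Hs" "eighth_root \<in> L" "ww \<in> L"
  shows "a = 0 \<and> c = - b"
  using admissible_nonpure[OF assms(1,2)] admissible_ww[OF assms(1,3)]
  by (simp add: eighth_root_def imdot_def)

lemma good_T_T_Q8: "good_gens {1, ii, jj, ww} {}"
  by (rule good_with_ww) (auto simp: unitq_basic)

text \<open>The direction \<open>jj - kk\<close> left by \<open>ii\<close> and \<open>ww\<close> is neither orthogonal nor parallel to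
  \<open>jj\<close>.\<close>

lemma count_T_T_Q8: "count_systems (refl_group {1, ii, jj, ww} {}) 1"
proof (rule count_one_ww[OF good_T_T_Q8])
  fix a b c assume "Quat 0 a b c \<in> admissible {1, ii, jj, ww} {}"
  from admissible_ii_ww[OF this] admissible_jj_ww[OF this]
  show "a = 0 \<and> b = 0 \<and> c = 0" by simp
qed simp

lemma good_O_O_O: "good_gens {1, ww} {eighth_root}"
  by (rule good_gensI[of _ _ ww]) (use ww_noncentral in \<open>auto simp: unitq_basic unitq_sqrt2 eighth_root_def\<close>)

lemma good_O_O_T: "good_gens {1, eighth_root, eighth_root_jj, ww} {}"
  by (rule good_with_ww) (auto simp: unitq_basic unitq_sqrt2 eighth_root_def eighth_root_jj_def)

lemma count_O_O_T: "count_systems (refl_group {1, eighth_root, eighth_root_jj, ww} {}) 1"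
proof (rule count_one_ww[OF good_O_O_T])
  fix a b c assume *: "Quat 0 a b c \<in> admissible {1, eighth_root, eighth_root_jj, ww} {}"
  have "b = 0"
    using admissible_nonpure[OF *, of eighth_root_jj] by (simp add: eighth_root_jj_def imdot_def)
  then show "a = 0 \<and> b = 0 \<and> c = 0" using admissible_eighth_root_ww[OF *] by simp
qed simp

lemma good_O_L32_Q8: "good_gens {1, eighth_root, jj, ww} {}"
  by (rule good_with_ww) (auto simp: unitq_basic unitq_sqrt2 eighth_root_def)

lemma count_O_L32_Q8: "count_systems (refl_group {1, eighth_root, jj, ww} {}) 1"
proof (rule count_one_ww[OF good_O_L32_Q8])
  fix a b c assume "Quat 0 a b c \<in> admissible {1, eighth_root, jj, ww} {}"
  from admissible_eighth_root_ww[OF this] admissible_jj_ww[OF this]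
  show "a = 0 \<and> b = 0 \<and> c = 0" by simp
qed simp

lemma good_I_I_I: "good_gens {1, ii, ww, vv} {}"
  by (rule good_with_ww) (auto simp: unitq_basic unitq_icosian)

lemma vv_nonpure: "qre vv \<noteq> 0"
  using tau_pos by (simp add: vv_def)

lemma admissible_vv: "Quat 0 a b c \<in> admissible L Hs \<Longrightarrow> vv \<in> L \<Longrightarrow> b = sigma * a"
  using admissible_nonpure[of "Quat 0 a b c" L Hs vv] vv_nonpure by (simp add: vv_def imdot_def mult.commute)

lemma count_I_I_I: "count_systems (refl_group {1, ii, ww, vv} {}) 1"
proof (rule count_one_ww[OF good_I_I_I])
  fix a b c assume "Quat 0 a b c \<in> admissible {1, ii, ww, vv} {}"
  from admissible_ii_ww[OF this] admissible_vv[OF this]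
  show "a = 0 \<and> b = 0 \<and> c = 0" by simp
qed simp

abbreviation icosian_uu :: quat where "icosian_uu \<equiv> Quat 0 (1/2) (sigma/2) (tau/2)"

lemma good_I_L20:
  assumes "Hs \<subseteq> {1, - 1}"
  shows "good_gens {1, ii, ww, icosian_uu} Hs"
  by (rule good_with_ww) (use assms in \<open>auto simp: unitq_basic unitq_icosian\<close>)

text \<open>The last generator is not orthogonal to the direction \<open>jj - kk\<close>, because \<open>\<tau>\<close> and \<open>\<sigma>\<close>
  differ, and not parallel to it, because of its \<open>ii\<close> coordinate.\<close>

lemma count_I_L20:
  assumes "Hs \<subseteq> {1, - 1}"
  shows "count_systems (refl_group {1, ii, ww, icosian_uu} Hs) 1"
proof (rule count_one_ww[OF good_I_L20[OF assms]])
  fix a b c assume *: "Quat 0 a b c \<in> admissible {1, ii, ww, icosian_uu} Hs"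
  have ac: "a = 0" "c = - b" using admissible_ii_ww[OF *] by simp_all
  have "imdot (Quat 0 a b c) icosian_uu = 0"
    using admissible_pure[OF *, of icosian_uu] ac by (auto simp: quat_simps)
  then have "b * (sigma - tau) = 0" using ac by (simp add: imdot_def algebra_simps)
  moreover have "sigma - tau \<noteq> 0" using tau_pos by (simp add: sigma_def)
  ultimately show "a = 0 \<and> b = 0 \<and> c = 0" using ac by simp
qed simp

subsection \<open>Two systems\<close>

lemma jk_unit_square: "jk_unit * jk_unit = - 1"
  by (simp add: jk_unit_def quat_simps)

lemma unitq_jk_unit: "unitq jk_unit"
  by (simp add: jk_unit_def unitq_iff power_divide)

lemma good_T_L12_C2: "good_gens {1, ii, ww} {- 1}"
  by (rule good_with_ww) (auto simp: unitq_basic)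

text \<open>The diagonal generator -1 singles out the two unit vectors among the multiples of
  \<open>jj - kk\<close>, and these have the same pair of lines.\<close>

lemma count_T_L12_C2: "count_systems (refl_group {1, ii, ww} {- 1}) 2"
proof (rule count_two[OF good_T_L12_C2 _ ww_noncentral _ jk_unit_square])
  fix y
  show "y \<in> admissible {1, ii, ww} {- 1} \<longleftrightarrow> y = jk_unit \<or> y = - jk_unit"
  proof
    assume y: "y \<in> admissible {1, ii, ww} {- 1}"
    then obtain a b c where abc: "y = Quat 0 a b c" by (rule admissible_cases)
    have ac: "a = 0" "c = - b" using admissible_ii_ww y abc by blast+
    have "y * y = - 1" using y minus_one_neq_one by (simp add: admissible_def)
    then have "(1 / sqrt 2)\<^sup>2 = b\<^sup>2"
      by (simp add: abc ac quat_simps power_divide power2_eq_square[of b])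
    then have "b = 1 / sqrt 2 \<or> b = - (1 / sqrt 2)" by (metis power2_eq_iff)
    then show "y = jk_unit \<or> y = - jk_unit" by (auto simp: abc ac jk_unit_def quat_simps)
  next
    assume "y = jk_unit \<or> y = - jk_unit"
    then show "y \<in> admissible {1, ii, ww} {- 1}"
      using jk_unit_square by (auto simp: admissible_def) (simp_all add: jk_unit_def quat_simps quat_consts imdot_def)
  qed
qed simp

text \<open>Being a generator, \<open>jk_unit\<close> is not orthogonal to its own direction and therefore
  admits only the slopes \<open>\<plusminus>jk_unit\<close>.\<close>

lemma admissible_jk_unit:
  assumes "\<And>a b c. Quat 0 a b c \<in> admissible L {} \<Longrightarrow> a = 0 \<and> c = - b"
    and "jk_unit \<in> L" "\<And>b. b \<in> L \<Longrightarrow> b = jk_unit \<or> imdot jk_unit b = 0"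
  shows "y \<in> admissible L {} \<longleftrightarrow> y = jk_unit \<or> y = - jk_unit"
proof
  assume y: "y \<in> admissible L {}"
  then obtain a b c where abc: "y = Quat 0 a b c" "a \<noteq> 0 \<or> b \<noteq> 0 \<or> c \<noteq> 0" by (rule admissible_cases)
  have ac: "a = 0" "c = - b" using assms(1) y abc by blast+
  then have "imdot y jk_unit \<noteq> 0" using abc by (simp add: imdot_def jk_unit_def)
  then show "y = jk_unit \<or> y = - jk_unit" using admissible_pure[OF y assms(2)] by simp
next
  have "qre jk_unit = 0" "jk_unit \<noteq> 0" "imdot (- jk_unit) b = - imdot jk_unit b" "- jk_unit \<noteq> 0"
    "qre (- jk_unit) = 0" for b
    by (simp_all add: jk_unit_def quat_simps imdot_def)
  then show "y \<in> admissible L {}" if "y = jk_unit \<or> y = - jk_unit"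
    using that assms(3) unfolding admissible_def by fastforce
qed

lemma good_O_L20_C2: "good_gens {1, eighth_root, ww, jk_unit} {}"
  by (rule good_with_ww) (auto simp: unitq_basic unitq_sqrt2 eighth_root_def unitq_jk_unit)

lemma count_O_L20_C2: "count_systems (refl_group {1, eighth_root, ww, jk_unit} {}) 2"
proof (rule count_two[OF good_O_L20_C2 _ ww_noncentral admissible_jk_unit jk_unit_square])
  show "b = jk_unit \<or> imdot jk_unit b = 0" if "b \<in> {1, eighth_root, ww, jk_unit}" for b
    using that by (auto simp: imdot_def jk_unit_def eighth_root_def ww_def quat_simps)
qed (use admissible_eighth_root_ww in auto)

lemma good_O_L14_1: "good_gens {1, ii, ww, jk_unit} {}"
  by (rule good_with_ww) (auto simp: unitq_basic unitq_jk_unit)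

lemma count_O_L14_1: "count_systems (refl_group {1, ii, ww, jk_unit} {}) 2"
proof (rule count_two[OF good_O_L14_1 _ ww_noncentral admissible_jk_unit jk_unit_square])
  show "b = jk_unit \<or> imdot jk_unit b = 0" if "b \<in> {1, ii, ww, jk_unit}" for b
    using that by (auto simp: imdot_def jk_unit_def ii_def ww_def quat_simps)
qed (use admissible_ii_ww in auto)

definition icosian_pp :: quat where "icosian_pp = Quat 0 (-tau/2) (1/2) (-sigma/2)"

lemma unitq_icosian_pp: "unitq icosian_pp"
  unfolding icosian_pp_def by (rule unitq_icosian)

lemma good_I_L32_C2: "good_gens {1, ww, vv, icosian_pp} {}"
  by (rule good_with_ww) (auto simp: unitq_basic unitq_icosian unitq_icosian_pp)

lemma icosian_pp_orth: "imdot icosian_pp ww = 0" "imdot icosian_pp vv = 0"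
  using tau_square by (simp_all add: imdot_def icosian_pp_def ww_def vv_def sigma_def field_simps)

text \<open>The pure generator is the unit normal of the plane spanned by the imaginary parts of
  the two others.\<close>

lemma count_I_L32_C2: "count_systems (refl_group {1, ww, vv, icosian_pp} {}) 2"
proof (rule count_two[OF good_I_L32_C2 _ ww_noncentral])
  show sq: "icosian_pp * icosian_pp = - 1"
    by (subst unitq_square_eq_minus_1[OF unitq_icosian_pp]) (simp add: icosian_pp_def)
  fix y
  show "y \<in> admissible {1, ww, vv, icosian_pp} {} \<longleftrightarrow> y = icosian_pp \<or> y = - icosian_pp"
  proof
    assume y: "y \<in> admissible {1, ww, vv, icosian_pp} {}"
    then obtain a b c where abc: "y = Quat 0 a b c" "a \<noteq> 0 \<or> b \<noteq> 0 \<or> c \<noteq> 0" by (rule admissible_cases)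
    have "a + b + c = 0" "b = sigma * a" using admissible_ww admissible_vv y abc(1) by blast+
    then have bc: "b = sigma * a" "c = - (1 + sigma) * a" by (simp_all add: algebra_simps)
    then have "a \<noteq> 0" using abc by auto
    have "2 * imdot y icosian_pp = a * (- tau + sigma + sigma * (1 + sigma))"
      by (simp add: abc bc imdot_def icosian_pp_def algebra_simps)
    also have "- tau + sigma + sigma * (1 + sigma) = 4 - 4 * tau"
      using tau_square by (simp add: sigma_def algebra_simps)
    finally have "imdot y icosian_pp \<noteq> 0" using \<open>a \<noteq> 0\<close> tau_pos by auto
    then show "y = icosian_pp \<or> y = - icosian_pp"
      using admissible_pure[OF y, of icosian_pp] by simp
  next
    have "qre icosian_pp = 0" "icosian_pp \<noteq> 0" "imdot (- icosian_pp) b = - imdot icosian_pp b"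
      "- icosian_pp \<noteq> 0" "qre (- icosian_pp) = 0" "imdot icosian_pp 1 = 0" for b
      by (simp_all add: icosian_pp_def quat_simps imdot_def)
    then show "y \<in> admissible {1, ww, vv, icosian_pp} {}" if "y = icosian_pp \<or> y = - icosian_pp"
      using that by (elim disjE) (simp_all add: icosian_pp_orth admissible_def)
  qed
qed simp

subsection \<open>Infinitely many systems\<close>

lemma good_T_L12_1: "good_gens {1, ii, ww} {}"
  by (rule good_with_ww) (auto simp: unitq_basic)

text \<open>All nonzero multiples of \<open>jj - kk\<close> are admissible.\<close>

lemma infinite_T_L12_1: "infinite (systems_of_imprimitivity (refl_group {1, ii, ww} {}))"
  by (rule infinite_systems[OF good_T_L12_1, of 0 1 "- 1"])
     (auto simp: admissible_def imdot_def quat_simps quat_consts)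

lemma good_O_L18_1: "good_gens {1, eighth_root, ww} {}"
  by (rule good_with_ww) (auto simp: unitq_basic unitq_sqrt2 eighth_root_def)

lemma infinite_O_L18_1: "infinite (systems_of_imprimitivity (refl_group {1, eighth_root, ww} {}))"
  by (rule infinite_systems[OF good_O_L18_1, of 0 1 "- 1"])
     (auto simp: admissible_def imdot_def quat_simps quat_consts eighth_root_def)

lemma good_I_L30_1: "good_gens {1, ww, vv} {}"
  by (rule good_with_ww) (auto simp: unitq_basic unitq_icosian)

text \<open>All nonzero multiples of the vector product of the imaginary parts of \<open>ww\<close> and \<open>vv\<close>
  are admissible.\<close>

lemma infinite_I_L30_1: "infinite (systems_of_imprimitivity (refl_group {1, ww, vv} {}))"
  by (rule infinite_systems[OF good_I_L30_1, of 1 sigma "- (1 + sigma)"])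
     (auto simp: admissible_def imdot_def quat_simps quat_consts field_simps)

section \<open>The subgroup H of the exceptional groups\<close>

text \<open>The dichotomy under which the orders of the reflections determine whether \<open>H\<close> is
  contained in \<open>{1, -1}\<close>; an element of infinite order in \<open>H\<close> would give no
  reflection.\<close>

definition tame :: "(quat^2^2) set \<Rightarrow> bool" where
  "tame K \<longleftrightarrow> H_of K \<subseteq> {1, - 1} \<or>
     (\<exists>h\<in>H_of K. unitq h \<and> h \<noteq> 1 \<and> h \<noteq> - 1 \<and> (\<exists>m>0. h ^ m = 1))"

lemma tameI: "diag1 h \<in> K \<Longrightarrow> unitq h \<Longrightarrow> h \<noteq> 1 \<Longrightarrow> h \<noteq> - 1 \<Longrightarrow> h ^ m = 1 \<Longrightarrow> m > 0 \<Longrightarrow> tame K"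
  unfolding tame_def H_of_def by blast

lemma two_elementsI:
  assumes "infinite X \<or> card X \<ge> 2"
  shows "\<exists>S\<in>X. \<exists>S'\<in>X. S \<noteq> S'"
proof (rule ccontr)
  assume *: "\<not> (\<exists>S\<in>X. \<exists>S'\<in>X. S \<noteq> S')"
  have "X \<subseteq> {S}" if "S \<in> X" for S using * that by blast
  then have "finite X \<and> card X \<le> 1"
    by (metis card.empty card_mono card_1_singleton_iff ex_in_conv finite.emptyI finite.insertI
      finite_subset le0 One_nat_def)
  with assms show False by auto
qed

lemma tame_two_systems:
  assumes "good_gens L Hs" "count_systems (refl_group L Hs) m" "m \<ge> 2"
  shows "tame (refl_group L Hs)"
proof -
  have "\<exists>S\<in>systems_of_imprimitivity (refl_group L Hs). \<exists>S'\<in>systems_of_imprimitivity (refl_group L Hs). S \<noteq> S'"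
    by (rule two_elementsI) (use assms in \<open>simp add: count_systems_def\<close>)
  then show ?thesis unfolding tame_def using two_systems_H_of[OF assms(1)] by blast
qed

lemma tame_infinite:
  assumes "good_gens L Hs" "infinite (systems_of_imprimitivity (refl_group L Hs))"
  shows "tame (refl_group L Hs)"
proof -
  have "\<exists>S\<in>systems_of_imprimitivity (refl_group L Hs). \<exists>S'\<in>systems_of_imprimitivity (refl_group L Hs). S \<noteq> S'"
    by (rule two_elementsI) (use assms in simp)
  then show ?thesis unfolding tame_def using two_systems_H_of[OF assms(1)] by blast
qed

text \<open>Products with the swap turn the antidiagonal generators into diagonal matrices whose
  second entry is the conjugate of the first. A word in these matrices has as its
  second entry the word in the conjugates, in the same order.\<close>

lemma refl_group_rotation:
  assumes "1 \<in> L" "b \<in> L"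
  shows "Mat b 0 0 (qcnj b) \<in> refl_group L Hs" "Mat (qcnj b) 0 0 b \<in> refl_group L Hs"
  using refl_group_mult[OF refl_group_antidiag[OF assms(2)] refl_group_antidiag[OF assms(1)], of Hs]
    refl_group_mult[OF refl_group_antidiag[OF assms(1)] refl_group_antidiag[OF assms(2)], of Hs]
  by (simp_all add: antidiag_Mat)

lemma refl_group_mult_diag:
  "Mat a 0 0 b \<in> refl_group L Hs \<Longrightarrow> Mat c 0 0 d \<in> refl_group L Hs \<Longrightarrow> Mat (a * c) 0 0 (b * d) \<in> refl_group L Hs"
  using refl_group_mult[of "Mat a 0 0 b" L Hs "Mat c 0 0 d"] by simp

lemma tame_T_T_T: "tame (refl_group {1, ii} {ww})"
proof (rule tameI[OF refl_group_diag1])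
  show "ww ^ 6 = 1"
    by (simp add: numeral_eq_Suc) (simp add: ww_def quat_simps)
qed (use ww_noncentral in \<open>simp_all add: unitq_basic\<close>)

lemma tame_O_O_O: "tame (refl_group {1, ww} {eighth_root})"
proof (rule tameI[OF refl_group_diag1])
  have "eighth_root * eighth_root = ii"
    by (simp add: eighth_root_def ii_def quat_simps)
  moreover have "ii * ii = - 1" by (simp add: ii_def quat_simps)
  moreover have "eighth_root ^ 8 =
    ((eighth_root * eighth_root) * (eighth_root * eighth_root)) * ((eighth_root * eighth_root) * (eighth_root * eighth_root))"
    by (simp add: numeral_eq_Suc mult.assoc)
  ultimately show "eighth_root ^ 8 = 1" by simp
qed (simp_all add: eighth_root_def unitq_sqrt2, simp_all add: quat_simps)

text \<open>The relation \<open>ww * ii * qcnj ww = jj\<close> makes a word in the conjugates trivial, while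
  the same word in the elements themselves involves \<open>qcnj ww * ii * ww = kk\<close> instead
  and gives \<open>- ii\<close>.\<close>

lemma tame_word_Q8:
  assumes i: "Mat ii 0 0 (- ii) \<in> refl_group L Hs" and j: "Mat (- jj) 0 0 jj \<in> refl_group L Hs"
    and w: "1 \<in> L" "ww \<in> L"
  shows "tame (refl_group L Hs)"
proof -
  have "Mat (- jj * qcnj ww * ii * ww) 0 0 (jj * ww * - ii * qcnj ww) \<in> refl_group L Hs"
    by (intro refl_group_mult_diag i j refl_group_rotation w)
  moreover have "- jj * qcnj ww * ii * ww = - ii" "jj * ww * - ii * qcnj ww = 1"
    by (simp_all add: quat_consts quat_simps)
  ultimately have "diag1 (- ii) \<in> refl_group L Hs" by (simp add: diag1_Mat)
  then show ?thesis
    by (rule tameI[of _ _ 4]) (simp_all add: unitq_basic numeral_eq_Suc, simp_all add: ii_def quat_simps)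
qed

lemma qcnj_pure: "qcnj ii = - ii" "qcnj jj = - jj"
  by (simp_all add: quat_simps ii_def jj_def)

lemma tame_T_T_Q8: "tame (refl_group {1, ii, jj, ww} {})"
  by (rule tame_word_Q8)
     (use refl_group_rotation(1)[of "{1, ii, jj, ww}" ii "{}"] refl_group_rotation(2)[of "{1, ii, jj, ww}" jj "{}"]
      in \<open>simp_all add: qcnj_pure\<close>)

lemma eighth_root_rotation:
  assumes "1 \<in> L" "eighth_root \<in> L"
  shows "Mat ii 0 0 (- ii) \<in> refl_group L Hs"
proof -
  have "Mat (eighth_root * eighth_root) 0 0 (qcnj eighth_root * qcnj eighth_root) \<in> refl_group L Hs"
    by (intro refl_group_mult_diag refl_group_rotation assms)
  moreover have "eighth_root * eighth_root = ii" "qcnj eighth_root * qcnj eighth_root = - ii"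
    by (simp_all add: eighth_root_def ii_def quat_simps)
  ultimately show ?thesis by simp
qed

lemma tame_O_O_T: "tame (refl_group {1, eighth_root, eighth_root_jj, ww} {})"
proof (rule tame_word_Q8[OF eighth_root_rotation])
  have "Mat (qcnj eighth_root_jj * qcnj eighth_root_jj) 0 0 (eighth_root_jj * eighth_root_jj)
      \<in> refl_group {1, eighth_root, eighth_root_jj, ww} {}"
    by (intro refl_group_mult_diag refl_group_rotation) simp_all
  moreover have "eighth_root_jj * eighth_root_jj = jj" "qcnj eighth_root_jj * qcnj eighth_root_jj = - jj"
    by (simp_all add: eighth_root_jj_def jj_def quat_simps)
  ultimately show "Mat (- jj) 0 0 jj \<in> refl_group {1, eighth_root, eighth_root_jj, ww} {}" by simp
qed simp_all

lemma tame_O_L32_Q8: "tame (refl_group {1, eighth_root, jj, ww} {})"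
  by (rule tame_word_Q8[OF eighth_root_rotation])
     (use refl_group_rotation(2)[of "{1, eighth_root, jj, ww}" jj "{}"] in \<open>simp_all add: qcnj_pure\<close>)

text \<open>The word is trivial when each letter is conjugated, but the word itself has order
  six.\<close>

lemma tame_I_I_I: "tame (refl_group {1, ii, ww, vv} {})"
proof (rule tameI)
  \<comment> \<open>The value of the word; a unit with real part one half is a primitive sixth root of unity.\<close>
  define h where "h = Quat (1/2) (- 1/2) (1/2) (1/2)"
  let ?L = "{1, ii, ww, vv}"
  have t: "tau * (tau * x) = tau * x + x" for x
    using tau_square by (simp add: mult.assoc[symmetric] distrib_right)
  have "Mat ((ii * vv * qcnj ii) * ((vv * vv) * ww)) 0 0
      ((qcnj ii * qcnj vv * ii) * ((qcnj vv * qcnj vv) * qcnj ww)) \<in> refl_group ?L {}"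
    by (intro refl_group_mult_diag refl_group_rotation) simp_all
  moreover have "ii * vv * qcnj ii = Quat (tau / 2) (sigma / 2) (1 / 2) 0"
    "qcnj ii * qcnj vv * ii = Quat (tau / 2) (- sigma / 2) (- 1 / 2) 0"
    by (simp_all add: vv_def ii_def quat_simps)
  moreover have "vv * vv = Quat ((tau - 1) / 2) (- 1 / 2) (- tau / 2) 0"
    "qcnj vv * qcnj vv = Quat ((tau - 1) / 2) (1 / 2) (tau / 2) 0"
    using tau_square by (simp_all add: vv_def quat_simps sigma_def field_simps)
  moreover have "Quat ((tau - 1) / 2) (- 1 / 2) (- tau / 2) 0 * ww = Quat (tau / 2) (- 1 / 2) 0 ((tau - 1) / 2)"
    "Quat ((tau - 1) / 2) (1 / 2) (tau / 2) 0 * qcnj ww = Quat (tau / 2) ((1 - tau) / 2) (1 / 2) 0"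
    by (simp_all add: ww_def quat_simps field_simps)
  moreover have "Quat (tau / 2) (sigma / 2) (1 / 2) 0 * Quat (tau / 2) (- 1 / 2) 0 ((tau - 1) / 2) = h"
    "Quat (tau / 2) (- sigma / 2) (- 1 / 2) 0 * Quat (tau / 2) ((1 - tau) / 2) (1 / 2) 0 = 1"
    using tau_square by (simp_all add: h_def quat_simps sigma_def field_simps)
  ultimately show "diag1 h \<in> refl_group ?L {}" by (simp only: diag1_Mat)
  have "h * h * h = - 1" by (simp add: h_def quat_simps)
  moreover have "h ^ 6 = (h * h * h) * (h * h * h)" by (simp add: numeral_eq_Suc mult.assoc)
  ultimately show "h ^ 6 = 1" by simp
  show "unitq h" "h \<noteq> 1" "h \<noteq> - 1" by (simp_all add: h_def unitq_iff quat_simps power2_eq_square)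
qed simp

section \<open>Real quadratic fields\<close>

text \<open>In lowest terms the denominator of \<open>x\<close> divides the square of the numerator.\<close>

lemma rational_sqrt_nat:
  assumes "x \<in> \<rat>" "x * x = real n"
  shows "\<exists>m. n = m * m"
proof -
  obtain p q :: nat where pq: "q \<noteq> 0" "\<bar>x\<bar> = real p / real q" "coprime p q"
    using assms(1) by (rule Rats_abs_nat_div_natE)
  have "\<bar>x\<bar> * \<bar>x\<bar> = real n" using assms(2) by simp
  then have "real p * real p = real n * (real q * real q)"
    using pq by (simp add: field_simps)
  then have eq: "p * p = n * (q * q)"
    by (metis of_nat_eq_iff of_nat_mult)
  then have "q dvd p * p" by simp
  then have "q dvd 1" using pq(3) by (metis coprime_commute coprime_dvd_mult_left_iff dvd_refl nat_mult_1_right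
    coprime_common_divisor_nat coprime_absorb_left)
  then have "n = p * p" using eq by simp
  then show ?thesis ..
qed

lemma not_square: "2 \<noteq> m * m" "5 \<noteq> m * m" "10 \<noteq> m * m" for m :: nat
proof -
  have "m \<le> 1 \<or> m = 2 \<or> m = 3 \<or> m \<ge> 4" by arith
  moreover have "m * m \<ge> 16" if "m \<ge> 4" using mult_le_mono[OF that that] by simp
  moreover have "m * m \<le> 1" if "m \<le> 1" using mult_le_mono[OF that that] by simp
  ultimately show "2 \<noteq> m * m" "5 \<noteq> m * m" "10 \<noteq> m * m" by fastforce+
qed

lemma sqrt_irrational: "sqrt 2 \<notin> \<rat>" "sqrt 5 \<notin> \<rat>" "sqrt 10 \<notin> \<rat>"
  using rational_sqrt_nat[of "sqrt 2" 2] rational_sqrt_nat[of "sqrt 5" 5] rational_sqrt_nat[of "sqrt 10" 10]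
    not_square by auto

text \<open>The field generated by \<open>sqrt d\<close> for rational \<open>d\<close>. For \<open>d = 0\<close> it is the field of
  rational numbers.\<close>

definition qfield :: "real \<Rightarrow> real set" where
  "qfield d = {a + b * sqrt d |a b. a \<in> \<rat> \<and> b \<in> \<rat>}"

lemma qfieldI: "a \<in> \<rat> \<Longrightarrow> b \<in> \<rat> \<Longrightarrow> x = a + b * sqrt d \<Longrightarrow> x \<in> qfield d"
  unfolding qfield_def by blast

lemma qfield_Rats: "x \<in> \<rat> \<Longrightarrow> x \<in> qfield d"
  by (rule qfieldI[of x 0]) auto

lemma qfield_add: "x \<in> qfield d \<Longrightarrow> y \<in> qfield d \<Longrightarrow> x + y \<in> qfield d"
proof -
  assume "x \<in> qfield d" "y \<in> qfield d"
  then obtain a b a' b' where "a \<in> \<rat>" "b \<in> \<rat>" "x = a + b * sqrt d" "a' \<in> \<rat>" "b' \<in> \<rat>" "y = a' + b' * sqrt d"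
    unfolding qfield_def by blast
  then show ?thesis by (intro qfieldI[of "a + a'" "b + b'"]) (auto simp: algebra_simps)
qed

lemma qfield_mult: "x \<in> qfield d \<Longrightarrow> y \<in> qfield d \<Longrightarrow> d \<ge> 0 \<Longrightarrow> d \<in> \<rat> \<Longrightarrow> x * y \<in> qfield d"
proof -
  assume "x \<in> qfield d" "y \<in> qfield d" and d: "d \<ge> 0" "d \<in> \<rat>"
  then obtain a b a' b' where ab: "a \<in> \<rat>" "b \<in> \<rat>" "x = a + b * sqrt d" "a' \<in> \<rat>" "b' \<in> \<rat>" "y = a' + b' * sqrt d"
    unfolding qfield_def by blast
  have "b * sqrt d * (b' * sqrt d) = b * b' * d"
    using d by (metis mult.assoc mult.left_commute real_sqrt_mult_self abs_of_nonneg)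
  then show ?thesis using d ab by (intro qfieldI[of "a * a' + b * b' * d" "a * b' + b * a'"]) (auto simp: algebra_simps)
qed

lemma qfield_uminus: "x \<in> qfield d \<Longrightarrow> d \<ge> 0 \<Longrightarrow> d \<in> \<rat> \<Longrightarrow> - x \<in> qfield d"
  using qfield_mult[of "- 1" d x] by (simp add: qfield_Rats)

lemma qfield_diff: "x \<in> qfield d \<Longrightarrow> y \<in> qfield d \<Longrightarrow> d \<ge> 0 \<Longrightarrow> d \<in> \<rat> \<Longrightarrow> x - y \<in> qfield d"
  using qfield_add[of x d "- y"] qfield_uminus[of y d] by simp

text \<open>In \<open>(a + b * sqrt d)^2\<close> the coefficient \<open>2 * a * b\<close> of \<open>sqrt d\<close> vanishes when the
  square is rational.\<close>

lemma qfield_square_cases: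
  assumes "x \<in> qfield d" "x * x \<in> \<rat>" "d \<ge> 0" "d \<in> \<rat>" "sqrt d \<notin> \<rat>"
  shows "x \<in> \<rat> \<or> x * sqrt d \<in> \<rat>"
proof -
  obtain a b where ab: "a \<in> \<rat>" "b \<in> \<rat>" "x = a + b * sqrt d"
    using assms(1) unfolding qfield_def by blast
  have sd: "sqrt d * sqrt d = d" using assms by simp
  have "x * x = a * a + b * b * (sqrt d * sqrt d) + 2 * a * b * sqrt d"
    by (simp add: ab algebra_simps)
  then have eq: "2 * a * b * sqrt d = x * x - a * a - b * b * d" unfolding sd by linarith
  have "a * b = 0"
  proof (rule ccontr)
    assume "a * b \<noteq> 0"
    then have "sqrt d = (2 * a * b * sqrt d) / (2 * a * b)" by simp
    also have "\<dots> = (x * x - a * a - b * b * d) / (2 * a * b)" unfolding eq ..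
    also have "\<dots> \<in> \<rat>" using assms(2,4) ab by simp
    finally show False using assms(5) by simp
  qed
  moreover have "x * sqrt d = b * d" if "a = 0" using that ab(3) sd by (simp only: mult.assoc add_0)
  ultimately have "x = a \<or> x * sqrt d = b * d" using ab(3) by auto
  then show ?thesis using ab assms(4) by auto
qed

lemma sqrt5_notin_qfield2: "sqrt 5 \<notin> qfield 2"
proof
  assume "sqrt 5 \<in> qfield 2"
  then have "sqrt 5 \<in> \<rat> \<or> sqrt 5 * sqrt 2 \<in> \<rat>"
    by (rule qfield_square_cases) (use sqrt_irrational in auto)
  then show False using sqrt_irrational by (simp add: real_sqrt_mult[symmetric])
qed

definition quat_over :: "real set \<Rightarrow> quat set" where
  "quat_over F = {q. qre q \<in> F \<and> qi q \<in> F \<and> qj q \<in> F \<and> qk q \<in> F}"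

lemma quat_over_mult:
  assumes "d \<ge> 0" "d \<in> \<rat>" "p \<in> quat_over (qfield d)" "q \<in> quat_over (qfield d)"
  shows "p * q \<in> quat_over (qfield d)"
  using assms unfolding quat_over_def times_quat_def
  by (simp add: qfield_add qfield_mult qfield_diff)

lemma quat_over_qcnj:
  assumes "d \<ge> 0" "d \<in> \<rat>" "p \<in> quat_over (qfield d)"
  shows "qcnj p \<in> quat_over (qfield d)"
  using assms unfolding quat_over_def qcnj_def by (simp add: qfield_uminus)

lemma re_trace_qfield:
  assumes good: "good_gens L Hs" and d: "d \<ge> 0" "d \<in> \<rat>" and sub: "L \<union> Hs \<subseteq> quat_over (qfield d)"
  shows "re_trace ` refl_group L Hs \<subseteq> qfield d"
proof -
  have one: "1 \<in> quat_over (qfield d)"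
    by (simp add: quat_over_def one_quat_def qfield_Rats)
  have "refl_group L Hs \<subseteq> monomial_over (\<lambda>p q. p \<in> quat_over (qfield d) \<and> q \<in> quat_over (qfield d))"
    by (rule refl_group_monomial_over)
      (use good sub d one in \<open>auto simp: good_gens_def quat_over_mult quat_over_qcnj\<close>)
  moreover have "re_trace A \<in> qfield d"
    if "A \<in> monomial_over (\<lambda>p q. p \<in> quat_over (qfield d) \<and> q \<in> quat_over (qfield d))" for A
    using that by (auto simp: monomial_over_def quat_over_def qfield_add zero_quat_def qfield_Rats)
  ultimately show ?thesis by blast
qed

section \<open>Galois conjugation and the groups with twenty reflections\<close>

text \<open>The graph of the nontrivial automorphism of \<open>\<rat>(\<surd>5)\<close>. Defined as a relation, it
  requires no choice of rational coordinates.\<close>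

definition conj5 :: "real \<Rightarrow> real \<Rightarrow> bool" where
  "conj5 x y \<longleftrightarrow> (\<exists>a\<in>\<rat>. \<exists>b\<in>\<rat>. x = a + b * sqrt 5 \<and> y = a - b * sqrt 5)"

lemma conj5I: "a \<in> \<rat> \<Longrightarrow> b \<in> \<rat> \<Longrightarrow> x = a + b * sqrt 5 \<Longrightarrow> y = a - b * sqrt 5 \<Longrightarrow> conj5 x y"
  unfolding conj5_def by blast

lemma conj5E:
  assumes "conj5 x y"
  obtains a b where "a \<in> \<rat>" "b \<in> \<rat>" "x = a + b * sqrt 5" "y = a - b * sqrt 5"
  using assms unfolding conj5_def by blast

lemma conj5_Rats: "x \<in> \<rat> \<Longrightarrow> conj5 x x"
  by (rule conj5I[of x 0]) auto

lemma conj5_sym: "conj5 x y \<Longrightarrow> conj5 y x"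
  by (elim conj5E) (rule conj5I[of _ "- _"], auto)

lemma conj5_uminus: "conj5 x y \<Longrightarrow> conj5 (- x) (- y)"
  by (elim conj5E) (rule conj5I[of "- _" "- _"], auto)

lemma conj5_add:
  assumes "conj5 x y" "conj5 x' y'"
  shows "conj5 (x + x') (y + y')"
proof -
  obtain a b where 1: "a \<in> \<rat>" "b \<in> \<rat>" "x = a + b * sqrt 5" "y = a - b * sqrt 5"
    using assms(1) by (rule conj5E)
  obtain c d where 2: "c \<in> \<rat>" "d \<in> \<rat>" "x' = c + d * sqrt 5" "y' = c - d * sqrt 5"
    using assms(2) by (rule conj5E)
  show ?thesis
    by (rule conj5I[of "a + c" "b + d"]) (use 1(1,2) 2(1,2) in \<open>simp_all add: 1(3,4) 2(3,4) algebra_simps\<close>)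
qed

lemma conj5_diff: "conj5 x y \<Longrightarrow> conj5 x' y' \<Longrightarrow> conj5 (x - x') (y - y')"
  using conj5_add[of x y "- x'" "- y'"] conj5_uminus[of x' y'] by simp

lemma conj5_mult:
  assumes "conj5 x y" "conj5 x' y'"
  shows "conj5 (x * x') (y * y')"
proof -
  obtain a b where 1: "a \<in> \<rat>" "b \<in> \<rat>" "x = a + b * sqrt 5" "y = a - b * sqrt 5"
    using assms(1) by (rule conj5E)
  obtain c d where 2: "c \<in> \<rat>" "d \<in> \<rat>" "x' = c + d * sqrt 5" "y' = c - d * sqrt 5"
    using assms(2) by (rule conj5E)
  have "b * sqrt 5 * (d * sqrt 5) = 5 * (b * d)" by (simp add: algebra_simps)
  then show ?thesis
    using 1(1,2) 2(1,2)
    by (intro conj5I[of "a * c + 5 * (b * d)" "a * d + b * c"]) (auto simp: 1(3,4) 2(3,4) algebra_simps)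
qed

lemma conj5_rational:
  assumes "conj5 x y" "y \<in> \<rat>"
  shows "x = y"
proof -
  obtain a b where ab: "a \<in> \<rat>" "b \<in> \<rat>" "x = a + b * sqrt 5" "y = a - b * sqrt 5"
    using assms(1) by (rule conj5E)
  have "b = 0"
  proof (rule ccontr)
    assume "b \<noteq> 0"
    then have "sqrt 5 = (a - y) / b" using ab(4) by (simp add: field_simps)
    also have "\<dots> \<in> \<rat>" using ab(1,2) assms(2) by (intro Rats_divide Rats_diff)
    finally show False using sqrt_irrational by simp
  qed
  with ab show ?thesis by simp
qed

text \<open>The automorphism \<open>\<surd>5 \<mapsto> -\<surd>5\<close> of all coordinates, followed by the half turn
  about \<open>jj - kk\<close>, which sends \<open>ii\<close>, \<open>jj\<close>, \<open>kk\<close> to \<open>- ii\<close>, \<open>- kk\<close>, \<open>- jj\<close>. It is an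
  involution, and it conjugates each of the four generators of \<open>G_I_L20_1\<close>.\<close>

definition galois :: "quat \<Rightarrow> quat \<Rightarrow> bool" where
  "galois p q \<longleftrightarrow> conj5 (qre p) (qre q) \<and> conj5 (qi p) (- qi q) \<and> conj5 (qj p) (- qk q) \<and> conj5 (qk p) (- qj q)"

lemma galois_sym: "galois p q \<Longrightarrow> galois q p"
  unfolding galois_def by (metis conj5_sym conj5_uminus minus_minus)

lemma galois_minus: "galois p q \<Longrightarrow> galois (- p) (- q)"
  using conj5_uminus[of "qre p" "qre q"] conj5_uminus[of "qi p" "- qi q"]
    conj5_uminus[of "qj p" "- qk q"] conj5_uminus[of "qk p" "- qj q"]
  by (simp add: galois_def uminus_quat_def)

lemma galois_mult:
  assumes "galois p q" "galois p' q'"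
  shows "galois (p * p') (q * q')"
proof -
  note c = assms[unfolded galois_def]
  have "conj5 (qre p * qre p' - qi p * qi p' - qj p * qj p' - qk p * qk p')
    (qre q * qre q' - (- qi q) * (- qi q') - (- qk q) * (- qk q') - (- qj q) * (- qj q'))"
    by (intro conj5_diff conj5_mult) (use c in auto)
  moreover have "conj5 (qre p * qi p' + qi p * qre p' + qj p * qk p' - qk p * qj p')
    (qre q * (- qi q') + (- qi q) * qre q' + (- qk q) * (- qj q') - (- qj q) * (- qk q'))"
    by (intro conj5_diff conj5_mult conj5_add) (use c in auto)
  moreover have "conj5 (qre p * qj p' - qi p * qk p' + qj p * qre p' + qk p * qi p')
    (qre q * (- qk q') - (- qi q) * (- qj q') + (- qk q) * qre q' + (- qj q) * (- qi q'))"
    by (intro conj5_diff conj5_mult conj5_add) (use c in auto)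
  moreover have "conj5 (qre p * qk p' + qi p * qj p' - qj p * qi p' + qk p * qre p')
    (qre q * (- qj q') + (- qi q) * (- qk q') - (- qk q) * (- qi q') + (- qj q) * qre q')"
    by (intro conj5_diff conj5_mult conj5_add) (use c in auto)
  ultimately show ?thesis
    unfolding galois_def times_quat_def by (simp add: algebra_simps)
qed

lemma galois_one: "galois h 1 \<longleftrightarrow> h = 1"
proof
  assume "galois h 1"
  then have "conj5 (qre h) 1" "conj5 (qi h) 0" "conj5 (qj h) 0" "conj5 (qk h) 0"
    by (simp_all add: galois_def one_quat_def)
  then have "qre h = 1" "qi h = 0" "qj h = 0" "qk h = 0"
    using conj5_rational by auto
  then show "h = 1" by (cases h) (simp add: one_quat_def)
qed (simp add: galois_def one_quat_def conj5_Rats)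

lemma conj5_sigma_tau: "conj5 (sigma / 2) (tau / 2)" "conj5 (tau / 2) (sigma / 2)"
  by (rule conj5I[of "1/4" "- 1/4"], auto simp: sigma_def tau_def field_simps)
     (rule conj5I[of "1/4" "1/4"], auto simp: sigma_def tau_def field_simps)

lemma galois_gens: "q \<in> {1, ii, ww, icosian_uu} \<Longrightarrow> galois q (qcnj q)"
  by (auto simp: galois_one) (simp_all add: galois_def qcnj_def ii_def ww_def conj5_Rats conj5_sigma_tau)

lemma H_of_monomial_over:
  assumes "refl_group L Hs \<subseteq> monomial_over R" "h \<in> H_of (refl_group L Hs)"
  shows "R h 1"
proof -
  have "Mat h 0 0 1 \<in> monomial_over R" using assms by (auto simp: H_of_def diag1_Mat)
  then show ?thesis unfolding monomial_over_def by auto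
qed

text \<open>The two nonzero entries of each matrix of the group correspond under an injective
  ring homomorphism, so an entry 1 forces the other to be 1.\<close>

lemma H_of_I_L20_1: "H_of (refl_group {1, ii, ww, icosian_uu} {}) = {1}"
proof -
  have "refl_group {1, ii, ww, icosian_uu} {} \<subseteq> monomial_over galois"
    by (rule refl_group_monomial_over)
      (use good_I_L20[of "{}"] in \<open>auto simp: good_gens_def galois_sym galois_mult galois_one intro: galois_gens\<close>)
  then have "h = 1" if "h \<in> H_of (refl_group {1, ii, ww, icosian_uu} {})" for h
    using H_of_monomial_over[OF _ that] galois_one by blast
  then show ?thesis using one_in_H_of by fast
qed

lemma H_of_I_L20_C2: "H_of (refl_group {1, ii, ww, icosian_uu} {- 1}) = {1, - 1}"
proof -
  let ?R = "\<lambda>p q. galois p q \<or> galois p (- q)"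
  have "refl_group {1, ii, ww, icosian_uu} {- 1} \<subseteq> monomial_over ?R"
  proof (rule refl_group_monomial_over)
    show "unit_gens {1, ii, ww, icosian_uu} {- 1}"
      using good_I_L20[of "{- 1}"] by (simp add: good_gens_def)
    show "?R q p" if "?R p q" for p q
      using that galois_sym galois_minus by (metis minus_minus)
    show "?R (p * p') (q * q')" if "?R p q" "?R p' q'" for p q p' q'
      using that galois_mult[of p q p' q'] galois_mult[of p "- q" p' q'] galois_mult[of p q p' "- q'"]
        galois_mult[of p "- q" p' "- q'"] by auto
    have "galois (- 1) (- 1)" using galois_minus[of 1 1] by (simp add: galois_one)
    then show "?R h 1" "?R (qcnj h) 1" if "h \<in> {- 1}" for h using that by auto
  qed (use galois_gens in \<open>auto simp: galois_one\<close>)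
  then have R: "?R h 1" if "h \<in> H_of (refl_group {1, ii, ww, icosian_uu} {- 1})" for h
    using H_of_monomial_over[OF _ that] by blast
  have "h = 1 \<or> h = - 1" if "?R h 1" for h
    using that galois_minus[of h "- 1"] by (auto simp: galois_one minus_equation_iff)
  then have "H_of (refl_group {1, ii, ww, icosian_uu} {- 1}) \<subseteq> {1, - 1}"
    using R by blast
  moreover have "- 1 \<in> H_of (refl_group {1, ii, ww, icosian_uu} {- 1})"
    unfolding H_of_def using refl_group_diag1[of "- 1" "{- 1}"] by simp
  ultimately show ?thesis using one_in_H_of[of "{1, ii, ww, icosian_uu}" "{- 1}"] by (simp add: subset_antisym)
qed

section \<open>Conjugacy and non-conjugacy\<close>

lemma conjm_eqI:
  assumes "P \<in> carrier GLH2" "P ** A = B ** P"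
  shows "conjm P A = B"
proof -
  have "conjm P A = B ** (P ** inv\<^bsub>GLH2\<^esub> P)" by (simp add: conjm_def assms(2) matrix_mul_assoc)
  then show ?thesis by (simp add: inv_GLH2_right[OF assms(1)])
qed

lemma conjm_generate:
  assumes P: "P \<in> carrier GLH2" and X: "X \<subseteq> carrier GLH2"
  shows "conjm P ` generate GLH2 X = generate GLH2 (conjm P ` X)"
proof -
  have "conjm P \<in> hom GLH2 GLH2"
    by (rule homI) (simp_all add: conjm_carrier[OF P] conjm_mult[OF P])
  then have "group_hom GLH2 GLH2 (conjm P)"
    by (intro group_hom.intro group_GLH2) (simp add: group_hom_axioms_def)
  then show ?thesis using group_hom.generate_img X by metis
qed

text \<open>The columns of the matrix span the two lines of the second system of the group over
  the octahedral quaternions. In this basis \<open>antidiag jk_unit\<close> is the diagonal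
  reflection \<open>diag1 (- 1)\<close>. The three other reflections keep their form, since
  \<open>jk_unit\<close> is orthogonal to the imaginary parts of \<open>ii\<close> and \<open>ww\<close>.\<close>

lemma conjugate_O_L14_T_L12:
  "conjugate_GLH2 (refl_group {1, ii, ww, jk_unit} {}) (refl_group {1, ii, ww} {- 1})"
proof -
  let ?P = "Mat 1 jk_unit jk_unit 1" and ?h = "Quat (1/2) 0 0 0"
  \<comment> \<open>Since \<open>jk_unit\<close> squares to -1, the inverse is half the matrix with the sign of \<open>jk_unit\<close> changed.\<close>
  have P: "?P \<in> carrier GLH2"
    by (rule carrier_GLH2I[of _ "Mat ?h (- ?h * jk_unit) (- ?h * jk_unit) ?h"])
      (simp_all add: Mat_one, simp_all add: jk_unit_def quat_simps)
  have "conjm ?P (antidiag b) = antidiag b" if "b \<in> {1, ii, ww}" for b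
    by (rule conjm_eqI[OF P])
      (use that in \<open>auto simp: antidiag_Mat\<close>, simp_all add: jk_unit_def ii_def ww_def quat_simps)
  moreover have "conjm ?P (diag1 (- 1)) = antidiag jk_unit"
    by (rule conjm_eqI[OF P]) (simp add: antidiag_Mat diag1_Mat, simp add: jk_unit_def quat_simps)
  ultimately have gens: "antidiag ` {1, ii, ww, jk_unit} \<union> diag1 ` {} = conjm ?P ` (antidiag ` {1, ii, ww} \<union> diag1 ` {- 1})"
    by (simp add: insert_commute)
  have "unit_gens {1, ii, ww} {- 1}" using good_T_L12_C2 by (simp only: good_gens_def)
  then have "refl_group {1, ii, ww, jk_unit} {} = conjm ?P ` refl_group {1, ii, ww} {- 1}"
    unfolding refl_group_def gens by (rule conjm_generate[OF P gens_subset_carrier, symmetric])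
  then show ?thesis unfolding conjugate_iff using P by blast
qed

lemma re_trace_rotation: "1 \<in> L \<Longrightarrow> b \<in> L \<Longrightarrow> 2 * qre b \<in> re_trace ` refl_group L Hs"
  by (rule image_eqI[OF _ refl_group_rotation(1)[of L b Hs]]) (simp_all add: qcnj_def)

lemma qfield_0: "qfield 0 = \<rat>"
  unfolding qfield_def by auto

lemma quat_over_basic: "ii \<in> quat_over (qfield d)" "ww \<in> quat_over (qfield d)" "1 \<in> quat_over (qfield d)"
  "- 1 \<in> quat_over (qfield d)"
  by (simp_all add: quat_over_def quat_consts one_quat_def uminus_quat_def qfield_Rats)

lemma sqrt_half_qfield: "1 / sqrt 2 \<in> qfield 2" "- (1 / sqrt 2) \<in> qfield 2"
  by (rule qfieldI[of 0 "1/2"], auto simp: field_simps) (rule qfieldI[of 0 "- 1/2"], auto simp: field_simps)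

lemma quat_over_sqrt2: "eighth_root \<in> quat_over (qfield 2)" "jk_unit \<in> quat_over (qfield 2)"
  by (simp_all add: quat_over_def eighth_root_def jk_unit_def sqrt_half_qfield qfield_Rats)

lemma eighth_root_trace: "2 * qre eighth_root = sqrt 2"
  by (simp add: eighth_root_def field_simps)

lemma vv_trace: "2 * qre vv = tau"
  by (simp add: vv_def)

lemma tau_notin: "tau \<notin> \<rat>" "tau \<notin> qfield 2"
proof -
  have s: "sqrt 5 = 2 * tau - 1" by (simp add: tau_def field_simps)
  show "tau \<notin> \<rat>" using sqrt_irrational(2) unfolding s by auto
  show "tau \<notin> qfield 2"
  proof
    assume "tau \<in> qfield 2"
    then have "2 * tau - 1 \<in> qfield 2"
      using qfield_diff[OF qfield_mult[of 2 2 tau], of 1] by (simp add: qfield_Rats)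
    then show False using sqrt5_notin_qfield2 unfolding s by simp
  qed
qed

text \<open>The real traces of the first group stay in the field of its coordinates, whereas the
  second group contains the matrix with diagonal entries \<open>b\<close> and \<open>qcnj b\<close>.\<close>

lemma not_conjugate_by_field:
  assumes "good_gens L Hs" "L \<union> Hs \<subseteq> quat_over (qfield d)" "d \<ge> 0" "d \<in> \<rat>"
    and "1 \<in> L'" "b \<in> L'" "2 * qre b \<notin> qfield d"
  shows "\<not> conjugate_GLH2 (refl_group L Hs) (refl_group L' Hs')"
proof
  assume "conjugate_GLH2 (refl_group L Hs) (refl_group L' Hs')"
  then have "re_trace ` refl_group L' Hs' \<subseteq> qfield d"
    using conjugate_re_trace re_trace_qfield[OF assms(1,3,4,2)] by simp
  then show False using re_trace_rotation[OF assms(5,6)] assms(7) by blast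
qed

section \<open>The dicyclic family\<close>

text \<open>The exponential of \<open>t * ii\<close>.\<close>

definition cz :: "real \<Rightarrow> quat" where
  "cz t = Quat (cos t) (sin t) 0 0"

lemma cz_mult: "cz s * cz t = cz (s + t)"
  by (simp add: cz_def quat_simps cos_add sin_add algebra_simps)

lemma cz_jj: "cz t * jj = Quat 0 0 (cos t) (sin t)"
  by (simp add: cz_def jj_def quat_simps)

lemma jj_cz: "jj * cz t = cz (- t) * jj"
  by (simp add: cz_def jj_def quat_simps)

lemma cz_0: "cz 0 = 1"
  by (simp add: cz_def quat_simps)

lemma cz_pi: "cz pi = - 1"
  by (simp add: cz_def quat_simps)

lemma cz_2pi: "cz (2 * pi * of_int k) = 1"
  by (simp add: cz_def quat_simps)

lemma cz_power: "cz t ^ m = cz (real m * t)"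
  by (induction m) (simp_all add: cz_0 cz_mult algebra_simps)

lemma jj_square: "jj * jj = - 1"
  by (simp add: jj_def quat_simps)

lemma omega_power: "omega n ^ k = cz (real k * (pi / real n))"
proof -
  have "omega n = cz (pi / real n)" by (simp add: omega_def cz_def)
  then show ?thesis by (simp only: cz_power)
qed

lemma unitq_cz: "unitq (cz t)"
  by (simp add: unitq_iff cz_def add.commute)

lemma qcnj_cz: "qcnj (cz t) = cz (- t)"
  by (simp add: cz_def qcnj_def)

text \<open>Arbitrary integers as exponents make closure under products additive; finiteness
  comes from periodicity.\<close>

definition dicyclic :: "nat \<Rightarrow> quat set" where
  "dicyclic n = {cz (of_int k * (pi / real n)) |k. True} \<union> {cz (of_int k * (pi / real n)) * jj |k. True}"

lemma dicyclicI: "cz (of_int k * (pi / real n)) \<in> dicyclic n" "cz (of_int k * (pi / real n)) * jj \<in> dicyclic n"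
  unfolding dicyclic_def by blast+

lemma dicyclic_cases:
  assumes "p \<in> dicyclic n"
  obtains k where "p = cz (of_int k * (pi / real n))" | k where "p = cz (of_int k * (pi / real n)) * jj"
  using assms unfolding dicyclic_def by blast

lemma dicyclic_mult:
  assumes n: "n > 0" and "p \<in> dicyclic n" "q \<in> dicyclic n"
  shows "p * q \<in> dicyclic n"
proof -
  define c where "c k = cz (of_int k * (pi / real n))" for k :: int
  have cc: "c k * c l = c (k + l)" for k l by (simp add: c_def cz_mult algebra_simps add_divide_distrib)
  have jc: "jj * c k = c (- k) * jj" for k by (simp add: c_def jj_cz)
  have m1: "- 1 = c (int n)" using n by (simp add: c_def cz_pi)
  have a': "c k * (c l * jj) = c (k + l) * jj" for k l
    by (simp only: cc[symmetric] mult.assoc)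
  have b': "c k * jj * c l = c (k - l) * jj" for k l
  proof -
    have "c k * jj * c l = c k * c (- l) * jj" by (simp only: jc mult.assoc)
    then show ?thesis by (simp only: cc) simp
  qed
  have d': "c k * jj * (c l * jj) = c (k - l + int n)" for k l
  proof -
    have "c k * jj * (c l * jj) = c k * jj * c l * jj" by (simp only: mult.assoc)
    also have "\<dots> = c (k - l) * (jj * jj)" by (simp only: b') (simp only: mult.assoc)
    also have "\<dots> = c (k - l) * c (int n)" by (simp only: jj_square m1)
    finally show ?thesis by (simp only: cc)
  qed
  have mem: "c k \<in> dicyclic n" "c k * jj \<in> dicyclic n" for k
    unfolding c_def by (rule dicyclicI)+
  have "(\<exists>k. p = c k) \<or> (\<exists>k. p = c k * jj)" "(\<exists>k. q = c k) \<or> (\<exists>k. q = c k * jj)"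
    using assms(2,3) unfolding c_def dicyclic_def by blast+
  then show ?thesis
    by (elim disjE exE) (simp_all only: cc a' b' d' mem)
qed

lemma dicyclic_one: "1 \<in> dicyclic n"
  using dicyclicI(1)[of 0 n] by (simp add: cz_0)

lemma dicyclic_omega: "omega n ^ k \<in> dicyclic n"
  using dicyclicI(1)[of "int k" n] by (simp add: omega_power)

lemma dicyclic_jj: "jj \<in> dicyclic n"
  using dicyclicI(2)[of 0 n] by (simp add: cz_0)

lemma dicyclic_minus: "n > 0 \<Longrightarrow> q \<in> dicyclic n \<Longrightarrow> - q \<in> dicyclic n"
  using dicyclic_mult[of n "cz (of_int (int n) * (pi / real n))" q] dicyclicI(1)[of "int n" n]
  by (simp add: cz_pi)

lemma qcnj_cz_jj: "qcnj (cz t * jj) = - (cz t * jj)"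
  by (simp add: cz_jj qcnj_def uminus_quat_def)

lemma dicyclic_qcnj: "n > 0 \<Longrightarrow> q \<in> dicyclic n \<Longrightarrow> qcnj q \<in> dicyclic n"
proof (elim dicyclic_cases)
  fix k assume "q = cz (of_int k * (pi / real n))"
  then show "qcnj q \<in> dicyclic n"
    using dicyclicI(1)[of "- k" n] by (simp add: qcnj_cz)
next
  fix k assume "n > 0" "q = cz (of_int k * (pi / real n)) * jj"
  then show "qcnj q \<in> dicyclic n"
    using dicyclic_minus[OF _ dicyclicI(2)[of k n]] by (simp only: qcnj_cz_jj)
qed

lemma dicyclic_unitq: "q \<in> dicyclic n \<Longrightarrow> unitq q"
  by (elim dicyclic_cases) (simp_all add: unitq_cz unitq_mult unitq_basic)

lemma dicyclic_torsion:
  assumes "n > 0" "q \<in> dicyclic n"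
  shows "\<exists>m>0. q ^ m = 1"
  using assms(2)
proof (cases rule: dicyclic_cases)
  case (1 k)
  have "real (2 * n) * (of_int k * (pi / real n)) = 2 * pi * of_int k"
    using assms(1) by simp
  then have "q ^ (2 * n) = 1" unfolding 1 cz_power using cz_2pi by (simp only:)
  then show ?thesis using assms(1) by (intro exI[of _ "2 * n"]) simp
next
  case (2 k)
  then have "q * q = - 1"
    by (subst unitq_square_eq_minus_1) (simp_all add: unitq_cz unitq_mult unitq_basic, simp add: cz_jj)
  moreover have "q ^ 4 = (q * q) * (q * q)" by (simp add: numeral_eq_Suc mult.assoc)
  ultimately show ?thesis by (intro exI[of _ 4]) simp
qed

lemma finite_dicyclic:
  assumes "n > 0"
  shows "finite (dicyclic n)"
proof -
  let ?c = "\<lambda>k::int. cz (of_int k * (pi / real n))"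
  have "?c k \<in> ?c ` {0..<2 * int n}" for k
  proof
    have "of_int k * (pi / real n) =
        of_int (k mod (2 * int n)) * (pi / real n) + 2 * pi * of_int (k div (2 * int n))"
    proof -
      have "k = k mod (2 * int n) + 2 * int n * (k div (2 * int n))" by simp
      from arg_cong[OF this, of real_of_int]
      have "(of_int k :: real) = of_int (k mod (2 * int n)) + 2 * real n * of_int (k div (2 * int n))"
        by (simp only: of_int_add of_int_mult of_int_numeral of_int_of_nat_eq)
      then show ?thesis using assms by (simp add: field_simps)
    qed
    then show "?c k = ?c (k mod (2 * int n))"
      by (simp only: cz_mult[symmetric] cz_2pi mult_1_right)
  qed (use assms in simp)
  then have "dicyclic n \<subseteq> ?c ` {0..<2 * int n} \<union> (\<lambda>q. q * jj) ` ?c ` {0..<2 * int n}"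
    unfolding dicyclic_def by blast
  then show ?thesis by (rule finite_subset) simp
qed

lemma dicyclic_monomial:
  assumes n: "n > 0" and unit: "unit_gens L Hs" and sub: "L \<union> Hs \<subseteq> dicyclic n"
  shows "refl_group L Hs \<subseteq> monomial_over (\<lambda>p q. p \<in> dicyclic n \<and> q \<in> dicyclic n)"
  by (rule refl_group_monomial_over)
    (use assms in \<open>auto simp: dicyclic_mult dicyclic_qcnj dicyclic_one\<close>)

text \<open>The elements of \<open>H\<close> are entries of matrices of the group, hence lie in the dicyclic
  group and are torsion.\<close>

lemma dicyclic_tame:
  assumes n: "n > 0" and unit: "unit_gens L Hs" and sub: "L \<union> Hs \<subseteq> dicyclic n"
  shows "tame (refl_group L Hs)"
proof (cases "H_of (refl_group L Hs) \<subseteq> {1, - 1}")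
  case True
  then show ?thesis by (simp add: tame_def)
next
  case False
  then obtain h where h: "h \<in> H_of (refl_group L Hs)" "h \<noteq> 1" "h \<noteq> - 1" by blast
  have "h \<in> dicyclic n"
    using H_of_monomial_over[OF dicyclic_monomial[OF assms] h(1)] by simp
  then show ?thesis
    using h dicyclic_torsion[OF n] dicyclic_unitq unfolding tame_def by blast
qed

lemma dicyclic_traces:
  assumes n: "n > 0" and unit: "unit_gens L Hs" and sub: "L \<union> Hs \<subseteq> dicyclic n"
  shows "finite (re_trace ` refl_group L Hs)"
proof (rule finite_subset)
  let ?T = "insert 0 ((\<lambda>(p, q). qre p + qre q) ` (dicyclic n \<times> dicyclic n))"
  show "finite ?T" using finite_dicyclic[OF n] by simp
  have "re_trace A \<in> ?T" if "A \<in> monomial_over (\<lambda>p q. p \<in> dicyclic n \<and> q \<in> dicyclic n)" for A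
    using that unfolding monomial_over_def
  proof (elim UnE CollectE exE conjE)
    fix p q assume "A = Mat p 0 0 q" "p \<in> dicyclic n" "q \<in> dicyclic n"
    then show ?thesis by force
  qed (simp add: zero_quat_def)
  then show "re_trace ` refl_group L Hs \<subseteq> ?T"
    using dicyclic_monomial[OF assms] by blast
qed

definition dic_L :: "nat \<Rightarrow> nat \<Rightarrow> nat \<Rightarrow> quat set" where
  "dic_L n a b = {1, omega n ^ a, jj, omega n ^ b * jj}"

lemma jj_noncentral: "jj \<noteq> 1" "jj \<noteq> - 1"
  by (simp_all add: jj_def quat_simps)

lemma good_dic:
  assumes "n > 0" "Hs \<subseteq> dicyclic n"
  shows "good_gens (dic_L n a b) Hs" "dic_L n a b \<union> Hs \<subseteq> dicyclic n"
proof -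
  show sub: "dic_L n a b \<union> Hs \<subseteq> dicyclic n"
    using assms by (auto simp: dic_L_def dicyclic_one dicyclic_omega dicyclic_jj dicyclic_mult)
  show "good_gens (dic_L n a b) Hs"
    by (rule good_gensI[of _ _ jj])
      (use dicyclic_unitq sub in \<open>auto simp: dic_L_def jj_noncentral\<close>)
qed

lemma G_dic_eq: "G_dic n a b r = refl_group (dic_L n a b) {omega n ^ (2 * n div r)}"
  by (simp add: G_dic_def dic_L_def)

lemma G_dic_full_eq: "G_dic_full n = refl_group (dic_L n 1 1) {omega n, jj}"
  by (simp add: G_dic_full_def dic_L_def)

lemma G_dic_half_eq: "G_dic_half n = refl_group (dic_L n 1 1) {jj}"
  by (simp add: G_dic_half_def dic_L_def)

lemma full_subset: "{omega n, jj} \<subseteq> dicyclic n"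
  using dicyclic_omega[of n 1] dicyclic_jj by simp

subsection \<open>The index set\<close>

lemma Lambda_star_cases:
  assumes "(n, a, b, r) \<in> Lambda_star n" "n \<ge> 2"
  shows "1 \<le> a" "a \<le> b" "b \<le> n" "coprime a b" "r \<ge> 1" "r \<le> 2 * n" "a < n"
    "a * b * r = n \<or> odd (a * b) \<and> a * b * r = 2 * n" "(a, b, r) \<noteq> (1, n, 1)"
proof -
  have *: "(a, b) \<in> Omega_index n" "r = n div (a * b) \<or> odd (a * b) \<and> r = 2 * n div (a * b)"
    using assms unfolding Lambda_star_def Lambda_index_def by auto
  then show 1: "1 \<le> a" "a \<le> b" "b \<le> n" "coprime a b"
    by (auto simp: Omega_index_def coprime_iff_gcd_eq_1)
  have "a dvd n" "b dvd n" using * by (auto simp: Omega_index_def)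
  then have dvd: "a * b dvd n" using 1(4) by (simp add: divides_mult)
  show 2: "a * b * r = n \<or> odd (a * b) \<and> a * b * r = 2 * n"
    using *(2) dvd by (metis dvd_mult dvd_mult_div_cancel)
  then show "r \<ge> 1" using assms(2) by (cases "r = 0") auto
  have "r \<le> a * b * r" using 1 by simp
  then show "r \<le> 2 * n" using 2 by linarith
  show "a < n"
  proof (rule ccontr)
    assume "\<not> a < n"
    then have "a = n" "b = n" using 1 by simp_all
    then show False using 1(4) assms(2) by simp
  qed
  show "(a, b, r) \<noteq> (1, n, 1)" using assms unfolding Lambda_star_def by auto
qed

text \<open>For \<open>2 * a = n\<close> the divisor \<open>b\<close> of \<open>n\<close> would be \<open>a\<close> or \<open>2 * a\<close>, and coprimality
  would give \<open>a = 1\<close> and \<open>n = 2\<close>.\<close>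

lemma Lambda_star_2a:
  assumes "(n, a, b, r) \<in> Lambda_star n" "n \<ge> 3"
  shows "2 * a \<noteq> n"
proof
  note L = Lambda_star_cases[OF assms(1)]
  assume 2: "2 * a = n"
  have "b dvd n" using assms unfolding Lambda_star_def Lambda_index_def Omega_index_def by auto
  then obtain c where c: "n = b * c" by (rule dvdE)
  have "a \<le> b" "1 \<le> a" "coprime a b" using L assms(2) by simp_all
  have "c = 1 \<or> c = 2"
  proof -
    have "c \<noteq> 0" using c 2 \<open>1 \<le> a\<close> by (metis mult_0_right mult_is_0 not_one_le_zero zero_neq_numeral)
    moreover have "c \<le> 2"
    proof (rule ccontr)
      assume "\<not> c \<le> 2"
      then have "b * 3 \<le> b * c" by simp
      then show False using c 2 \<open>a \<le> b\<close> \<open>1 \<le> a\<close> by linarith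
    qed
    ultimately show ?thesis by linarith
  qed
  then have "a dvd b" using c 2 by auto
  then have "a = 1" using \<open>coprime a b\<close> by (metis coprime_absorb_left nat_dvd_1_iff_1)
  then show False using 2 assms(2) by simp
qed

subsection \<open>Systems of the dicyclic groups\<close>

lemma angle_bounds:
  assumes "0 < a" "a < n"
  shows "sin (real a * (pi / real n)) > 0"
proof (rule sin_gt_zero)
  show "0 < real a * (pi / real n)" using assms by simp
  have "real a * pi < real n * pi" using assms by simp
  then show "real a * (pi / real n) < pi" using assms by (simp add: field_simps)
qed

lemma cos_angle_zero:
  assumes "a \<le> n" "0 < n" "cos (real a * (pi / real n)) = 0"
  shows "2 * a = n"
proof -
  have "real a * pi \<le> real n * pi" using assms by simp
  then have "real a * (pi / real n) \<le> pi" using assms by (simp add: field_simps)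
  moreover have "0 \<le> real a * (pi / real n)" by simp
  moreover have "cos (real a * (pi / real n)) = cos (pi / 2)" using assms by simp
  ultimately have "real a * (pi / real n) = pi / 2"
    using cos_inj_pi[of "real a * (pi / real n)" "pi / 2"] by simp
  then have "real (2 * a) = real n" using assms(2) by (simp add: field_simps)
  then show ?thesis by (simp only: of_nat_eq_iff)
qed

lemma omega_not_real:
  assumes "0 < a" "a < n"
  shows "omega n ^ a \<noteq> 1" "omega n ^ a \<noteq> - 1"
  using angle_bounds[OF assms] by (auto simp: omega_power cz_def quat_simps)

text \<open>The diagonal generator is a power of \<open>omega n\<close> with exponent strictly between 0 and
  \<open>n\<close>.\<close>

lemma count_dic_large_r:
  assumes "(n, a, b, r) \<in> Lambda_star n" "n \<ge> 2" "r \<ge> 3"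
  shows "count_systems (G_dic n a b r) 1"
proof -
  note L = Lambda_star_cases[OF assms(1,2)]
  have "2 * n div r > 0" using L(5,6) by (simp add: div_greater_zero_iff)
  moreover have "2 * n div r < n"
  proof -
    have "2 * n div r \<le> 2 * n div 3" using assms(3) by (simp add: div_le_mono2)
    also have "\<dots> < n" using assms(2) by simp
    finally show ?thesis .
  qed
  ultimately have "omega n ^ (2 * n div r) \<noteq> 1" "omega n ^ (2 * n div r) \<noteq> - 1"
    using omega_not_real by blast+
  then show ?thesis unfolding G_dic_eq
    using assms(2) by (intro count_H_nontrivial[OF good_dic(1)]) (auto simp: dicyclic_omega)
qed

lemma omega_n: "n > 0 \<Longrightarrow> omega n ^ n = - 1" "n > 0 \<Longrightarrow> omega n ^ (2 * n) = 1"
  using cz_2pi[of 1] by (simp_all add: omega_power cz_pi)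

text \<open>Since \<open>omega n ^ a\<close> is neither real nor pure, \<open>x\<close> is orthogonal to \<open>ii\<close>. The
  generators \<open>jj\<close> and \<open>omega n ^ b * jj\<close> are unit vectors at the angle \<open>b * \<pi> / n\<close>
  in the plane of \<open>jj\<close> and \<open>kk\<close>.\<close>

lemma admissible_dic:
  assumes "(n, a, b, r) \<in> Lambda_star n" "n \<ge> 3"
  shows "x \<in> admissible (dic_L n a b) Hs \<longleftrightarrow> (\<exists>q s. x = Quat 0 0 q s \<and> (q \<noteq> 0 \<or> s \<noteq> 0) \<and>
     (q = 0 \<or> s = 0 \<and> (q = 1 \<or> q = - 1)) \<and>
     (let c = cos (real b * (pi / real n)); d = sin (real b * (pi / real n)) in
       q * c + s * d = 0 \<or> (q = c \<and> s = d) \<or> (q = - c \<and> s = - d)) \<and>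
     (\<forall>h\<in>Hs. h = 1 \<or> h = - 1 \<and> x * x = - 1))"
proof -
  have n2: "n \<ge> 2" using assms(2) by simp
  note L = Lambda_star_cases[OF assms(1) n2]
  define \<alpha> where "\<alpha> = real a * (pi / real n)"
  define \<beta> where "\<beta> = real b * (pi / real n)"
  have sa: "sin \<alpha> \<noteq> 0" unfolding \<alpha>_def using angle_bounds[of a n] L by simp
  have ca: "cos \<alpha> \<noteq> 0" unfolding \<alpha>_def
    using cos_angle_zero[of a n] L Lambda_star_2a[OF assms] assms(2) by auto
  have Lset: "dic_L n a b = {1, cz \<alpha>, jj, Quat 0 0 (cos \<beta>) (sin \<beta>)}"
    by (simp add: dic_L_def omega_power \<alpha>_def \<beta>_def cz_jj)
  have "imdot x (cz \<alpha>) = 0 \<or> cz \<alpha> = x \<or> cz \<alpha> = - x \<longleftrightarrow> qi x = 0" if "qre x = 0"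
    using that sa ca by (cases x) (auto simp: imdot_def cz_def quat_simps)
  moreover have "imdot x jj = 0 \<or> jj = x \<or> jj = - x \<longleftrightarrow> qj x = 0 \<or> qk x = 0 \<and> (qj x = 1 \<or> qj x = - 1)"
    if "qre x = 0" "qi x = 0"
    using that by (cases x) (auto simp: imdot_def jj_def quat_simps)
  moreover have "imdot x 1 = 0" by (simp add: imdot_def one_quat_def)
  moreover have "imdot x (Quat 0 0 (cos \<beta>) (sin \<beta>)) = 0 \<or> Quat 0 0 (cos \<beta>) (sin \<beta>) = x \<or> Quat 0 0 (cos \<beta>) (sin \<beta>) = - x
     \<longleftrightarrow> qj x * cos \<beta> + qk x * sin \<beta> = 0 \<or> (qj x = cos \<beta> \<and> qk x = sin \<beta>) \<or> (qj x = - cos \<beta> \<and> qk x = - sin \<beta>)"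
    if "qre x = 0" "qi x = 0"
    using that by (cases x) (auto simp: imdot_def quat_simps)
  ultimately have "x \<in> admissible (dic_L n a b) Hs \<longleftrightarrow> x \<noteq> 0 \<and> qre x = 0 \<and> qi x = 0 \<and>
     (qj x = 0 \<or> qk x = 0 \<and> (qj x = 1 \<or> qj x = - 1)) \<and>
     (qj x * cos \<beta> + qk x * sin \<beta> = 0 \<or> (qj x = cos \<beta> \<and> qk x = sin \<beta>) \<or> (qj x = - cos \<beta> \<and> qk x = - sin \<beta>)) \<and>
     (\<forall>h\<in>Hs. h = 1 \<or> h = - 1 \<and> x * x = - 1)"
    unfolding admissible_def Lset by auto
  also have "\<dots> \<longleftrightarrow> (\<exists>q s. x = Quat 0 0 q s \<and> (q \<noteq> 0 \<or> s \<noteq> 0) \<and>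
     (q = 0 \<or> s = 0 \<and> (q = 1 \<or> q = - 1)) \<and>
     (q * cos \<beta> + s * sin \<beta> = 0 \<or> (q = cos \<beta> \<and> s = sin \<beta>) \<or> (q = - cos \<beta> \<and> s = - sin \<beta>)) \<and>
     (\<forall>h\<in>Hs. h = 1 \<or> h = - 1 \<and> x * x = - 1))"
    by (cases x) (auto simp: zero_quat_def)
  finally show ?thesis unfolding Let_def \<beta>_def .
qed

lemma omega_nonpure:
  assumes "(n, a, b, r) \<in> Lambda_star n" "n \<ge> 3"
  shows "omega n ^ a \<in> dic_L n a b" "omega n ^ a \<noteq> 1" "omega n ^ a \<noteq> - 1" "qre (omega n ^ a) \<noteq> 0"
proof -
  have n2: "n \<ge> 2" using assms(2) by simp
  note L = Lambda_star_cases[OF assms(1) n2]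
  show "omega n ^ a \<in> dic_L n a b" by (simp add: dic_L_def)
  show "omega n ^ a \<noteq> 1" "omega n ^ a \<noteq> - 1" using omega_not_real[of a n] L by simp_all
  show "qre (omega n ^ a) \<noteq> 0"
    using cos_angle_zero[of a n] L Lambda_star_2a[OF assms] assms(2)
    unfolding omega_power cz_def quat.sel by linarith
qed

text \<open>The unit vectors \<open>jj\<close> and \<open>omega n ^ b * jj\<close> are parallel or orthogonal; in both
  cases exactly \<open>\<plusminus>jj\<close> and \<open>\<plusminus>kk\<close> are admissible.\<close>

lemma count_dic_three:
  assumes "(n, a, b, r) \<in> Lambda_star n" "n \<ge> 3" "b = n \<and> r = 2 \<or> 2 * b = n \<and> (r = 1 \<or> r = 2)"
  shows "count_systems (G_dic n a b r) 3"
  unfolding G_dic_eq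
proof (rule count_three[OF good_dic(1) omega_nonpure[OF assms(1,2)], where x = jj and y = kk])
  show "n > 0" "{omega n ^ (2 * n div r)} \<subseteq> dicyclic n"
    using assms(2) by (simp_all add: dicyclic_omega)
  show "jj * jj = - 1" "kk * kk = - 1" "jj \<noteq> kk" "jj \<noteq> - kk"
    by (simp_all add: jj_def kk_def quat_simps)
  have h: "omega n ^ (2 * n div r) = (if r = 1 then 1 else - 1)"
    using assms(2,3) omega_n[of n] by auto
  have cases: "r = 2 \<or> r = 1 \<and> 2 * b = n" using assms(3) by auto
  fix z
  have c: "z = jj \<or> z = - jj \<or> z = kk \<or> z = - kk \<longleftrightarrow> (\<exists>q s. z = Quat 0 0 q s \<and>
      (s = 0 \<and> (q = 1 \<or> q = - 1) \<or> q = 0 \<and> (s = 1 \<or> s = - 1)))"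
    by (auto simp: jj_def kk_def quat_simps)
  have sq: "Quat 0 0 q s * Quat 0 0 q s = - 1 \<longleftrightarrow> q * q + s * s = 1" for q s
    by (auto simp: quat_simps)
  have s1: "s * s = 1 \<longleftrightarrow> s = 1 \<or> s = - 1" for s :: real
    by (simp add: Rings.square_eq_1_iff)
  let ?\<beta> = "real b * (pi / real n)"
  have key: "(q \<noteq> 0 \<or> s \<noteq> 0) \<and> (q = 0 \<or> s = 0 \<and> (q = 1 \<or> q = - 1)) \<and>
      (let c = cos ?\<beta>; d = sin ?\<beta> in
        q * c + s * d = 0 \<or> (q = c \<and> s = d) \<or> (q = - c \<and> s = - d)) \<and>
      (\<forall>h\<in>{omega n ^ (2 * n div r)}. h = 1 \<or> h = - 1 \<and> Quat 0 0 q s * Quat 0 0 q s = - 1)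
    \<longleftrightarrow> s = 0 \<and> (q = 1 \<or> q = - 1) \<or> q = 0 \<and> (s = 1 \<or> s = - 1)" for q s
  proof (cases "b = n")
    case True
    then have "cos ?\<beta> = - 1" "sin ?\<beta> = 0" "r = 2"
      using assms(2,3) by auto
    then show ?thesis
      unfolding h sq Let_def by (cases "q = 0") (auto simp: s1)
  next
    case False
    then have b: "2 * b = n" using assms(3) by auto
    have "?\<beta> = pi / 2"
      using assms(2) by (simp add: field_simps flip: b)
    then have "cos ?\<beta> = 0" "sin ?\<beta> = 1"
      by (simp_all only: cos_pi_half sin_pi_half)
    then show ?thesis
      unfolding h sq Let_def by (cases "q = 0") (auto simp: s1)
  qed
  show "z \<in> admissible (dic_L n a b) {omega n ^ (2 * n div r)} \<longleftrightarrow> z = jj \<or> z = - jj \<or> z = kk \<or> z = - kk"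
    unfolding admissible_dic[OF assms(1,2)] c
    by (intro iff_exI conj_cong refl) (use key in simp)
qed

text \<open>Two unit vectors in a plane that are neither parallel nor orthogonal leave no
  admissible slope: a slope orthogonal or parallel to one of them is neither for the
  other.\<close>

lemma count_dic_one:
  assumes "(n, a, b, r) \<in> Lambda_star n" "n \<ge> 3" "b \<noteq> n" "2 * b \<noteq> n"
  shows "count_systems (G_dic n a b r) 1"
  unfolding G_dic_eq
proof (rule count_one[OF good_dic(1) omega_nonpure[OF assms(1,2)]])
  show "n > 0" "{omega n ^ (2 * n div r)} \<subseteq> dicyclic n"
    using assms(2) by (simp_all add: dicyclic_omega)
  have n2: "n \<ge> 2" using assms(2) by simp
  note L = Lambda_star_cases[OF assms(1) n2]
  have "sin (real b * (pi / real n)) \<noteq> 0" using angle_bounds[of b n] L assms(3) by simp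
  moreover have "cos (real b * (pi / real n)) \<noteq> 0" using cos_angle_zero[of b n] L assms(4) n2 by auto
  ultimately show "admissible (dic_L n a b) {omega n ^ (2 * n div r)} = {}"
    unfolding set_eq_iff admissible_dic[OF assms(1,2)] Let_def by auto
qed

text \<open>The antidiagonal generators come from \<open>1\<close>, \<open>ii\<close>, \<open>jj\<close>, \<open>kk\<close>. Each of the three
  imaginary units is one of them and is orthogonal to the others, and as all four
  are real or pure, the pair of slopes \<open>{1, -1}\<close> is a system as well.\<close>

lemma count_dic_five: "count_systems (G_dic 2 1 1 2) 5"
proof -
  let ?L = "{1, ii, jj, kk}"
  have w: "omega 2 = ii" by (simp add: omega_def ii_def)
  have L: "dic_L 2 1 1 = ?L"
    using w by (simp add: dic_L_def) (simp add: ii_def jj_def kk_def quat_simps)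
  have h: "omega 2 ^ (2 * 2 div 2) = - 1" using omega_n(1)[of 2] by simp
  have G: "G_dic 2 1 1 2 = refl_group ?L {- 1}" unfolding G_dic_eq h L ..
  have good: "good_gens ?L {- 1}"
    using good_dic(1)[of 2 "{- 1}" 1 1] dicyclic_minus[of 2 1] unfolding L by (simp add: dicyclic_one)
  have adm: "admissible ?L {- 1} = {ii, - ii, jj, - jj, kk, - kk}"
  proof (intro subset_antisym subsetI)
    fix x assume x: "x \<in> admissible ?L {- 1}"
    then obtain a b c where abc: "x = Quat 0 a b c" "a \<noteq> 0 \<or> b \<noteq> 0 \<or> c \<noteq> 0" by (rule admissible_cases)
    have "imdot x ii = a" "imdot x jj = b" "imdot x kk = c"
      by (simp_all add: abc imdot_def quat_consts)
    then have "a = 0 \<or> x = ii \<or> x = - ii" "b = 0 \<or> x = jj \<or> x = - jj" "c = 0 \<or> x = kk \<or> x = - kk"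
      using admissible_pure[OF x, of ii] admissible_pure[OF x, of jj] admissible_pure[OF x, of kk]
      by simp_all
    then show "x \<in> {ii, - ii, jj, - jj, kk, - kk}" using abc(2) by blast
  next
    have facts: "ii * ii = - 1" "jj * jj = - 1" "kk * kk = - 1" "imdot p 1 = 0"
      "imdot ii jj = 0" "imdot ii kk = 0" "imdot jj ii = 0" "imdot jj kk = 0" "imdot kk ii = 0" "imdot kk jj = 0"
      "imdot (- p) q = - imdot p q" "qre ii = 0" "qre jj = 0" "qre kk = 0" "qre (- q) = - qre q"
      "ii \<noteq> 0" "jj \<noteq> 0" "kk \<noteq> 0" for p q
      by (simp_all add: quat_consts quat_simps imdot_def)
    show "x \<in> admissible ?L {- 1}" if "x \<in> {ii, - ii, jj, - jj, kk, - kk}" for x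
      using that unfolding admissible_def by (elim insertE emptyE) (simp_all add: facts)
  qed
  have inv: "inverse ii = - ii" "inverse jj = - jj" "inverse kk = - kk"
    by (rule inverse_of_square_minus_one, simp add: quat_consts quat_simps)+
  have p: "pair_of (- ii) = pair_of ii" "pair_of (- jj) = pair_of jj" "pair_of (- kk) = pair_of kk"
    by (simp_all add: pair_of_eq_iff inv)
  have distinct: "pair_of ii \<noteq> pair_of jj" "pair_of ii \<noteq> pair_of kk" "pair_of jj \<noteq> pair_of kk"
    by (simp_all add: pair_of_eq_iff inv, simp_all add: quat_consts quat_simps)
  have pm: "{Line 1, Line (- 1)} \<noteq> pair_of ii" "{Line 1, Line (- 1)} \<noteq> pair_of jj" "{Line 1, Line (- 1)} \<noteq> pair_of kk"
    using pair_of_neq_pm1[of ii] pair_of_neq_pm1[of jj] pair_of_neq_pm1[of kk] by (simp_all add: quat_consts)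
  have pure: "\<forall>b\<in>?L. b = 1 \<or> b = - 1 \<or> qre b = 0" by (simp add: quat_consts)
  have "systems_of_imprimitivity (refl_group ?L {- 1}) =
      {{Line 0, Line_inf}, {Line 1, Line (- 1)}, pair_of ii, pair_of jj, pair_of kk}"
  proof (rule Set.set_eqI)
    fix S
    show "S \<in> systems_of_imprimitivity (refl_group ?L {- 1}) \<longleftrightarrow>
       S \<in> {{Line 0, Line_inf}, {Line 1, Line (- 1)}, pair_of ii, pair_of jj, pair_of kk}"
      unfolding systems_iff_good[OF good] adm using pure by (simp add: p)
  qed
  then show ?thesis unfolding G count_systems_def
    using distinct pm pm1_neq_standard[symmetric] by simp
qed

section \<open>Systems of the listed groups\<close>

text \<open>For \<open>r \<le> 2\<close> and \<open>n \<ge> 3\<close> a second system requires \<open>b = n\<close> or \<open>2 * b = n\<close>. The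
  equation \<open>a * b * r = n\<close>, or \<open>a * b * r = 2 * n\<close> with \<open>a * b\<close> odd, then leaves the
  few values of \<open>a\<close> and \<open>r\<close> that occur in the three families.\<close>

lemma dic_trichotomy:
  assumes "(n, a, b, r) \<in> Lambda_star n" "n \<ge> 2"
  shows "count_systems (G_dic n a b r) 1 \<or> G_dic n a b r \<in> family_odd \<union> family_even \<union> family_half_odd \<or>
    G_dic n a b r = G_dic 2 1 1 2"
proof -
  note L = Lambda_star_cases[OF assms]
  consider "r \<ge> 3" | "r \<le> 2" "n = 2" | "n \<ge> 3" "b \<noteq> n" "2 * b \<noteq> n"
    | "r \<le> 2" "n \<ge> 3" "b = n" | "r \<le> 2" "n \<ge> 3" "2 * b = n"
    using assms(2) by linarith
  then show ?thesis
  proof cases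
    case 1
    then show ?thesis using count_dic_large_r[OF assms] by simp
  next
    case 2
    then have "a = 1" using L(1,7) by simp
    moreover have "b \<noteq> 2"
      using L(5,8,9) 2 \<open>a = 1\<close> by auto
    then have "b = 1" using L(1-3) 2 by simp
    moreover have "r = 2" using L(8) 2 \<open>a = 1\<close> \<open>b = 1\<close> by auto
    ultimately show ?thesis using 2 by simp
  next
    case 3
    then show ?thesis using count_dic_one[OF assms(1)] by simp
  next
    case 4
    then have "a * r = 1 \<or> odd (a * n) \<and> a * r = 2" using L(8) by auto
    moreover have "r = 1 \<or> r = 2" using 4(1) L(5) by linarith
    ultimately have "a = 1 \<and> r = 1 \<or> odd n \<and> a = 1 \<and> r = 2" by auto
    then have "odd n" "a = 1" "r = 2" using L(9) 4 by auto
    then have "G_dic n a b r \<in> family_odd"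
      using 4 assms unfolding family_odd_def by blast
    then show ?thesis by simp
  next
    case 5
    then have "a * r = 2 \<or> odd (a * b) \<and> a * r = 4" using L(8) by auto
    moreover have "r = 1 \<or> r = 2" using 5(1) L(5) by linarith
    ultimately have "a = 1 \<and> r = 2 \<or> a = 2 \<and> r = 1" by auto
    then show ?thesis
    proof
      assume *: "a = 1 \<and> r = 2"
      have "b = n div 2" "even n" "n \<noteq> 2" using 5 by auto
      then have "G_dic n a b r \<in> family_even"
        using * assms unfolding family_even_def by blast
      then show ?thesis by simp
    next
      assume *: "a = 2 \<and> r = 1"
      have "b = n div 2" "even n" "odd b" using 5 L(4) * by auto
      then have "G_dic n a b r \<in> family_half_odd"
        using * assms unfolding family_half_odd_def by blast
      then show ?thesis by simp
    qed
  qed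
qed

lemma family_count_three:
  assumes "K \<in> family_odd \<union> family_even \<union> family_half_odd"
  shows "count_systems K 3" "K \<in> listed_groups"
proof -
  obtain n a b r where K: "K = G_dic n a b r" "(n, a, b, r) \<in> Lambda_star n" "n \<ge> 2" "n \<noteq> 2"
      "b = n \<and> r = 2 \<or> 2 * b = n \<and> (r = 1 \<or> r = 2)"
    using assms
  proof (elim UnE)
    assume "K \<in> family_odd"
    then obtain n where "K = G_dic n 1 n 2" "n \<ge> 2" "odd n" "(n, 1, n, 2) \<in> Lambda_star n"
      unfolding family_odd_def by blast
    then show thesis by (intro that[of n 1 n 2]) auto
  next
    assume "K \<in> family_even"
    then obtain n where "K = G_dic n 1 (n div 2) 2" "n \<ge> 2" "even n" "n \<noteq> 2" "(n, 1, n div 2, 2) \<in> Lambda_star n"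
      unfolding family_even_def by blast
    then show thesis by (intro that[of n 1 "n div 2" 2]) auto
  next
    assume "K \<in> family_half_odd"
    then obtain n where n: "K = G_dic n 2 (n div 2) 1" "n \<ge> 2" "even n" "odd (n div 2)" "(n, 2, n div 2, 1) \<in> Lambda_star n"
      unfolding family_half_odd_def by blast
    then have "n \<noteq> 2" using Lambda_star_cases(7)[OF n(5,2)] by simp
    with n show thesis by (intro that[of n 2 "n div 2" 1]) auto
  qed
  then show "count_systems K 3" using count_dic_three by simp
  have "K \<in> {G_dic n a b r | n a b r. n \<ge> 2 \<and> (n, a, b, r) \<in> Lambda_star n}" using K(1-3) by blast
  then show "K \<in> listed_groups"
    unfolding listed_groups_def by (rule UnI2[THEN UnI1, THEN UnI1, THEN UnI1])
qed

lemmas exceptional_eqs =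
  G_T_T_T_def G_T_T_Q8_def G_T_L12_C2_def G_T_L12_1_def
  G_O_O_O_def[folded eighth_root_def] G_O_O_T_def[folded eighth_root_def eighth_root_jj_def]
  G_O_L32_Q8_def[folded eighth_root_def] G_O_L20_C2_def[folded eighth_root_def jk_unit_def]
  G_O_L18_1_def[folded eighth_root_def] G_O_L14_1_def[folded jk_unit_def]
  G_I_I_I_def G_I_L32_C2_def[folded icosian_pp_def] G_I_L30_1_def G_I_L20_C2_def G_I_L20_1_def

lemma listed_groups_cases:
  assumes "K \<in> listed_groups"
  obtains (full) n where "n \<ge> 2" "K = G_dic_full n"
    | (half) n where "n \<ge> 4" "K = G_dic_half n"
    | (dic) n a b r where "n \<ge> 2" "(n, a, b, r) \<in> Lambda_star n" "K = G_dic n a b r"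
    | (one) "K \<in> {G_T_T_T, G_T_T_Q8, G_O_O_O, G_O_O_T, G_O_L32_Q8, G_I_I_I, G_I_L20_C2, G_I_L20_1}"
    | (two) "K \<in> {G_T_L12_C2, G_O_L20_C2, G_O_L14_1, G_I_L32_C2}"
    | (infinite) "K \<in> {G_T_L12_1, G_O_L18_1, G_I_L30_1}"
  using assms unfolding listed_groups_def Un_iff
proof (elim disjE)
  assume "K \<in> {G_T_T_T, G_T_T_Q8, G_T_L12_C2, G_T_L12_1}"
  then show thesis
    by (elim insertE emptyE) (simp_all add: one two infinite)
next
  assume "K \<in> {G_O_O_O, G_O_O_T, G_O_L32_Q8, G_O_L20_C2, G_O_L18_1, G_O_L14_1}"
  then show thesis
    by (elim insertE emptyE) (simp_all add: one two infinite)
next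
  assume "K \<in> {G_I_I_I, G_I_L32_C2, G_I_L30_1, G_I_L20_C2, G_I_L20_1}"
  then show thesis
    by (elim insertE emptyE) (simp_all add: one two infinite)
next
  assume "K \<in> {G_dic_full n |n. n \<ge> 2}"
  then show thesis by (elim CollectE exE conjE) (rule full)
next
  assume "K \<in> {G_dic_half n |n. even n \<and> n \<ge> 4}"
  then show thesis by (elim CollectE exE conjE) (rule half)
next
  assume "K \<in> {G_dic n a b r |n a b r. n \<ge> 2 \<and> (n, a, b, r) \<in> Lambda_star n}"
  then show thesis by (elim CollectE exE conjE) (rule dic)
qed

lemma count_full: "n \<ge> 2 \<Longrightarrow> count_systems (G_dic_full n) 1"
  unfolding G_dic_full_eq
  by (rule count_H_nontrivial[OF good_dic(1)[OF _ full_subset], of _ jj]) (simp_all add: jj_noncentral)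

lemma count_half: "n \<ge> 2 \<Longrightarrow> count_systems (G_dic_half n) 1"
  unfolding G_dic_half_eq
  by (rule count_H_nontrivial[OF good_dic(1), of _ _ jj]) (simp_all add: jj_noncentral dicyclic_jj)

lemma count_exceptional_one:
  assumes "K \<in> {G_T_T_T, G_T_T_Q8, G_O_O_O, G_O_O_T, G_O_L32_Q8, G_I_I_I, G_I_L20_C2, G_I_L20_1}"
  shows "count_systems K 1"
proof -
  have "eighth_root \<noteq> 1" "eighth_root \<noteq> - 1" by (simp_all add: eighth_root_def quat_simps)
  then have T: "count_systems (refl_group {1, ii} {ww}) 1" and O: "count_systems (refl_group {1, ww} {eighth_root}) 1"
    using count_H_nontrivial[OF good_T_T_T, of ww] count_H_nontrivial[OF good_O_O_O, of eighth_root]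
      ww_noncentral by blast+
  have I: "count_systems (refl_group {1, ii, ww, icosian_uu} {- 1}) 1"
    "count_systems (refl_group {1, ii, ww, icosian_uu} {}) 1"
    by (rule count_I_L20, simp)+
  show ?thesis
    using assms unfolding exceptional_eqs
    by (elim insertE emptyE)
      (simp_all only: T O I count_T_T_Q8 count_O_O_T count_O_L32_Q8 count_I_I_I)
qed

lemma count_exceptional_two:
  assumes "K \<in> {G_T_L12_C2, G_O_L20_C2, G_O_L14_1, G_I_L32_C2}"
  shows "count_systems K 2"
  using assms unfolding exceptional_eqs
  by (elim insertE emptyE)
    (simp_all only: count_T_L12_C2 count_O_L20_C2 count_O_L14_1 count_I_L32_C2)

lemma exceptional_infinite:
  assumes "K \<in> {G_T_L12_1, G_O_L18_1, G_I_L30_1}"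
  shows "infinite (systems_of_imprimitivity K)"
  using assms unfolding exceptional_eqs
  by (elim insertE emptyE)
    (simp_all only: infinite_T_L12_1 infinite_O_L18_1 infinite_I_L30_1 not_False_eq_True)

lemma listed_count:
  assumes "K \<in> listed_groups"
  shows "count_systems K 1 \<or> K \<in> family_odd \<union> family_even \<union> family_half_odd \<or> K = G_dic 2 1 1 2 \<or>
    K \<in> {G_T_L12_C2, G_O_L20_C2, G_O_L14_1, G_I_L32_C2} \<or> K \<in> {G_T_L12_1, G_O_L18_1, G_I_L30_1}"
  using assms
proof (cases rule: listed_groups_cases)
  case (full n)
  then show ?thesis using count_full by simp
next
  case (half n)
  then show ?thesis using count_half by simp
next
  case (dic n a b r)
  then show ?thesis using dic_trichotomy by blast
next
  case one
  then show ?thesis by (intro disjI1 count_exceptional_one)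
next
  case two
  then show ?thesis by (rule disjI1[THEN disjI2, THEN disjI2, THEN disjI2])
next
  case infinite
  then show ?thesis by (intro disjI2)
qed

definition tame_refl_group :: "(quat^2^2) set \<Rightarrow> bool" where
  "tame_refl_group K \<longleftrightarrow> (\<exists>L Hs. K = refl_group L Hs \<and> good_gens L Hs) \<and> tame K"

lemma tame_refl_groupI: "good_gens L Hs \<Longrightarrow> tame (refl_group L Hs) \<Longrightarrow> tame_refl_group (refl_group L Hs)"
  unfolding tame_refl_group_def by blast

lemma tame_dic: "n > 0 \<Longrightarrow> Hs \<subseteq> dicyclic n \<Longrightarrow> tame_refl_group (refl_group (dic_L n a b) Hs)"
  using good_dic[of n Hs a b] by (intro tame_refl_groupI dicyclic_tame) (simp_all add: good_gens_def)

lemma listed_tame: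
  assumes "K \<in> listed_groups"
  shows "tame_refl_group K"
  using assms
proof (cases rule: listed_groups_cases)
  case (full n)
  then show ?thesis unfolding full(2) G_dic_full_eq by (intro tame_dic full_subset) simp
next
  case (half n)
  then show ?thesis unfolding half(2) G_dic_half_eq by (intro tame_dic) (simp_all add: dicyclic_jj)
next
  case (dic n a b r)
  then show ?thesis unfolding dic(3) G_dic_eq by (intro tame_dic) (simp_all add: dicyclic_omega)
next
  case one
  have "tame (refl_group {1, ii, ww, icosian_uu} {})" "tame (refl_group {1, ii, ww, icosian_uu} {- 1})"
    by (simp_all add: tame_def H_of_I_L20_1 H_of_I_L20_C2)
  then show ?thesis
    using one unfolding exceptional_eqs
    by (elim insertE emptyE)
      (simp_all only: tame_refl_groupI good_T_T_T tame_T_T_T good_T_T_Q8 tame_T_T_Q8 good_O_O_O tame_O_O_O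
        good_O_O_T tame_O_O_T good_O_L32_Q8 tame_O_L32_Q8 good_I_I_I tame_I_I_I good_I_L20 empty_subsetI
        insert_subset insertI1 insertI2 simp_thms)
next
  case two
  have *: "tame_refl_group (refl_group L Hs)" if "good_gens L Hs" "count_systems (refl_group L Hs) 2" for L Hs
    using that by (intro tame_refl_groupI tame_two_systems[of L Hs 2]) simp_all
  show ?thesis
    using two unfolding exceptional_eqs
    by (elim insertE emptyE)
      (simp_all only: * good_T_L12_C2 count_T_L12_C2 good_O_L20_C2 count_O_L20_C2 good_O_L14_1 count_O_L14_1
        good_I_L32_C2 count_I_L32_C2)
next
  case infinite
  have *: "tame_refl_group (refl_group L Hs)"
    if "good_gens L Hs" "infinite (systems_of_imprimitivity (refl_group L Hs))" for L Hs
    using that by (intro tame_refl_groupI tame_infinite)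
  show ?thesis
    using infinite unfolding exceptional_eqs
    by (elim insertE emptyE)
      (simp_all only: * good_T_L12_1 infinite_T_L12_1 good_O_L18_1 infinite_O_L18_1 good_I_L30_1 infinite_I_L30_1
        not_False_eq_True)
qed

section \<open>Counting conjugacy classes\<close>

lemma listed_imprimitive: "K \<in> listed_groups \<Longrightarrow> K \<in> imprimitive_quat_refl_groups"
  unfolding imprimitive_quat_refl_groups_def using conjugate_refl by blast

lemma imprimitive_conjugate:
  "conjugate_GLH2 G K \<Longrightarrow> K \<in> imprimitive_quat_refl_groups \<Longrightarrow> G \<in> imprimitive_quat_refl_groups"
  unfolding imprimitive_quat_refl_groups_def using conjugate_trans by blast

lemma conjugate_count: "conjugate_GLH2 G K \<Longrightarrow> count_systems G m \<longleftrightarrow> count_systems K m"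
  unfolding count_systems_def using conjugate_systems(1,2) by metis

lemma groups_with_systems_iff:
  "G \<in> groups_with_systems m \<longleftrightarrow> (\<exists>K\<in>listed_groups. conjugate_GLH2 G K \<and> count_systems K m)"
proof -
  have "G \<in> groups_with_systems m \<longleftrightarrow> (\<exists>K\<in>listed_groups. conjugate_GLH2 G K) \<and> count_systems G m"
    unfolding groups_with_systems_def imprimitive_quat_refl_groups_def count_systems_def by simp
  then show ?thesis using conjugate_count by blast
qed

lemma groups_with_infinitely_many_systems_iff:
  "G \<in> groups_with_infinitely_many_systems \<longleftrightarrow>
    (\<exists>K\<in>listed_groups. conjugate_GLH2 G K \<and> infinite (systems_of_imprimitivity K))"
proof -
  have "G \<in> groups_with_infinitely_many_systems \<longleftrightarrow>
      (\<exists>K\<in>listed_groups. conjugate_GLH2 G K) \<and> infinite (systems_of_imprimitivity G)"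
    unfolding groups_with_infinitely_many_systems_def imprimitive_quat_refl_groups_def by simp
  then show ?thesis using conjugate_systems(1) by blast
qed

lemma count_unique: "count_systems K m \<Longrightarrow> count_systems K m' \<Longrightarrow> m = m'"
  by (simp add: count_systems_def)

lemma count_not_infinite: "count_systems K m \<Longrightarrow> infinite (systems_of_imprimitivity K) \<Longrightarrow> False"
  by (simp add: count_systems_def)

lemma conj_rel_class_eq:
  assumes "X \<in> imprimitive_quat_refl_groups" "Y \<in> imprimitive_quat_refl_groups"
  shows "conj_rel `` {X} = conj_rel `` {Y} \<longleftrightarrow> conjugate_GLH2 X Y"
proof
  assume "conj_rel `` {X} = conj_rel `` {Y}"
  moreover have "Y \<in> conj_rel `` {Y}" unfolding conj_rel_def using assms conjugate_refl by simp
  ultimately have "Y \<in> conj_rel `` {X}" by simp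
  then show "conjugate_GLH2 X Y" unfolding conj_rel_def by simp
next
  assume "conjugate_GLH2 X Y"
  then have "conjugate_GLH2 X Z \<longleftrightarrow> conjugate_GLH2 Y Z" for Z
    using conjugate_sym conjugate_trans by blast
  then show "conj_rel `` {X} = conj_rel `` {Y}" unfolding conj_rel_def using assms by auto
qed

lemma quotient_image: "X // conj_rel = (\<lambda>G. conj_rel `` {G}) ` X"
  unfolding quotient_def by blast

lemma quotient_classes:
  assumes "R \<subseteq> imprimitive_quat_refl_groups" "\<And>G. G \<in> X \<longleftrightarrow> (\<exists>K\<in>R. conjugate_GLH2 G K)"
  shows "X // conj_rel = (\<lambda>K. conj_rel `` {K}) ` R"
  unfolding quotient_image
proof (intro subset_antisym image_subsetI)
  fix G assume "G \<in> X"
  then obtain K where K: "K \<in> R" "conjugate_GLH2 G K" using assms(2) by blast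
  then have "conj_rel `` {G} = conj_rel `` {K}"
    using conj_rel_class_eq assms(1) imprimitive_conjugate by blast
  with K show "conj_rel `` {G} \<in> (\<lambda>K. conj_rel `` {K}) ` R" by blast
next
  fix K assume "K \<in> R"
  then have "K \<in> X" using assms(2) conjugate_refl by blast
  then show "conj_rel `` {K} \<in> (\<lambda>G. conj_rel `` {G}) ` X" by blast
qed

lemma card_quotient_three:
  assumes "{A, B, C} \<subseteq> imprimitive_quat_refl_groups"
    and "\<And>G. G \<in> X \<longleftrightarrow> (\<exists>K\<in>{A, B, C}. conjugate_GLH2 G K)"
    and "\<not> conjugate_GLH2 A B" "\<not> conjugate_GLH2 A C" "\<not> conjugate_GLH2 B C"
  shows "card (X // conj_rel) = 3"
proof -
  have "conj_rel `` {A} \<noteq> conj_rel `` {B}" "conj_rel `` {A} \<noteq> conj_rel `` {C}" "conj_rel `` {B} \<noteq> conj_rel `` {C}"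
    using assms(1,3-5) conj_rel_class_eq by auto
  then show ?thesis
    unfolding quotient_classes[OF assms(1,2)] by simp
qed

text \<open>If there were finitely many classes, infinitely many of the groups would share one
  set of real traces. That set is finite, but the cosines are pairwise different.\<close>

lemma infinite_quotient:
  fixes K :: "nat \<Rightarrow> (quat^2^2) set"
  assumes A: "infinite A" and imp: "\<And>n. n \<in> A \<Longrightarrow> K n \<in> imprimitive_quat_refl_groups"
    and pos: "\<And>n. n \<in> A \<Longrightarrow> c \<le> n" "c > 0"
    and fin: "\<And>n. n \<in> A \<Longrightarrow> finite (re_trace ` K n)"
    and mem: "\<And>n. n \<in> A \<Longrightarrow> 2 * cos (real c * (pi / real n)) \<in> re_trace ` K n"
  shows "infinite (K ` A // conj_rel)"
proof
  assume "finite (K ` A // conj_rel)"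
  then have "finite ((\<lambda>n. conj_rel `` {K n}) ` A)" unfolding quotient_image image_image .
  from pigeonhole_infinite[OF A this] obtain m where m: "m \<in> A"
    and inf: "infinite {n \<in> A. conj_rel `` {K n} = conj_rel `` {K m}}" by blast
  let ?B = "{n \<in> A. conj_rel `` {K n} = conj_rel `` {K m}}"
  let ?f = "\<lambda>n. 2 * cos (real c * (pi / real n))"
  have "?f n \<in> re_trace ` K m" if "n \<in> ?B" for n
  proof -
    have "conjugate_GLH2 (K n) (K m)" using that conj_rel_class_eq imp m by blast
    then have "re_trace ` K n = re_trace ` K m" by (rule conjugate_re_trace)
    then show ?thesis using mem[of n] that by simp
  qed
  then have "finite (?f ` ?B)"
    using finite_subset[OF _ fin[OF m]] by (metis (no_types, lifting) image_subsetI)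
  moreover have "inj_on ?f ?B"
  proof (rule inj_onI)
    fix x y assume xy: "x \<in> ?B" "y \<in> ?B" "?f x = ?f y"
    have bounds: "0 \<le> real c * (pi / real n)" "real c * (pi / real n) \<le> pi" "n > 0" if "n \<in> ?B" for n
    proof -
      have n: "c \<le> n" using pos(1) that by simp
      then show "n > 0" using pos(2) by simp
      then have "real c * pi \<le> real n * pi" using n by simp
      then show "real c * (pi / real n) \<le> pi" using \<open>n > 0\<close> by (simp add: field_simps)
    qed simp
    have "real c * (pi / real x) = real c * (pi / real y)"
      using cos_inj_pi[of "real c * (pi / real x)" "real c * (pi / real y)"] bounds xy by simp
    then show "x = y" using bounds(3)[OF xy(1)] bounds(3)[OF xy(2)] pos(2) by (simp add: field_simps)
  qed
  ultimately show False using finite_imageD inf by blast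
qed

lemma dic_traces:
  assumes "n > 0" "Hs \<subseteq> dicyclic n"
  shows "finite (re_trace ` refl_group (dic_L n a b) Hs)"
    "2 * cos (real a * (pi / real n)) \<in> re_trace ` refl_group (dic_L n a b) Hs"
proof -
  show "finite (re_trace ` refl_group (dic_L n a b) Hs)"
    using good_dic[OF assms] assms(1) by (intro dicyclic_traces) (simp_all add: good_gens_def)
  show "2 * cos (real a * (pi / real n)) \<in> re_trace ` refl_group (dic_L n a b) Hs"
    using re_trace_rotation[of "dic_L n a b" "omega n ^ a" Hs]
    unfolding omega_power cz_def by (simp add: dic_L_def omega_power cz_def)
qed


section \<open>Groups by number of systems\<close>

lemma dic_in_listed: "n \<ge> 2 \<Longrightarrow> (n, a, b, r) \<in> Lambda_star n \<Longrightarrow> G_dic n a b r \<in> listed_groups"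
  unfolding listed_groups_def by (rule UnI2[THEN UnI1, THEN UnI1, THEN UnI1]) blast

lemma full_in_listed: "n \<ge> 2 \<Longrightarrow> G_dic_full n \<in> listed_groups"
  unfolding listed_groups_def by (rule UnI1[THEN UnI1, THEN UnI1, THEN UnI1, THEN UnI1]) blast

lemma exceptional_in_listed:
  "K \<in> {G_T_T_T, G_T_T_Q8, G_T_L12_C2, G_T_L12_1} \<Longrightarrow> K \<in> listed_groups"
  "K \<in> {G_O_O_O, G_O_O_T, G_O_L32_Q8, G_O_L20_C2, G_O_L18_1, G_O_L14_1} \<Longrightarrow> K \<in> listed_groups"
  "K \<in> {G_I_I_I, G_I_L32_C2, G_I_L30_1, G_I_L20_C2, G_I_L20_1} \<Longrightarrow> K \<in> listed_groups"
  unfolding listed_groups_def by (simp_all only: Un_iff simp_thms)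

lemma two_listed: "K \<in> {G_T_L12_C2, G_O_L20_C2, G_O_L14_1, G_I_L32_C2} \<Longrightarrow> K \<in> listed_groups"
  by (elim insertE emptyE) (simp_all add: exceptional_in_listed)

lemma infinite_listed: "K \<in> {G_T_L12_1, G_O_L18_1, G_I_L30_1} \<Longrightarrow> K \<in> listed_groups"
  by (elim insertE emptyE) (simp_all add: exceptional_in_listed)

lemma family_odd_index: "odd n \<Longrightarrow> n \<ge> 3 \<Longrightarrow> (n, 1, n, 2) \<in> Lambda_star n"
  unfolding Lambda_star_def Lambda_index_def Omega_index_def by auto

lemma family_even_index: "even n \<Longrightarrow> n \<ge> 3 \<Longrightarrow> (n, 1, n div 2, 2) \<in> Lambda_star n"
  unfolding Lambda_star_def Lambda_index_def Omega_index_def by auto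

lemma family_half_odd_index: "odd m \<Longrightarrow> m \<ge> 2 \<Longrightarrow> (2 * m, 2, m, 1) \<in> Lambda_star (2 * m)"
  unfolding Lambda_star_def Lambda_index_def Omega_index_def
  by (auto simp: coprime_iff_gcd_eq_1[symmetric])

lemma five_index: "(2, 1, 1, 2) \<in> Lambda_star 2"
  unfolding Lambda_star_def Lambda_index_def Omega_index_def by auto

text \<open>The propositional step from a case distinction with mutually exclusive outcomes to
  equivalences.\<close>

lemma exclusive_cases:
  assumes "t2 \<Longrightarrow> c2" "t3 \<Longrightarrow> c3" "t5 \<Longrightarrow> c5" "ti \<Longrightarrow> ci" "c1 \<or> t3 \<or> t5 \<or> t2 \<or> ti"
    and "\<not> (c1 \<and> c2)" "\<not> (c1 \<and> c3)" "\<not> (c1 \<and> c5)" "\<not> (c2 \<and> c3)" "\<not> (c2 \<and> c5)" "\<not> (c3 \<and> c5)"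
      "\<not> (c1 \<and> ci)" "\<not> (c2 \<and> ci)" "\<not> (c3 \<and> ci)" "\<not> (c5 \<and> ci)"
  shows "c2 \<longleftrightarrow> t2" "c3 \<longleftrightarrow> t3" "c5 \<longleftrightarrow> t5" "ci \<longleftrightarrow> ti" "c1 \<or> c2 \<or> c3 \<or> c5 \<or> ci"
  using assms by blast+

lemma listed_count_iff:
  assumes "K \<in> listed_groups"
  shows "count_systems K 2 \<longleftrightarrow> K \<in> {G_T_L12_C2, G_O_L20_C2, G_O_L14_1, G_I_L32_C2}"
    and "count_systems K 3 \<longleftrightarrow> K \<in> family_odd \<union> family_even \<union> family_half_odd"
    and "count_systems K 5 \<longleftrightarrow> K = G_dic 2 1 1 2"
    and "infinite (systems_of_imprimitivity K) \<longleftrightarrow> K \<in> {G_T_L12_1, G_O_L18_1, G_I_L30_1}"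
    and "count_systems K 1 \<or> count_systems K 2 \<or> count_systems K 3 \<or> count_systems K 5 \<or>
      infinite (systems_of_imprimitivity K)"
proof -
  let ?two = "K \<in> {G_T_L12_C2, G_O_L20_C2, G_O_L14_1, G_I_L32_C2}"
    and ?three = "K \<in> family_odd \<union> family_even \<union> family_half_odd" and ?five = "K = G_dic 2 1 1 2"
    and ?inf = "K \<in> {G_T_L12_1, G_O_L18_1, G_I_L30_1}"
  have 2: "?two \<Longrightarrow> count_systems K 2" by (rule count_exceptional_two)
  have 3: "?three \<Longrightarrow> count_systems K 3" by (rule family_count_three)
  have 5: "?five \<Longrightarrow> count_systems K 5" using count_dic_five by (simp only:)
  have i: "?inf \<Longrightarrow> infinite (systems_of_imprimitivity K)" by (rule exceptional_infinite)
  have cases: "count_systems K 1 \<or> ?three \<or> ?five \<or> ?two \<or> ?inf" by (rule listed_count[OF assms])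
  have excl: "\<not> (count_systems K m \<and> count_systems K m')" if "m \<noteq> m'" for m m'
    using that count_unique by fast
  have f: "\<not> (count_systems K m \<and> infinite (systems_of_imprimitivity K))" for m
    using count_not_infinite by fast
  have e: "\<not> (count_systems K 1 \<and> count_systems K 2)" "\<not> (count_systems K 1 \<and> count_systems K 3)"
    "\<not> (count_systems K 1 \<and> count_systems K 5)" "\<not> (count_systems K 2 \<and> count_systems K 3)"
    "\<not> (count_systems K 2 \<and> count_systems K 5)" "\<not> (count_systems K 3 \<and> count_systems K 5)"
    by (rule excl, simp)+
  note exclusive = exclusive_cases[OF 2 3 5 i cases e f f f f]
  show "count_systems K 2 \<longleftrightarrow> ?two" by (rule exclusive(1))
  show "count_systems K 3 \<longleftrightarrow> ?three" by (rule exclusive(2))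
  show "count_systems K 5 \<longleftrightarrow> ?five" by (rule exclusive(3))
  show "infinite (systems_of_imprimitivity K) \<longleftrightarrow> ?inf" by (rule exclusive(4))
  show "count_systems K 1 \<or> count_systems K 2 \<or> count_systems K 3 \<or> count_systems K 5 \<or>
      infinite (systems_of_imprimitivity K)" by (rule exclusive(5))
qed

lemma H_of_two_systems:
  assumes "K \<in> listed_groups"
    and "\<exists>S\<in>systems_of_imprimitivity K. \<exists>S'\<in>systems_of_imprimitivity K. S \<noteq> S'"
  shows "H_of K = {1} \<or> H_of K = {1, - 1}"
proof -
  obtain L Hs where K: "K = refl_group L Hs" "good_gens L Hs"
    using listed_tame[OF assms(1)] unfolding tame_refl_group_def by metis
  obtain S S' where S: "S \<in> systems_of_imprimitivity K" "S' \<in> systems_of_imprimitivity K" "S \<noteq> S'"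
    using assms(2) by metis
  from two_systems_H_of[OF K(2) S[unfolded K(1)]] show ?thesis
    unfolding K(1) H_of_cases .
qed

lemma listed_H_of_iff:
  assumes "K \<in> listed_groups"
  shows "H_of K = {1} \<or> H_of K = {1, - 1} \<longleftrightarrow> (\<forall>r\<in>K. is_reflection r \<longrightarrow> group.ord GLH2 r = 2)"
proof -
  obtain L Hs where K: "K = refl_group L Hs" "good_gens L Hs" "tame K"
    using listed_tame[OF assms] unfolding tame_refl_group_def by metis
  then show ?thesis
    unfolding K(1) by (intro reflections_order_two_iff) (simp_all add: good_gens_def tame_def)
qed

lemma listed_subset_carrier: "K \<in> listed_groups \<Longrightarrow> K \<subseteq> carrier GLH2"
  using listed_tame unfolding tame_refl_group_def good_gens_def
  by (metis refl_group_subset_carrier)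

lemma two_systems_reflections:
  assumes "G \<in> imprimitive_quat_refl_groups"
    and "\<exists>S\<in>systems_of_imprimitivity G. \<exists>S'\<in>systems_of_imprimitivity G. S \<noteq> S'"
  shows "\<forall>r\<in>G. is_reflection r \<longrightarrow> group.ord GLH2 r = 2"
proof -
  obtain K where K: "K \<in> listed_groups" "conjugate_GLH2 G K"
    using assms(1) unfolding imprimitive_quat_refl_groups_def by blast
  have "H_of K = {1} \<or> H_of K = {1, - 1}"
    using assms(2) unfolding conjugate_systems(3)[OF K(2)] by (rule H_of_two_systems[OF K(1)])
  then have "\<forall>r\<in>K. is_reflection r \<longrightarrow> group.ord GLH2 r = 2"
    unfolding listed_H_of_iff[OF K(1)] .
  then show ?thesis by (rule conjugate_reflection_orders[OF K(2) listed_subset_carrier[OF K(1)]])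
qed

lemma listed_in_groups_with_systems:
  "K \<in> listed_groups \<Longrightarrow> count_systems K m \<Longrightarrow> K \<in> groups_with_systems m"
  unfolding groups_with_systems_iff using conjugate_refl by blast

lemma imprimitive_partition:
  "imprimitive_quat_refl_groups =
    groups_with_systems 1 \<union> groups_with_systems 2 \<union> groups_with_systems 3 \<union>
    groups_with_systems 5 \<union> groups_with_infinitely_many_systems"
proof (rule subset_antisym)
  show "imprimitive_quat_refl_groups \<subseteq>
    groups_with_systems 1 \<union> groups_with_systems 2 \<union> groups_with_systems 3 \<union>
    groups_with_systems 5 \<union> groups_with_infinitely_many_systems"
  proof
    fix G assume "G \<in> imprimitive_quat_refl_groups"
    then obtain K where K: "K \<in> listed_groups" "conjugate_GLH2 G K"
      unfolding imprimitive_quat_refl_groups_def by blast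
    then show "G \<in> groups_with_systems 1 \<union> groups_with_systems 2 \<union> groups_with_systems 3 \<union>
      groups_with_systems 5 \<union> groups_with_infinitely_many_systems"
      unfolding Un_iff groups_with_systems_iff groups_with_infinitely_many_systems_iff
      using listed_count_iff(5)[OF K(1)] by fast
  qed
qed (simp add: groups_with_systems_def groups_with_infinitely_many_systems_def)

lemma bex_restrict:
  assumes "\<And>K. K \<in> A \<Longrightarrow> P K \<longleftrightarrow> K \<in> R" "R \<subseteq> A"
  shows "(\<exists>K\<in>A. Q K \<and> P K) \<longleftrightarrow> (\<exists>K\<in>R. Q K)"
  using assms by blast

text \<open>Of the four listed groups with two systems, two are conjugate.\<close>

lemma groups_with_systems_2:
  "G \<in> groups_with_systems 2 \<longleftrightarrow> (\<exists>K\<in>{G_T_L12_C2, G_O_L20_C2, G_I_L32_C2}. conjugate_GLH2 G K)"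
proof -
  have O: "conjugate_GLH2 G_O_L14_1 G_T_L12_C2"
    unfolding exceptional_eqs by (rule conjugate_O_L14_T_L12)
  have "G \<in> groups_with_systems 2 \<longleftrightarrow>
      (\<exists>K\<in>{G_T_L12_C2, G_O_L20_C2, G_O_L14_1, G_I_L32_C2}. conjugate_GLH2 G K)"
    unfolding groups_with_systems_iff
    by (rule bex_restrict[OF listed_count_iff(1)]) (assumption, rule subsetI, rule two_listed)
  also have "\<dots> \<longleftrightarrow> (\<exists>K\<in>{G_T_L12_C2, G_O_L20_C2, G_I_L32_C2}. conjugate_GLH2 G K)"
    using conjugate_trans[OF _ O] by (simp only: bex_simps) fast
  finally show ?thesis .
qed

lemma groups_with_systems_3:
  "G \<in> groups_with_systems 3 \<longleftrightarrow> (\<exists>K\<in>family_odd \<union> family_even \<union> family_half_odd. conjugate_GLH2 G K)"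
  unfolding groups_with_systems_iff
  by (rule bex_restrict[OF listed_count_iff(2)]) (assumption, rule subsetI, rule family_count_three(2))

lemma groups_with_systems_5: "G \<in> groups_with_systems 5 \<longleftrightarrow> (\<exists>K\<in>{G_dic 2 1 1 2}. conjugate_GLH2 G K)"
proof -
  have "G_dic 2 1 1 2 \<in> listed_groups" by (rule dic_in_listed[OF _ five_index]) simp
  then show ?thesis
    unfolding groups_with_systems_iff
    by (intro bex_restrict) (simp_all add: listed_count_iff(3))
qed

lemma groups_with_infinitely_many:
  "G \<in> groups_with_infinitely_many_systems \<longleftrightarrow> (\<exists>K\<in>{G_T_L12_1, G_O_L18_1, G_I_L30_1}. conjugate_GLH2 G K)"
  unfolding groups_with_infinitely_many_systems_iff
  by (rule bex_restrict[OF listed_count_iff(4)]) (assumption, rule subsetI, rule infinite_listed)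

lemma traces_not_rational: "2 * qre eighth_root \<notin> qfield 0" "2 * qre vv \<notin> qfield 0" "2 * qre vv \<notin> qfield 2"
  using sqrt_irrational tau_notin by (simp_all only: eighth_root_trace vv_trace qfield_0 not_False_eq_True)

lemma card_two_systems: "card (groups_with_systems 2 // conj_rel) = 3"
proof (rule card_quotient_three[OF _ groups_with_systems_2])
  show "{G_T_L12_C2, G_O_L20_C2, G_I_L32_C2} \<subseteq> imprimitive_quat_refl_groups"
    using two_listed listed_imprimitive by simp
  show "\<not> conjugate_GLH2 G_T_L12_C2 G_O_L20_C2" unfolding exceptional_eqs
    by (rule not_conjugate_by_field[OF good_T_L12_C2 _ _ _ _ _ traces_not_rational(1)])
      (simp_all add: quat_over_basic)
  show "\<not> conjugate_GLH2 G_T_L12_C2 G_I_L32_C2" unfolding exceptional_eqs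
    by (rule not_conjugate_by_field[OF good_T_L12_C2 _ _ _ _ _ traces_not_rational(2)])
      (simp_all add: quat_over_basic)
  show "\<not> conjugate_GLH2 G_O_L20_C2 G_I_L32_C2" unfolding exceptional_eqs
    by (rule not_conjugate_by_field[OF good_O_L20_C2 _ _ _ _ _ traces_not_rational(3)])
      (simp_all add: quat_over_basic quat_over_sqrt2)
qed

lemma card_infinitely_many: "card (groups_with_infinitely_many_systems // conj_rel) = 3"
proof (rule card_quotient_three[OF _ groups_with_infinitely_many])
  show "{G_T_L12_1, G_O_L18_1, G_I_L30_1} \<subseteq> imprimitive_quat_refl_groups"
    using infinite_listed listed_imprimitive by simp
  show "\<not> conjugate_GLH2 G_T_L12_1 G_O_L18_1" unfolding exceptional_eqs
    by (rule not_conjugate_by_field[OF good_T_L12_1 _ _ _ _ _ traces_not_rational(1)])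
      (simp_all add: quat_over_basic)
  show "\<not> conjugate_GLH2 G_T_L12_1 G_I_L30_1" unfolding exceptional_eqs
    by (rule not_conjugate_by_field[OF good_T_L12_1 _ _ _ _ _ traces_not_rational(2)])
      (simp_all add: quat_over_basic)
  show "\<not> conjugate_GLH2 G_O_L18_1 G_I_L30_1" unfolding exceptional_eqs
    by (rule not_conjugate_by_field[OF good_O_L18_1 _ _ _ _ _ traces_not_rational(3)])
      (simp_all add: quat_over_basic quat_over_sqrt2)
qed

lemma card_five_systems: "card (groups_with_systems 5 // conj_rel) = 1"
proof -
  have "{G_dic 2 1 1 2} \<subseteq> imprimitive_quat_refl_groups"
    using listed_imprimitive[OF dic_in_listed[OF _ five_index]] by simp
  from quotient_classes[OF this groups_with_systems_5] show ?thesis by simp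
qed

lemma infinite_dic_quotient:
  assumes "infinite A" "\<And>n. n \<in> A \<Longrightarrow> n \<ge> 2 \<and> (n, c, b n, r) \<in> Lambda_star n"
  shows "infinite ((\<lambda>n. G_dic n c (b n) r) ` A // conj_rel)"
proof (rule infinite_quotient[where c = c, OF assms(1)])
  obtain n where "n \<in> A" using assms(1) by (metis ex_in_conv finite.emptyI)
  then show "0 < c" using Lambda_star_cases(1)[of n c "b n" r] assms(2)[of n] by simp
next
  fix n assume "n \<in> A"
  then have n: "n \<ge> 2" "(n, c, b n, r) \<in> Lambda_star n" using assms(2) by auto
  note L = Lambda_star_cases[OF n(2,1)]
  show "G_dic n c (b n) r \<in> imprimitive_quat_refl_groups"
    using n by (intro listed_imprimitive dic_in_listed)
  show "c \<le> n" using L(7) by simp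
  have "{omega n ^ (2 * n div r)} \<subseteq> dicyclic n" "n > 0" using n by (simp_all add: dicyclic_omega)
  from dic_traces[OF this(2,1)]
  show "finite (re_trace ` G_dic n c (b n) r)" "2 * cos (real c * (pi / real n)) \<in> re_trace ` G_dic n c (b n) r"
    unfolding G_dic_eq .
qed

lemma infinite_nat_unbounded: "(\<And>m. f m \<ge> m \<and> P (f m)) \<Longrightarrow> infinite {n :: nat. P n}" for f :: "nat \<Rightarrow> nat"
  unfolding infinite_nat_iff_unbounded_le by blast

lemma infinite_family_odd: "infinite (family_odd // conj_rel)"
proof -
  have "infinite {n::nat. odd n \<and> n \<ge> 3}"
    by (rule infinite_nat_unbounded[of "\<lambda>m. 2 * m + 3"]) simp
  then have "infinite ((\<lambda>n. G_dic n 1 n 2) ` {n. odd n \<and> n \<ge> 3} // conj_rel)"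
    by (rule infinite_dic_quotient) (simp add: family_odd_index[simplified])
  moreover have "family_odd = (\<lambda>n. G_dic n 1 n 2) ` {n. odd n \<and> n \<ge> 3}"
  proof (intro subset_antisym subsetI)
    fix K assume "K \<in> family_odd"
    then obtain n where n: "K = G_dic n 1 n 2" "n \<ge> 2" "odd n" unfolding family_odd_def by blast
    then have "n \<ge> 3" by (cases "n = 2") auto
    with n show "K \<in> (\<lambda>n. G_dic n 1 n 2) ` {n. odd n \<and> n \<ge> 3}" by blast
  next
    fix K assume "K \<in> (\<lambda>n. G_dic n 1 n 2) ` {n. odd n \<and> n \<ge> 3}"
    then obtain n where n: "K = G_dic n 1 n 2" "odd n" "n \<ge> 3" by blast
    then have "n \<ge> 2" by simp
    with n family_odd_index[OF n(2,3)] show "K \<in> family_odd" unfolding family_odd_def by blast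
  qed
  ultimately show ?thesis by simp
qed

lemma infinite_family_even: "infinite (family_even // conj_rel)"
proof -
  have "infinite {n::nat. even n \<and> n \<ge> 3}"
    by (rule infinite_nat_unbounded[of "\<lambda>m. 2 * m + 4"]) simp
  then have "infinite ((\<lambda>n. G_dic n 1 (n div 2) 2) ` {n. even n \<and> n \<ge> 3} // conj_rel)"
    by (rule infinite_dic_quotient) (simp add: family_even_index[simplified])
  moreover have "family_even = (\<lambda>n. G_dic n 1 (n div 2) 2) ` {n. even n \<and> n \<ge> 3}"
  proof (intro subset_antisym subsetI)
    fix K assume "K \<in> family_even"
    then obtain n where n: "K = G_dic n 1 (n div 2) 2" "n \<ge> 2" "even n" "n \<noteq> 2" unfolding family_even_def by blast
    then have "n \<ge> 3" by simp
    with n show "K \<in> (\<lambda>n. G_dic n 1 (n div 2) 2) ` {n. even n \<and> n \<ge> 3}" by blast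
  next
    fix K assume "K \<in> (\<lambda>n. G_dic n 1 (n div 2) 2) ` {n. even n \<and> n \<ge> 3}"
    then obtain n where n: "K = G_dic n 1 (n div 2) 2" "even n" "n \<ge> 3" by blast
    then have "n \<ge> 2" "n \<noteq> 2" by simp_all
    with n family_even_index[OF n(2,3)] show "K \<in> family_even" unfolding family_even_def by blast
  qed
  ultimately show ?thesis by simp
qed

lemma infinite_family_half_odd: "infinite (family_half_odd // conj_rel)"
proof -
  let ?A = "{n::nat. even n \<and> odd (n div 2) \<and> n \<ge> 4}"
  have idx: "(n, 2, n div 2, 1) \<in> Lambda_star n" if "n \<in> ?A" for n
  proof -
    have "2 \<le> n div 2" "2 * (n div 2) = n" using that by auto
    then show ?thesis using family_half_odd_index[of "n div 2"] that by simp
  qed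
  have "infinite ?A"
    by (rule infinite_nat_unbounded[of "\<lambda>m. 2 * (2 * m + 3)"]) simp
  then have "infinite ((\<lambda>n. G_dic n 2 (n div 2) 1) ` ?A // conj_rel)"
    by (rule infinite_dic_quotient) (use idx in simp)
  moreover have "family_half_odd = (\<lambda>n. G_dic n 2 (n div 2) 1) ` ?A"
  proof (intro subset_antisym subsetI)
    fix K assume "K \<in> family_half_odd"
    then obtain n where n: "K = G_dic n 2 (n div 2) 1" "n \<ge> 2" "even n" "odd (n div 2)"
      "(n, 2, n div 2, 1) \<in> Lambda_star n" unfolding family_half_odd_def by blast
    have "2 < n" using Lambda_star_cases(7)[OF n(5,2)] .
    then have "n \<in> ?A" using n by auto
    with n show "K \<in> (\<lambda>n. G_dic n 2 (n div 2) 1) ` ?A" by blast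
  next
    fix K assume "K \<in> (\<lambda>n. G_dic n 2 (n div 2) 1) ` ?A"
    then obtain n where n: "K = G_dic n 2 (n div 2) 1" "n \<in> ?A" by blast
    then have "n \<ge> 2" "even n" "odd (n div 2)" by simp_all
    with n(1) idx[OF n(2)] show "K \<in> family_half_odd" unfolding family_half_odd_def by blast
  qed
  ultimately show ?thesis by simp
qed

lemma infinite_one_system: "infinite (groups_with_systems 1 // conj_rel)"
proof -
  have "infinite (G_dic_full ` {2..} // conj_rel)"
  proof (rule infinite_quotient[where c = 1])
    fix n :: nat assume "n \<in> {2..}"
    then have n: "n \<ge> 2" "n > 0" by simp_all
    show "G_dic_full n \<in> imprimitive_quat_refl_groups"
      using n by (intro listed_imprimitive full_in_listed)
    from dic_traces[OF n(2) full_subset]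
    show "finite (re_trace ` G_dic_full n)" "2 * cos (real 1 * (pi / real n)) \<in> re_trace ` G_dic_full n"
      unfolding G_dic_full_eq .
    show "1 \<le> n" using n by simp
  qed (simp_all add: infinite_Ici)
  moreover have "G_dic_full ` {2..} \<subseteq> groups_with_systems 1"
    using listed_in_groups_with_systems full_in_listed count_full by auto
  then have "G_dic_full ` {2..} // conj_rel \<subseteq> groups_with_systems 1 // conj_rel"
    unfolding quotient_image by (rule image_mono)
  ultimately show ?thesis using infinite_super by blast
qed

theorem corollary6p1:
  shows
   "(\<forall>K \<in> listed_groups.
        (\<exists>S \<in> systems_of_imprimitivity K. \<exists>S' \<in> systems_of_imprimitivity K. S \<noteq> S') \<longrightarrow>
        H_of K = {1} \<or> H_of K = {1, -1}) \<and>
    (\<forall>K \<in> listed_groups.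
        H_of K = {1} \<or> H_of K = {1, -1} \<longleftrightarrow>
        (\<forall>r \<in> K. is_reflection r \<longrightarrow> group.ord GLH2 r = 2)) \<and>
    (\<forall>G \<in> imprimitive_quat_refl_groups.
        (\<exists>S \<in> systems_of_imprimitivity G. \<exists>S' \<in> systems_of_imprimitivity G. S \<noteq> S') \<longrightarrow>
        (\<forall>r \<in> G. is_reflection r \<longrightarrow> group.ord GLH2 r = 2)) \<and>
    H_of G_I_L20_1 = {1} \<and> G_I_L20_1 \<in> groups_with_systems 1 \<and>
    H_of G_I_L20_C2 = {1, -1} \<and> G_I_L20_C2 \<in> groups_with_systems 1 \<and>
    imprimitive_quat_refl_groups =
      groups_with_systems 1 \<union> groups_with_systems 2 \<union> groups_with_systems 3 \<union>
      groups_with_systems 5 \<union> groups_with_infinitely_many_systems \<and>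
    infinite (groups_with_systems 1 // conj_rel) \<and>
    card (groups_with_systems 2 // conj_rel) = 3 \<and>
    groups_with_systems 3 =
      {G. \<exists>K \<in> family_odd \<union> family_even \<union> family_half_odd. conjugate_GLH2 G K} \<and>
    infinite (family_odd // conj_rel) \<and>
    infinite (family_even // conj_rel) \<and>
    infinite (family_half_odd // conj_rel) \<and>
    card (groups_with_systems 5 // conj_rel) = 1 \<and>
    card (groups_with_infinitely_many_systems // conj_rel) = 3"
proof (intro conjI)
  show "\<forall>K \<in> listed_groups.
        (\<exists>S \<in> systems_of_imprimitivity K. \<exists>S' \<in> systems_of_imprimitivity K. S \<noteq> S') \<longrightarrow>
        H_of K = {1} \<or> H_of K = {1, -1}"
    by (intro ballI impI) (rule H_of_two_systems)
  show "\<forall>K \<in> listed_groups.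
        H_of K = {1} \<or> H_of K = {1, -1} \<longleftrightarrow>
        (\<forall>r \<in> K. is_reflection r \<longrightarrow> group.ord GLH2 r = 2)"
    by (intro ballI) (rule listed_H_of_iff)
  show "\<forall>G \<in> imprimitive_quat_refl_groups.
        (\<exists>S \<in> systems_of_imprimitivity G. \<exists>S' \<in> systems_of_imprimitivity G. S \<noteq> S') \<longrightarrow>
        (\<forall>r \<in> G. is_reflection r \<longrightarrow> group.ord GLH2 r = 2)"
    by (rule ballI, rule impI) (rule two_systems_reflections)
  show "H_of G_I_L20_1 = {1}" "H_of G_I_L20_C2 = {1, -1}"
    unfolding exceptional_eqs by (rule H_of_I_L20_1, rule H_of_I_L20_C2)
  show "G_I_L20_1 \<in> groups_with_systems 1" "G_I_L20_C2 \<in> groups_with_systems 1"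
    by (rule listed_in_groups_with_systems, rule exceptional_in_listed(3), simp, rule count_exceptional_one, simp)+
  show "groups_with_systems 3 =
      {G. \<exists>K \<in> family_odd \<union> family_even \<union> family_half_odd. conjugate_GLH2 G K}"
    unfolding groups_with_systems_3[symmetric] by simp
qed (rule imprimitive_partition infinite_one_system card_two_systems infinite_family_odd infinite_family_even
    infinite_family_half_odd card_five_systems card_infinitely_many)+

end
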